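(* View $\mathrm{PLie}$ as a sub-operad of $\mathrm{ST}$ via $(t,r)\mapsto(t,\mathtt{o}_{(t,r)},r)$. The operad isomorphism $\psi:\mathrm{T}\to\mathrm{PLie}\cap\mathcal{O}$, $\psi(t)=\sum_{r\in V}(t,r)$ for $t$ a tree on $V$ (where $\mathrm{PLie}\cap\mathcal{O}$ embeds in $\mathcal{O}/\mathcal{I}$, since $\mathcal{I}\cap\mathrm{PLie}=\{0\}$), extends to an operad isomorphism $\psi:\mathrm{MG}_c\to\mathcal{O}/\mathcal{I}$ satisfying, for any connected multigraph $g$ on $V$, $$\psi(g)=\Big[\sum_{r\in V}(g,\mathtt{o}_{(t(r),r)},r)\Big],$$ where for each $r\in V$, $t(r)$ is a spanning tree of $g$ and $[\cdot]$ denotes the class modulo $\mathcal{I}$. Furthermore, this isomorphism restricts to an isomorphism $\mathrm{G}_c\to(\mathcal{O}\cap\mathrm{G}^{\bullet}_{orc})/(\mathcal{I}\cap\mathrm{G}^{\bullet}_{orc})$.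
   Context: $\mathbb{K}$ is a field of characteristic $0$. A (linear) species is a functor from finite sets with bijections to $\mathbb{K}$-vector spaces. An operad is a species $O$ with $O[\emptyset]=\{0\}$, units $e(v)\in O[\{v\}]$, and natural bilinear partial compositions $\circ_*:O[V_1\sqcup\{*\}]\times O[V_2]\to O[V_1\sqcup V_2]$ satisfying the usual parallel and sequential associativity axioms and unit axioms of symmetric operads. An ideal $\mathcal{I}$ of $O$ is a sub-species with $x\circ_* y\in\mathcal{I}$ whenever one of $x,y$ is in $\mathcal{I}$ and the other in $O$; then $O/\mathcal{I}$ is an operad. A multigraph on $V$ is a finite multiset of unordered pairs of (possibly equal) elements of $V$ (edges; each edge has two ends); a graph is a multigraph without loops and without repeated edges. An oriented multigraph is a multigraph in which each end of each edge is labelled "source" or "target" (both ends of an edge may have the same label). Operad $\mathrm{MG}$: $\mathrm{MG}[V]$ ($V$ nonempty) has basis the multigraphs on $V$; $g_1\circ_*g_2$ is the sum, over all ways of reconnecting independently each edge end attached to $*$ in $g_1$ to a vertex of $V_2$, of the resulting multigraph on $V_1\sqcup V_2$. $\mathrm{T}\subset\mathrm{G}_c\subset\mathrm{MG}_c$ are its sub-operads spanned by trees, connected graphs and connected multigraphs respectively. Operad $\mathrm{MG}^{\bullet}_{or}$: $\mathrm{MG}^{\bullet}_{or}[V]$ has basis the pairs (also written as triples $(g,\mathtt{o},v)$ with $\mathtt{o}$ the orientation) of an oriented multigraph on $V$ and a vertex $v\in V$. The composition $(g_1,v_1)\circ_*(g_2,v_2)$ is the sum over all elements obtained by taking the disjoint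 union, removing $*$, connecting each loose source end to $v_2$, and connecting each loose target end independently to any vertex of $V_2$ (sum over all choices); the new root is $v_1$ if $v_1\ne *$ and $v_2$ otherwise. $\mathrm{MG}^{\bullet}_{orc}$ (resp. $\mathrm{G}^{\bullet}_{orc}$) is the sub-operad spanned by the elements whose underlying multigraph is connected (resp. is a connected graph). Operad $\mathrm{PLie}$: $\mathrm{PLie}[V]$ has basis the rooted trees $(t,r)$ on $V$; $t_1\circ_*t_2$ is the sum over all rooted trees obtained by taking the disjoint union, removing $*$, adding an edge between the parent of $*$ (if any) and the root of $t_2$ and, for each child of $*$, an edge between this child and any vertex of $t_2$; the root is that of $t_1$ if it is not $*$, and that of $t_2$ otherwise. For a connected multigraph $g$ on $V$, a spanning tree $t$ of $g$ and $r\in V$, $\mathtt{o}_{(t,r)}$ is the orientation of $g$ in which, for each edge of $t$, the end nearer to $r$ in $t$ is a target and the other end is a source, and in which both ends of every edge not in $t$ are targets. Sub-species of $\mathrm{MG}^{\bullet}_{orc}$ (linear spans): $\mathrm{ST}[V]=\mathbb{K}\{(g,\mathtt{o}_{(t,r)},r)\}$ over all connected multigraphs $g$ on $V$, $r\in V$, $t$ a spanning tree of $g$; $\mathcal{O}[V]=\mathbb{K}\{\sum_{r\in V}(g,\mathtt{o}_{(t(r),r)},r)\}$ over all connected multigraphs $g$ on $V$ and all choices, for each $r\in V$, of a spanning tree $t(r)$ of $g$; $\mathcal{I}[V]=\mathbb{K}\{(g,\mathtt{o}_{(t_1,r)},r)-(g,\mathtt{o}_{(t_2,r)},r)\}$ over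 all connected multigraphs $g$ on $V$, $r\in V$, and spanning trees $t_1,t_2$ of $g$. $\mathrm{ST}$ is a sub-operad of $\mathrm{MG}^{\bullet}_{orc}$, $\mathcal{O}$ is a sub-operad of $\mathrm{ST}$, and $\mathcal{I}$ is an ideal of $\mathcal{O}$. *)

theory Defs
  imports Complex_Main "HOL-Library.Uprod" "HOL-Library.Multiset" "HOL-Library.FuncSet"
    "HOL-Library.Poly_Mapping"
begin

section \<open>Species, operads, ideals and quotients\<close>

text \<open>
  Finite sets are finite subsets of a type \<open>'v\<close> of labels.  A species comes with explicit vector
  space operations on each of its components, because the components of a quotient species are
  made of cosets.  \<open>relabel P V \<sigma>\<close> is the image under the functor of the bijection
  \<open>\<sigma> : V \<rightarrow> \<sigma> ` V\<close>, and \<open>pcomp P V1 V2 s\<close> is the partial composition at \<open>s\<close>,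
  from \<open>P[V1 \<squnion> {s}] \<times> P[V2]\<close> to \<open>P[V1 \<squnion> V2]\<close>.  Since only \<open>s \<notin> V1\<close> and
  \<open>V1 \<inter> V2 = {}\<close> are needed for these unions to be disjoint, \<open>s \<in> V2\<close> is allowed.
\<close>

record ('v, 'k, 'e) operad_data =
  space :: "'v set \<Rightarrow> 'e set"
  vzero :: "'v set \<Rightarrow> 'e"
  vadd :: "'v set \<Rightarrow> 'e \<Rightarrow> 'e \<Rightarrow> 'e"
  vsmult :: "'v set \<Rightarrow> 'k \<Rightarrow> 'e \<Rightarrow> 'e"
  relabel :: "'v set \<Rightarrow> ('v \<Rightarrow> 'v) \<Rightarrow> 'e \<Rightarrow> 'e"
  ident :: "'v \<Rightarrow> 'e"
  pcomp :: "'v set \<Rightarrow> 'v set \<Rightarrow> 'v \<Rightarrow> 'e \<Rightarrow> 'e \<Rightarrow> 'e"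

locale vector_space_on =
  fixes S :: "'e set" and z :: 'e and add :: "'e \<Rightarrow> 'e \<Rightarrow> 'e"
    and scl :: "'k::field \<Rightarrow> 'e \<Rightarrow> 'e"
  assumes zero_closed: "z \<in> S"
    and add_closed: "\<lbrakk>x \<in> S; y \<in> S\<rbrakk> \<Longrightarrow> add x y \<in> S"
    and scl_closed: "x \<in> S \<Longrightarrow> scl c x \<in> S"
    and add_assoc: "\<lbrakk>x \<in> S; y \<in> S; w \<in> S\<rbrakk> \<Longrightarrow> add (add x y) w = add x (add y w)"
    and add_commute: "\<lbrakk>x \<in> S; y \<in> S\<rbrakk> \<Longrightarrow> add x y = add y x"
    and add_zero: "x \<in> S \<Longrightarrow> add z x = x"
    and add_inverse: "x \<in> S \<Longrightarrow> \<exists>y\<in>S. add x y = z"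
    and scl_add: "\<lbrakk>x \<in> S; y \<in> S\<rbrakk> \<Longrightarrow> scl c (add x y) = add (scl c x) (scl c y)"
    and add_scl: "x \<in> S \<Longrightarrow> scl (c + d) x = add (scl c x) (scl d x)"
    and scl_scl: "x \<in> S \<Longrightarrow> scl c (scl d x) = scl (c * d) x"
    and scl_one: "x \<in> S \<Longrightarrow> scl 1 x = x"

locale species =
  fixes P :: "('v, 'k::field, 'e) operad_data"
  assumes vector_space_on:
      "finite V \<Longrightarrow> vector_space_on (space P V) (vzero P V) (vadd P V) (vsmult P V)"
    and relabel_closed:
      "\<lbrakk>finite V; inj_on \<sigma> V; x \<in> space P V\<rbrakk> \<Longrightarrow> relabel P V \<sigma> x \<in> space P (\<sigma> ` V)"
    and relabel_add:
      "\<lbrakk>finite V; inj_on \<sigma> V; x \<in> space P V; y \<in> space P V\<rbrakk> \<Longrightarrow>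
        relabel P V \<sigma> (vadd P V x y) = vadd P (\<sigma> ` V) (relabel P V \<sigma> x) (relabel P V \<sigma> y)"
    and relabel_smult:
      "\<lbrakk>finite V; inj_on \<sigma> V; x \<in> space P V\<rbrakk> \<Longrightarrow>
        relabel P V \<sigma> (vsmult P V c x) = vsmult P (\<sigma> ` V) c (relabel P V \<sigma> x)"
    and relabel_cong:
      "\<lbrakk>finite V; inj_on \<sigma> V; \<And>v. v \<in> V \<Longrightarrow> \<sigma> v = \<tau> v; x \<in> space P V\<rbrakk> \<Longrightarrow>
        relabel P V \<sigma> x = relabel P V \<tau> x"
    and relabel_id: "\<lbrakk>finite V; x \<in> space P V\<rbrakk> \<Longrightarrow> relabel P V id x = x"
    and relabel_comp:
      "\<lbrakk>finite V; inj_on \<sigma> V; inj_on \<tau> (\<sigma> ` V); x \<in> space P V\<rbrakk> \<Longrightarrow>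
        relabel P (\<sigma> ` V) \<tau> (relabel P V \<sigma> x) = relabel P V (\<tau> \<circ> \<sigma>) x"

locale operad = species P for P :: "('v, 'k::field, 'e) operad_data" +
  assumes space_empty: "space P {} = {vzero P {}}"
    and ident_closed: "ident P v \<in> space P {v}"
    and ident_natural: "relabel P {v} \<sigma> (ident P v) = ident P (\<sigma> v)"
    and pcomp_closed:
      "\<lbrakk>finite V1; finite V2; V1 \<inter> V2 = {}; s \<notin> V1; x \<in> space P (insert s V1); y \<in> space P V2\<rbrakk> \<Longrightarrow>
        pcomp P V1 V2 s x y \<in> space P (V1 \<union> V2)"
    and pcomp_add_left:
      "\<lbrakk>finite V1; finite V2; V1 \<inter> V2 = {}; s \<notin> V1;
        x \<in> space P (insert s V1); x' \<in> space P (insert s V1); y \<in> space P V2\<rbrakk> \<Longrightarrow>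
        pcomp P V1 V2 s (vadd P (insert s V1) x x') y =
        vadd P (V1 \<union> V2) (pcomp P V1 V2 s x y) (pcomp P V1 V2 s x' y)"
    and pcomp_smult_left:
      "\<lbrakk>finite V1; finite V2; V1 \<inter> V2 = {}; s \<notin> V1; x \<in> space P (insert s V1); y \<in> space P V2\<rbrakk> \<Longrightarrow>
        pcomp P V1 V2 s (vsmult P (insert s V1) c x) y =
        vsmult P (V1 \<union> V2) c (pcomp P V1 V2 s x y)"
    and pcomp_add_right:
      "\<lbrakk>finite V1; finite V2; V1 \<inter> V2 = {}; s \<notin> V1;
        x \<in> space P (insert s V1); y \<in> space P V2; y' \<in> space P V2\<rbrakk> \<Longrightarrow>
        pcomp P V1 V2 s x (vadd P V2 y y') =
        vadd P (V1 \<union> V2) (pcomp P V1 V2 s x y) (pcomp P V1 V2 s x y')"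
    and pcomp_smult_right:
      "\<lbrakk>finite V1; finite V2; V1 \<inter> V2 = {}; s \<notin> V1; x \<in> space P (insert s V1); y \<in> space P V2\<rbrakk> \<Longrightarrow>
        pcomp P V1 V2 s x (vsmult P V2 c y) = vsmult P (V1 \<union> V2) c (pcomp P V1 V2 s x y)"
    and pcomp_natural:
      "\<lbrakk>finite V1; finite V2; V1 \<inter> V2 = {}; s \<notin> V1; inj_on \<sigma> (insert s V1); inj_on \<tau> V2;
        \<sigma> ` V1 \<inter> \<tau> ` V2 = {}; x \<in> space P (insert s V1); y \<in> space P V2\<rbrakk> \<Longrightarrow>
        relabel P (V1 \<union> V2) (\<lambda>v. if v \<in> V1 then \<sigma> v else \<tau> v) (pcomp P V1 V2 s x y) =
        pcomp P (\<sigma> ` V1) (\<tau> ` V2) (\<sigma> s) (relabel P (insert s V1) \<sigma> x) (relabel P V2 \<tau> y)"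
    and pcomp_parallel:
      "\<lbrakk>finite V1; finite V2; finite V3; V1 \<inter> V2 = {}; V1 \<inter> V3 = {}; V2 \<inter> V3 = {};
        s \<noteq> u; s \<notin> V1 \<union> V3; u \<notin> V1 \<union> V2;
        x \<in> space P (insert s (insert u V1)); y \<in> space P V2; z \<in> space P V3\<rbrakk> \<Longrightarrow>
        pcomp P (V1 \<union> V2) V3 u (pcomp P (insert u V1) V2 s x y) z =
        pcomp P (V1 \<union> V3) V2 s (pcomp P (insert s V1) V3 u x z) y"
    and pcomp_sequential:
      "\<lbrakk>finite V1; finite V2; finite V3; V1 \<inter> V2 = {}; V1 \<inter> V3 = {}; V2 \<inter> V3 = {};
        s \<notin> V1; u \<notin> V1 \<union> V2;
        x \<in> space P (insert s V1); y \<in> space P (insert u V2); z \<in> space P V3\<rbrakk> \<Longrightarrow>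
        pcomp P (V1 \<union> V2) V3 u (pcomp P V1 (insert u V2) s x y) z =
        pcomp P V1 (V2 \<union> V3) s x (pcomp P V2 V3 u y z)"
    and ident_left: "\<lbrakk>finite V; x \<in> space P V\<rbrakk> \<Longrightarrow> pcomp P {} V s (ident P s) x = x"
    and ident_right:
      "\<lbrakk>finite V; s \<notin> V; v \<notin> V; x \<in> space P (insert s V)\<rbrakk> \<Longrightarrow>
        pcomp P V {v} s x (ident P v) = relabel P (insert s V) (id(s := v)) x"

definition operad_hom ::
    "('v, 'k::field, 'e) operad_data \<Rightarrow> ('v, 'k, 'f) operad_data \<Rightarrow> ('v set \<Rightarrow> 'e \<Rightarrow> 'f) \<Rightarrow> bool" where
  "operad_hom P Q f \<longleftrightarrow> operad P \<and> operad Q \<and>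
    (\<forall>V. finite V \<longrightarrow>
      (\<forall>x\<in>space P V. f V x \<in> space Q V) \<and>
      (\<forall>x\<in>space P V. \<forall>y\<in>space P V. f V (vadd P V x y) = vadd Q V (f V x) (f V y)) \<and>
      (\<forall>c. \<forall>x\<in>space P V. f V (vsmult P V c x) = vsmult Q V c (f V x)) \<and>
      (\<forall>\<sigma>. inj_on \<sigma> V \<longrightarrow>
        (\<forall>x\<in>space P V. f (\<sigma> ` V) (relabel P V \<sigma> x) = relabel Q V \<sigma> (f V x)))) \<and>
    (\<forall>v. f {v} (ident P v) = ident Q v) \<and>
    (\<forall>V1 V2 s. finite V1 \<longrightarrow> finite V2 \<longrightarrow> V1 \<inter> V2 = {} \<longrightarrow> s \<notin> V1 \<longrightarrow>
      (\<forall>x\<in>space P (insert s V1). \<forall>y\<in>space P V2.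
        f (V1 \<union> V2) (pcomp P V1 V2 s x y) = pcomp Q V1 V2 s (f (insert s V1) x) (f V2 y)))"

definition operad_embedding ::
    "('v, 'k::field, 'e) operad_data \<Rightarrow> ('v, 'k, 'f) operad_data \<Rightarrow> ('v set \<Rightarrow> 'e \<Rightarrow> 'f) \<Rightarrow> bool" where
  "operad_embedding P Q f \<longleftrightarrow>
    operad_hom P Q f \<and> (\<forall>V. finite V \<longrightarrow> inj_on (f V) (space P V))"

definition operad_iso ::
    "('v, 'k::field, 'e) operad_data \<Rightarrow> ('v, 'k, 'f) operad_data \<Rightarrow> ('v set \<Rightarrow> 'e \<Rightarrow> 'f) \<Rightarrow> bool" where
  "operad_iso P Q f \<longleftrightarrow>
    operad_hom P Q f \<and> (\<forall>V. finite V \<longrightarrow> bij_betw (f V) (space P V) (space Q V))"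

definition sub_data ::
    "('v, 'k, 'e) operad_data \<Rightarrow> ('v set \<Rightarrow> 'e set) \<Rightarrow> ('v, 'k, 'e) operad_data" where
  "sub_data P S = P\<lparr>space := S\<rparr>"

definition subspecies :: "('v, 'k::field, 'e) operad_data \<Rightarrow> ('v set \<Rightarrow> 'e set) \<Rightarrow> bool" where
  "subspecies P S \<longleftrightarrow>
    (\<forall>V. finite V \<longrightarrow> S V \<subseteq> space P V \<and> vzero P V \<in> S V \<and>
      (\<forall>x\<in>S V. \<forall>y\<in>S V. vadd P V x y \<in> S V) \<and>
      (\<forall>c. \<forall>x\<in>S V. vsmult P V c x \<in> S V) \<and>
      (\<forall>\<sigma>. inj_on \<sigma> V \<longrightarrow> (\<forall>x\<in>S V. relabel P V \<sigma> x \<in> S (\<sigma> ` V))))"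

definition operad_ideal :: "('v, 'k::field, 'e) operad_data \<Rightarrow> ('v set \<Rightarrow> 'e set) \<Rightarrow> bool" where
  "operad_ideal P I \<longleftrightarrow> operad P \<and> subspecies P I \<and>
    (\<forall>V1 V2 s. finite V1 \<longrightarrow> finite V2 \<longrightarrow> V1 \<inter> V2 = {} \<longrightarrow> s \<notin> V1 \<longrightarrow>
      (\<forall>x\<in>space P (insert s V1). \<forall>y\<in>space P V2.
        x \<in> I (insert s V1) \<or> y \<in> I V2 \<longrightarrow> pcomp P V1 V2 s x y \<in> I (V1 \<union> V2)))"

definition coset ::
    "('v, 'k, 'e) operad_data \<Rightarrow> ('v set \<Rightarrow> 'e set) \<Rightarrow> 'v set \<Rightarrow> 'e \<Rightarrow> 'e set" where
  "coset P I V x = {vadd P V x i | i. i \<in> I V}"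

text \<open>
  The operations of the quotient are those induced on representatives.  They are written as unions
  over all representatives; for an ideal, all the sets in each union coincide.
\<close>

definition quotient ::
    "('v, 'k, 'e) operad_data \<Rightarrow> ('v set \<Rightarrow> 'e set) \<Rightarrow> ('v, 'k, 'e set) operad_data" where
  "quotient P I =
    \<lparr>space = (\<lambda>V. coset P I V ` space P V),
     vzero = (\<lambda>V. coset P I V (vzero P V)),
     vadd = (\<lambda>V X Y. \<Union>x\<in>X. \<Union>y\<in>Y. coset P I V (vadd P V x y)),
     vsmult = (\<lambda>V c X. \<Union>x\<in>X. coset P I V (vsmult P V c x)),
     relabel = (\<lambda>V \<sigma> X. \<Union>x\<in>X. coset P I (\<sigma> ` V) (relabel P V \<sigma> x)),
     ident = (\<lambda>v. coset P I {v} (ident P v)),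
     pcomp = (\<lambda>V1 V2 s X Y. \<Union>x\<in>X. \<Union>y\<in>Y. coset P I (V1 \<union> V2) (pcomp P V1 V2 s x y))\<rparr>"

text \<open>
  For a sub-operad \<open>P'\<close> of \<open>P\<close> and an ideal \<open>I'\<close> of \<open>P'\<close> contained in the ideal \<open>I\<close> of \<open>P\<close>, this is
  the map from \<open>P'/I'\<close> to \<open>P/I\<close> induced by the inclusion, sending the class of \<open>x\<close> modulo \<open>I'\<close> to
  the class of \<open>x\<close> modulo \<open>I\<close>.
\<close>

definition coset_incl ::
    "('v, 'k, 'e) operad_data \<Rightarrow> ('v set \<Rightarrow> 'e set) \<Rightarrow> 'v set \<Rightarrow> 'e set \<Rightarrow> 'e set" where
  "coset_incl P I V X = (\<Union>x\<in>X. coset P I V x)"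


section \<open>Free vector spaces\<close>

definition smul :: "'k::field \<Rightarrow> ('b \<Rightarrow>\<^sub>0 'k) \<Rightarrow> ('b \<Rightarrow>\<^sub>0 'k)" where
  "smul c x = Poly_Mapping.map ((*) c) x"

lemma lookup_smul: "Poly_Mapping.lookup (smul c x) b = c * Poly_Mapping.lookup x b"
  by (simp add: smul_def Poly_Mapping.map.rep_eq when_def)

interpretation free: vector_space "smul :: 'k::field \<Rightarrow> ('b \<Rightarrow>\<^sub>0 'k) \<Rightarrow> ('b \<Rightarrow>\<^sub>0 'k)"
  by standard (auto intro!: poly_mapping_eqI simp: lookup_smul lookup_add algebra_simps)

abbreviation basis :: "'b \<Rightarrow> ('b \<Rightarrow>\<^sub>0 'k::field)" where
  "basis b \<equiv> Poly_Mapping.single b 1"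

text \<open>Linear and bilinear extensions of maps defined on the basis.\<close>

definition lin :: "('b \<Rightarrow> ('c \<Rightarrow>\<^sub>0 'k)) \<Rightarrow> ('b \<Rightarrow>\<^sub>0 'k) \<Rightarrow> ('c \<Rightarrow>\<^sub>0 'k::field)" where
  "lin f x = (\<Sum>b\<in>Poly_Mapping.keys x. smul (Poly_Mapping.lookup x b) (f b))"

definition bilin ::
    "('a \<Rightarrow> 'b \<Rightarrow> ('c \<Rightarrow>\<^sub>0 'k)) \<Rightarrow> ('a \<Rightarrow>\<^sub>0 'k) \<Rightarrow> ('b \<Rightarrow>\<^sub>0 'k) \<Rightarrow> ('c \<Rightarrow>\<^sub>0 'k::field)" where
  "bilin f x y = lin (\<lambda>a. lin (f a) y) x"

definition free_operad ::
    "('v set \<Rightarrow> 'b set) \<Rightarrow> (('v \<Rightarrow> 'v) \<Rightarrow> 'b \<Rightarrow> 'b) \<Rightarrow> ('v \<Rightarrow> 'b) \<Rightarrow>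
     ('v set \<Rightarrow> 'v \<Rightarrow> 'b \<Rightarrow> 'b \<Rightarrow> ('b \<Rightarrow>\<^sub>0 'k)) \<Rightarrow> ('v, 'k::field, 'b \<Rightarrow>\<^sub>0 'k) operad_data" where
  "free_operad B r e c =
    \<lparr>space = (\<lambda>V. free.span (basis ` B V)),
     vzero = (\<lambda>V. 0),
     vadd = (\<lambda>V. (+)),
     vsmult = (\<lambda>V. smul),
     relabel = (\<lambda>V \<sigma>. lin (\<lambda>b. basis (r \<sigma> b))),
     ident = (\<lambda>v. basis (e v)),
     pcomp = (\<lambda>V1 V2 s. bilin (c V2 s))\<rparr>"


section \<open>Multigraphs, trees and orientations\<close>

type_synonym 'v mgraph = "'v uprod multiset"

definition mgraph_on :: "'v set \<Rightarrow> 'v mgraph \<Rightarrow> bool" where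
  "mgraph_on V g \<longleftrightarrow> (\<forall>e. e \<in># g \<longrightarrow> set_uprod e \<subseteq> V)"

definition simple_mgraph :: "'v mgraph \<Rightarrow> bool" where
  "simple_mgraph g \<longleftrightarrow> (\<forall>e. e \<in># g \<longrightarrow> proper_uprod e \<and> count g e = 1)"

definition adj :: "'v mgraph \<Rightarrow> ('v \<times> 'v) set" where
  "adj g = {(u, v). Upair u v \<in># g}"

definition connected_on :: "'v set \<Rightarrow> 'v mgraph \<Rightarrow> bool" where
  "connected_on V g \<longleftrightarrow> V \<noteq> {} \<and> mgraph_on V g \<and> (\<forall>u\<in>V. \<forall>v\<in>V. (u, v) \<in> (adj g)\<^sup>*)"

definition cycle :: "'v mgraph \<Rightarrow> 'v list \<Rightarrow> bool" where
  "cycle g vs \<longleftrightarrow> length vs \<ge> 3 \<and> distinct vs \<and>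
    (\<forall>i<length vs. (vs ! i, vs ! (Suc i mod length vs)) \<in> adj g)"

text \<open>Cycles of length 1 and 2 (loops and repeated edges) are excluded by \<^const>\<open>simple_mgraph\<close>.\<close>

definition tree_on :: "'v set \<Rightarrow> 'v mgraph \<Rightarrow> bool" where
  "tree_on V t \<longleftrightarrow> connected_on V t \<and> simple_mgraph t \<and> (\<nexists>vs. cycle t vs)"

definition spanning_tree :: "'v set \<Rightarrow> 'v mgraph \<Rightarrow> 'v mgraph \<Rightarrow> bool" where
  "spanning_tree V g t \<longleftrightarrow> tree_on V t \<and> t \<subseteq># g"

definition gdist :: "'v mgraph \<Rightarrow> 'v \<Rightarrow> 'v \<Rightarrow> nat" where
  "gdist g u v = (LEAST n. (u, v) \<in> adj g ^^ n)"

text \<open>The edges of an oriented multigraph are unordered pairs of labelled ends.\<close>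

datatype end_label = Source | Target

type_synonym 'v omgraph = "('v \<times> end_label) uprod multiset"

definition underlying :: "'v omgraph \<Rightarrow> 'v mgraph" where
  "underlying h = image_mset (map_uprod fst) h"

lift_definition orient_edge :: "'v mgraph \<Rightarrow> 'v \<Rightarrow> 'v uprod \<Rightarrow> ('v \<times> end_label) uprod" is
  "\<lambda>t r (a, b).
    ((a, if gdist t r a < gdist t r b then Target else Source),
     (b, if gdist t r b < gdist t r a then Target else Source))"
  by (auto simp: eq_upair_def)

definition orientation :: "'v mgraph \<Rightarrow> 'v mgraph \<Rightarrow> 'v \<Rightarrow> 'v omgraph" where
  "orientation g t r =
    image_mset (orient_edge t r) t + image_mset (map_uprod (\<lambda>v. (v, Target))) (g - t)"


section \<open>The operads of multigraphs\<close>

text \<open>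
  Finitely supported functions on multisets of edges form the polynomial algebra in the edges, the
  product of the monomials of \<open>g\<close> and \<open>h\<close> being that of \<open>g + h\<close>.  If each edge end \<open>a\<close> may be
  reconnected independently to any element of \<open>A a\<close>, the sum of all resulting multigraphs, with the
  occurrences of an edge and the two ends of a loop treated as distinct, is the product over the
  edges of the sums of the reconnected edges.
\<close>

lift_definition reconnect_edge ::
    "('a \<Rightarrow> 'a set) \<Rightarrow> 'a uprod \<Rightarrow> ('a uprod multiset \<Rightarrow>\<^sub>0 'k::field)" is
  "\<lambda>A (a, b). \<Sum>a'\<in>A a. \<Sum>b'\<in>A b. basis {#Upair a' b'#}"
proof -
  fix A :: "'a \<Rightarrow> 'a set" and e e' :: "'a \<times> 'a"
  have "(\<Sum>x\<in>A a. \<Sum>y\<in>A b. basis {#Upair x y#} :: 'a uprod multiset \<Rightarrow>\<^sub>0 'k) =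
        (\<Sum>y\<in>A b. \<Sum>x\<in>A a. basis {#Upair y x#})" for a b
  proof -
    have "Upair x y = Upair y x" for x y :: 'a by simp
    then show ?thesis by (subst sum.swap) presburger
  qed
  then show "eq_upair e e' \<Longrightarrow>
      (case e of (a, b) \<Rightarrow>
        (\<Sum>a'\<in>A a. \<Sum>b'\<in>A b. basis {#Upair a' b'#} :: 'a uprod multiset \<Rightarrow>\<^sub>0 'k)) =
      (case e' of (a, b) \<Rightarrow> (\<Sum>a'\<in>A a. \<Sum>b'\<in>A b. basis {#Upair a' b'#}))"
    by (auto simp: eq_upair_def)
qed

definition reconnect ::
    "('a \<Rightarrow> 'a set) \<Rightarrow> 'a uprod multiset \<Rightarrow> ('a uprod multiset \<Rightarrow>\<^sub>0 'k::field)" where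
  "reconnect A g = prod_mset (image_mset (reconnect_edge A) g)"

definition MG_pcomp ::
    "'v set \<Rightarrow> 'v \<Rightarrow> 'v mgraph \<Rightarrow> 'v mgraph \<Rightarrow> ('v mgraph \<Rightarrow>\<^sub>0 'k::field)" where
  "MG_pcomp V2 s g1 g2 = reconnect (\<lambda>v. if v = s then V2 else {v}) g1 * basis g2"

definition MG :: "('v, 'k::field, 'v mgraph \<Rightarrow>\<^sub>0 'k) operad_data" where
  "MG = free_operad (\<lambda>V. {g. V \<noteq> {} \<and> mgraph_on V g})
    (\<lambda>\<sigma>. image_mset (map_uprod \<sigma>)) (\<lambda>v. {#}) MG_pcomp"

definition MGc :: "('v, 'k::field, 'v mgraph \<Rightarrow>\<^sub>0 'k) operad_data" where
  "MGc = sub_data MG (\<lambda>V. free.span (basis ` {g. connected_on V g}))"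

definition Gc :: "('v, 'k::field, 'v mgraph \<Rightarrow>\<^sub>0 'k) operad_data" where
  "Gc = sub_data MG (\<lambda>V. free.span (basis ` {g. connected_on V g \<and> simple_mgraph g}))"

definition T :: "('v, 'k::field, 'v mgraph \<Rightarrow>\<^sub>0 'k) operad_data" where
  "T = sub_data MG (\<lambda>V. free.span (basis ` {g. tree_on V g}))"

definition MGor_pcomp ::
    "'v set \<Rightarrow> 'v \<Rightarrow> 'v omgraph \<times> 'v \<Rightarrow> 'v omgraph \<times> 'v \<Rightarrow> ('v omgraph \<times> 'v \<Rightarrow>\<^sub>0 'k::field)" where
  "MGor_pcomp V2 s = (\<lambda>(h1, v1) (h2, v2).
    lin (\<lambda>h. basis (h, if v1 \<noteq> s then v1 else v2))
      (reconnect (\<lambda>(v, l). if v \<noteq> s then {(v, l)} else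
          (case l of Source \<Rightarrow> {(v2, Source)} | Target \<Rightarrow> (\<lambda>w. (w, Target)) ` V2)) h1
        * basis h2))"

definition MGor :: "('v, 'k::field, 'v omgraph \<times> 'v \<Rightarrow>\<^sub>0 'k) operad_data" where
  "MGor = free_operad (\<lambda>V. {(h, v). mgraph_on V (underlying h) \<and> v \<in> V})
    (\<lambda>\<sigma> (h, v). (image_mset (map_uprod (map_prod \<sigma> id)) h, \<sigma> v)) (\<lambda>v. ({#}, v)) MGor_pcomp"

definition MGorc :: "('v, 'k::field, 'v omgraph \<times> 'v \<Rightarrow>\<^sub>0 'k) operad_data" where
  "MGorc = sub_data MGor (\<lambda>V. free.span (basis ` {(h, v). connected_on V (underlying h) \<and> v \<in> V}))"

definition Gorc :: "('v, 'k::field, 'v omgraph \<times> 'v \<Rightarrow>\<^sub>0 'k) operad_data" where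
  "Gorc = sub_data MGor (\<lambda>V. free.span (basis `
    {(h, v). connected_on V (underlying h) \<and> simple_mgraph (underlying h) \<and> v \<in> V}))"


section \<open>Rooted trees\<close>

definition is_parent :: "'v mgraph \<Rightarrow> 'v \<Rightarrow> 'v \<Rightarrow> 'v \<Rightarrow> bool" where
  "is_parent t r p w \<longleftrightarrow> (p, w) \<in> adj t \<and> gdist t r p < gdist t r w"

definition PLie_pcomp ::
    "'v set \<Rightarrow> 'v \<Rightarrow> 'v mgraph \<times> 'v \<Rightarrow> 'v mgraph \<times> 'v \<Rightarrow> ('v mgraph \<times> 'v \<Rightarrow>\<^sub>0 'k::field)" where
  "PLie_pcomp V2 s = (\<lambda>(t1, r1) (t2, r2).
    \<Sum>f\<in>{w. is_parent t1 r1 s w} \<rightarrow>\<^sub>E V2.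
      basis (filter_mset (\<lambda>e. s \<notin> set_uprod e) t1
             + image_mset (\<lambda>p. Upair p r2) (mset_set {p. is_parent t1 r1 p s})
             + image_mset (\<lambda>w. Upair w (f w)) (mset_set {w. is_parent t1 r1 s w})
             + t2,
             if r1 \<noteq> s then r1 else r2))"

definition PLie :: "('v, 'k::field, 'v mgraph \<times> 'v \<Rightarrow>\<^sub>0 'k) operad_data" where
  "PLie = free_operad (\<lambda>V. {(t, r). tree_on V t \<and> r \<in> V})
    (\<lambda>\<sigma> (t, r). (image_mset (map_uprod \<sigma>) t, \<sigma> r)) (\<lambda>v. ({#}, v)) PLie_pcomp"


section \<open>The sub-operads of spanning trees\<close>

text \<open>
  \<open>OST\<close> and \<open>IST\<close> are the operad \<open>\<O>\<close> and its ideal \<open>\<I>\<close>.  \<open>PLie_O\<close> is \<open>PLie \<inter> \<O>\<close> with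
  \<open>PLie\<close> seen inside \<open>ST\<close>, and \<open>psi_tree\<close> is the isomorphism from \<open>T\<close> to it that sends a tree to
  the sum of its rootings.  \<open>OSTG\<close> and \<open>ISTG\<close> are the intersections of \<open>\<O>\<close> and \<open>\<I>\<close> with
  \<open>Gorc\<close>.
\<close>

definition ST :: "('v, 'k::field, 'v omgraph \<times> 'v \<Rightarrow>\<^sub>0 'k) operad_data" where
  "ST = sub_data MGorc (\<lambda>V. free.span
    {basis (orientation g t r, r) | g t r. connected_on V g \<and> r \<in> V \<and> spanning_tree V g t})"

definition OST :: "('v, 'k::field, 'v omgraph \<times> 'v \<Rightarrow>\<^sub>0 'k) operad_data" where
  "OST = sub_data ST (\<lambda>V. free.span
    {(\<Sum>r\<in>V. basis (orientation g (t r) r, r)) | g t.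
      connected_on V g \<and> (\<forall>r\<in>V. spanning_tree V g (t r))})"

definition IST :: "'v set \<Rightarrow> ('v omgraph \<times> 'v \<Rightarrow>\<^sub>0 'k::field) set" where
  "IST V = free.span
    {basis (orientation g t1 r, r) - basis (orientation g t2 r, r) | g t1 t2 r.
      connected_on V g \<and> r \<in> V \<and> spanning_tree V g t1 \<and> spanning_tree V g t2}"

definition PLie_emb :: "'v set \<Rightarrow> ('v mgraph \<times> 'v \<Rightarrow>\<^sub>0 'k) \<Rightarrow> ('v omgraph \<times> 'v \<Rightarrow>\<^sub>0 'k::field)" where
  "PLie_emb V = lin (\<lambda>(t, r). basis (orientation t t r, r))"

definition PLie_in_ST :: "'v set \<Rightarrow> ('v omgraph \<times> 'v \<Rightarrow>\<^sub>0 'k::field) set" where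
  "PLie_in_ST V = PLie_emb V ` space PLie V"

definition PLie_O :: "('v, 'k::field, 'v omgraph \<times> 'v \<Rightarrow>\<^sub>0 'k) operad_data" where
  "PLie_O = sub_data ST (\<lambda>V. PLie_in_ST V \<inter> space OST V)"

definition psi_tree :: "'v set \<Rightarrow> ('v mgraph \<Rightarrow>\<^sub>0 'k) \<Rightarrow> ('v omgraph \<times> 'v \<Rightarrow>\<^sub>0 'k::field)" where
  "psi_tree V x = PLie_emb V (lin (\<lambda>t. \<Sum>r\<in>V. basis (t, r)) x)"

definition OSTG :: "('v, 'k::field, 'v omgraph \<times> 'v \<Rightarrow>\<^sub>0 'k) operad_data" where
  "OSTG = sub_data OST (\<lambda>V. space OST V \<inter> space Gorc V)"

definition ISTG :: "'v set \<Rightarrow> ('v omgraph \<times> 'v \<Rightarrow>\<^sub>0 'k::field) set" where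
  "ISTG V = IST V \<inter> space Gorc V"

end

theory Submission
  imports Defs "HOL-Library.Disjoint_Sets"
begin

text \<open>
  Forgetting the orientation, \<open>(h, r) \<mapsto> (g, r)\<close>, is a linear map on \<open>ST\<close> whose kernel is \<open>\<I>\<close>, and \<open>\<O>\<close>
  consists of the elements of \<open>ST\<close> that are mapped to a sum \<open>\<Sum>\<^sub>r (a, r)\<close> over all roots, for some linear
  combination \<open>a\<close> of multigraphs.  Such an \<open>a\<close> is unique and its multigraphs are connected, so
  there is a linear surjection from \<open>\<O>\<close> to \<open>MG\<^sub>c\<close> with kernel \<open>\<I>\<close>.  It is compatible with the
  compositions at \<open>s\<close>: the target ends at \<open>s\<close> are reconnected as in \<open>MG\<close>, and the only source end
  at \<open>s\<close>, if any, belongs to the edge towards the parent of \<open>s\<close> and follows the root of the second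
  factor, so that summing over this root reconnects that end to all vertices too.  The isomorphism
  \<open>\<psi>\<close> is the inverse of the induced map on \<open>\<O>/\<I>\<close>; on rooted trees and on simple graphs it restricts
  to the two other isomorphisms.

  A spanning tree rooted at \<open>r\<close> is encoded by its parent function.  The operad axioms need only
  be checked for \<open>MG\<^sup>\<bullet>\<^sub>o\<^sub>r\<close>: every other operad of the theorem is a sub-operad of it or the image of
  one under a surjection compatible with the structure.
\<close>


section \<open>Linear extensions\<close>

text \<open>Forgetting orientations is not compatible with composition on single rooted multigraphs:
  the source end at \<open>s\<close> goes to the root of the second factor alone, whereas
  \<open>MG\<close> sends it to every vertex. The two rules agree as soon as the second factor is a
  sum over its roots, whatever the first factor in \<open>ST\<close> is; summing over the roots of
  the first as well gives all roots of the result. Describing \<O> and \<I> by the image under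
  forgetting, not by generators, turns closure under composition into a computation. The price is to
  show that the generators suffice, which rests on \<I> being contained in \<O>: two families of
  spanning trees that differ at a single root differ by a generator of \<I>. Sums over reconnections
  are products in a polynomial algebra whose variables are the edges. Relabelling and forgetting
  labels are also reconnections, with one choice per end, so a single rule for successive
  reconnections yields naturality, associativity and the comparison with \<open>MG\<close>. No
  representative is chosen for \<psi>: an element is sent to its whole fibre, which is a
  coset.\<close>

abbreviation coeff :: "('b \<Rightarrow>\<^sub>0 'k::zero) \<Rightarrow> 'b \<Rightarrow> 'k" where
  "coeff \<equiv> Poly_Mapping.lookup"

abbreviation supp :: "('b \<Rightarrow>\<^sub>0 'k::zero) \<Rightarrow> 'b set" where
  "supp \<equiv> Poly_Mapping.keys"

text \<open>The sum in \<open>lin\<close> runs over the support, which varies with the argument; a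
  larger fixed finite set gives several arguments a common index set, as additivity
  requires.\<close>

lemma lin_superset:
  assumes "finite S" "supp x \<subseteq> S"
  shows "lin f x = (\<Sum>b\<in>S. smul (coeff x b) (f b))"
  unfolding lin_def
  by (rule sum.mono_neutral_left) (use assms in \<open>auto simp: in_keys_iff\<close>)

lemma lin_zero [simp]: "lin f 0 = 0"
  by (simp add: lin_def)

lemma lin_basis [simp]: "lin f (basis b) = f b"
  by (simp add: lin_def)

lemma lin_add: "lin f (x + y) = lin f x + lin f y"
proof -
  let ?S = "supp x \<union> supp y"
  have *: "finite ?S" by simp
  show ?thesis
    unfolding lin_superset[OF *, of x] lin_superset[OF *, of y, simplified]
      lin_superset[OF * keys_add] lin_superset[OF *, of x, simplified]
    by (simp add: lookup_add free.scale_left_distrib sum.distrib)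
qed

lemma supp_smul: "supp (smul c x) \<subseteq> supp x"
  by (auto simp: in_keys_iff lookup_smul)

lemma lin_smul: "lin f (smul c x) = smul c (lin f x)"
  unfolding lin_superset[OF finite_keys supp_smul] lin_def[of f x]
  by (simp add: lookup_smul free.scale_sum_right)

lemma lin_sum: "lin f (sum g S) = (\<Sum>i\<in>S. lin f (g i))"
  by (induction S rule: infinite_finite_induct) (simp_all add: lin_add)

lemma lin_uminus: "lin f (- x) = - lin f x"
  using lin_add[of f x "- x"] by (simp add: eq_neg_iff_add_eq_0 add.commute)

lemma lin_diff: "lin f (x - y) = lin f x - lin f y"
  using lin_add[of f x "- y"] by (simp add: lin_uminus)

lemma lin_cong: "(\<And>b. b \<in> supp x \<Longrightarrow> f b = g b) \<Longrightarrow> lin f x = lin g x"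
  by (simp add: lin_def)

lemma lin_lin: "lin f (lin g x) = lin (\<lambda>b. lin f (g b)) x"
  by (simp add: lin_def[of g] lin_def[of "\<lambda>b. lin f (g b)"] lin_sum lin_smul)

lemma lin_basis_id [simp]: "lin basis x = x"
proof (rule poly_mapping_eqI)
  fix b
  have "coeff (lin basis x) b = (\<Sum>a\<in>supp x. coeff x a * (1 when a = b))"
    by (simp add: lin_def lookup_sum lookup_smul lookup_single)
  also have "\<dots> = (\<Sum>a\<in>supp x. if a = b then coeff x b else 0)"
    by (rule sum.cong) (auto simp: when_def)
  also have "\<dots> = coeff x b"
    by (simp add: in_keys_iff)
  finally show "coeff (lin basis x) b = coeff x b" .
qed

lemma lin_fun_zero [simp]: "lin (\<lambda>b. 0) x = 0"
  by (simp add: lin_def)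

lemma lin_fun_add: "lin (\<lambda>b. f b + g b) x = lin f x + lin g x"
  by (simp add: lin_def free.scale_right_distrib sum.distrib)

lemma lin_fun_smul: "lin (\<lambda>b. smul c (f b)) x = smul c (lin f x)"
  by (simp add: lin_def free.scale_sum_right mult.commute)

lemma lin_fun_sum: "lin (\<lambda>b. \<Sum>i\<in>S. f i b) x = (\<Sum>i\<in>S. lin (f i) x)"
  by (induction S rule: infinite_finite_induct) (simp_all add: lin_fun_add)

lemma lin_swap: "lin (\<lambda>a. lin (f a) y) x = lin (\<lambda>b. lin (\<lambda>a. f a b) x) y"
  unfolding lin_def[of "f _"] by (simp add: lin_fun_sum lin_fun_smul lin_def[of _ y])

lemma smul_mult_left: "smul c x * y = smul c (x * y :: 'b::cancel_comm_monoid_add \<Rightarrow>\<^sub>0 'k::field)"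
  by (simp add: smul_def mult_map_scale_conv_mult mult.assoc)

lemma lin_mult_left:
  "lin f x * y = lin (\<lambda>b. f b * y :: 'b::cancel_comm_monoid_add \<Rightarrow>\<^sub>0 'k::field) x"
  by (simp add: lin_def sum_distrib_right smul_mult_left)

lemma lin_mult_right:
  "y * lin f x = lin (\<lambda>b. y * f b :: 'b::cancel_comm_monoid_add \<Rightarrow>\<^sub>0 'k::field) x"
  using lin_mult_left[of f x y] by (simp add: mult.commute)

lemma basis_mult: "basis a * basis b = (basis (a + b) :: 'b::cancel_comm_monoid_add \<Rightarrow>\<^sub>0 'k::field)"
  by (simp add: mult_single)

lemma supp_lin: "supp (lin f x) \<subseteq> (\<Union>b\<in>supp x. supp (f b))"
proof
  fix c assume "c \<in> supp (lin f x)"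
  then have "(\<Sum>b\<in>supp x. coeff x b * coeff (f b) c) \<noteq> 0"
    by (simp add: in_keys_iff lin_def lookup_sum lookup_smul)
  then obtain b where "b \<in> supp x" "coeff x b * coeff (f b) c \<noteq> 0"
    by (meson sum.neutral)
  then show "c \<in> (\<Union>b\<in>supp x. supp (f b))"
    by (auto simp: in_keys_iff)
qed

lemma lin_mem_span: "(\<And>b. b \<in> supp x \<Longrightarrow> f b \<in> free.span S) \<Longrightarrow> lin f x \<in> free.span S"
  unfolding lin_def by (intro free.span_sum free.span_scale)

text \<open>Membership in a span becomes inclusion of supports, and this is the form in which
  components of operads are handled from here on.\<close>

lemma span_basis: "free.span (basis ` B) = {x :: 'b \<Rightarrow>\<^sub>0 'k::field. supp x \<subseteq> B}"
proof
  show "free.span (basis ` B) \<subseteq> {x :: 'b \<Rightarrow>\<^sub>0 'k. supp x \<subseteq> B}"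
  proof
    fix x :: "'b \<Rightarrow>\<^sub>0 'k" assume "x \<in> free.span (basis ` B)"
    then show "x \<in> {x. supp x \<subseteq> B}"
    proof (induction rule: free.span_induct_alt)
      case (step c x y)
      then show ?case
        using keys_add[of "smul c x" y] supp_smul[of c x] by fastforce
    qed simp
  qed
next
  show "{x :: 'b \<Rightarrow>\<^sub>0 'k. supp x \<subseteq> B} \<subseteq> free.span (basis ` B)"
  proof
    fix x :: "'b \<Rightarrow>\<^sub>0 'k" assume "x \<in> {x. supp x \<subseteq> B}"
    then have "lin basis x \<in> free.span (basis ` B)"
      by (intro lin_mem_span free.span_base) auto
    then show "x \<in> free.span (basis ` B)" by simp
  qed
qed

lemma supp_sum: "supp (sum f S) \<subseteq> (\<Union>i\<in>S. supp (f i))"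
  by (induction S rule: infinite_finite_induct) (use keys_add in fastforce)+

section \<open>Constructions of operads\<close>

lemma free_operad_sel [simp]:
  "space (free_operad B r e c) V = {x. supp x \<subseteq> B V}"
  "vzero (free_operad B r e c) V = 0"
  "vadd (free_operad B r e c) V = (+)"
  "vsmult (free_operad B r e c) V = smul"
  "relabel (free_operad B r e c) V \<sigma> = lin (\<lambda>b. basis (r \<sigma> b))"
  "ident (free_operad B r e c) v = basis (e v)"
  "pcomp (free_operad B r e c) V1 V2 s = bilin (c V2 s)"
  by (simp_all add: free_operad_def span_basis)

lemma sub_data_sel [simp]:
  "space (sub_data P S) = S"
  "vzero (sub_data P S) = vzero P"
  "vadd (sub_data P S) = vadd P"
  "vsmult (sub_data P S) = vsmult P"
  "relabel (sub_data P S) = relabel P"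
  "ident (sub_data P S) = ident P"
  "pcomp (sub_data P S) = pcomp P"
  "sub_data (sub_data P S) S' = sub_data P S'"
  by (simp_all add: sub_data_def)

lemma bilin_add_left: "bilin f (x + x') y = bilin f x y + bilin f x' y"
  and bilin_add_right: "bilin f x (y + y') = bilin f x y + bilin f x y'"
  and bilin_smul_left: "bilin f (smul c x) y = smul c (bilin f x y)"
  and bilin_smul_right: "bilin f x (smul c y) = smul c (bilin f x y)"
  and bilin_zero_left [simp]: "bilin f 0 y = 0"
  and bilin_zero_right [simp]: "bilin f x 0 = 0"
  and bilin_basis [simp]: "bilin f (basis a) (basis b) = f a b"
  by (simp_all add: bilin_def lin_add lin_smul lin_fun_add lin_fun_smul)

lemma bilin_cong:
  "(\<And>a b. a \<in> supp x \<Longrightarrow> b \<in> supp y \<Longrightarrow> f a b = g a b) \<Longrightarrow> bilin f x y = bilin g x y"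
  unfolding bilin_def by (intro lin_cong) auto

lemma supp_bilin: "supp (bilin f x y) \<subseteq> (\<Union>a\<in>supp x. \<Union>b\<in>supp y. supp (f a b))"
  unfolding bilin_def by (rule order.trans[OF supp_lin UN_mono[OF order.refl supp_lin]])

lemma lin_bilin: "lin h (bilin f x y) = bilin (\<lambda>a b. lin h (f a b)) x y"
  by (simp add: bilin_def lin_lin)

lemma bilin_lin_lin: "bilin f (lin g x) (lin h y) = bilin (\<lambda>a b. bilin f (g a) (h b)) x y"
  by (simp add: bilin_def lin_lin) (intro lin_cong lin_swap)

lemma bilin_bilin_left:
  "bilin f (bilin g x y) z = lin (\<lambda>a. lin (\<lambda>b. lin (\<lambda>c. bilin f (g a b) (basis c)) z) y) x"
  by (simp add: bilin_def lin_lin) (intro lin_cong lin_swap)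

lemma bilin_bilin_right:
  "bilin f x (bilin g y z) = lin (\<lambda>a. lin (\<lambda>b. lin (\<lambda>c. bilin f (basis a) (g b c)) z) y) x"
  by (simp add: bilin_def lin_lin)

lemma vector_space_on_free:
  "vector_space_on {x :: 'b \<Rightarrow>\<^sub>0 'k::field. supp x \<subseteq> B} 0 (+) smul"
proof (rule vector_space_on.intro, goal_cases)
  case (2 x y)
  then show ?case using keys_add by fastforce
next
  case (3 x c)
  then show ?case using supp_smul by fastforce
next
  case (7 x)
  then show ?case by (intro bexI[of _ "- x"]) simp_all
next
  case 5 show ?case by (rule add.commute)
next
  case 8 show ?case by (rule free.scale_right_distrib)
next
  case 9 show ?case by (rule free.scale_left_distrib)
qed (simp_all add: add.assoc)

lemma supp_lin_basis: "supp (lin (\<lambda>b. basis (f b)) x) \<subseteq> f ` supp x"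
  using supp_lin[of "\<lambda>b. basis (f b)" x] by auto

text \<open>All operations are linear or bilinear extensions, so each axiom reduces to basis
  elements. In the associativity axioms the inner composition is already a linear combination, hence
  the outer \<open>bilin\<close> in those hypotheses.\<close>

lemma free_operadI:
  fixes c :: "'v set \<Rightarrow> 'v \<Rightarrow> 'b \<Rightarrow> 'b \<Rightarrow> ('b \<Rightarrow>\<^sub>0 'k::field)"
  assumes empty: "B {} = {}"
    and e: "\<And>v. e v \<in> B {v}" "\<And>\<sigma> v. r \<sigma> (e v) = e (\<sigma> v)"
    and r_closed: "\<And>V \<sigma> b. \<lbrakk>finite V; inj_on \<sigma> V; b \<in> B V\<rbrakk> \<Longrightarrow> r \<sigma> b \<in> B (\<sigma> ` V)"
    and r_cong: "\<And>V \<sigma> \<tau> b. \<lbrakk>finite V; \<And>v. v \<in> V \<Longrightarrow> \<sigma> v = \<tau> v; b \<in> B V\<rbrakk> \<Longrightarrow> r \<sigma> b = r \<tau> b"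
    and r_id: "\<And>b. r id b = b"
    and r_comp: "\<And>\<sigma> \<tau> b. r \<tau> (r \<sigma> b) = r (\<tau> \<circ> \<sigma>) b"
    and c_closed: "\<And>V1 V2 s a b. \<lbrakk>finite V1; finite V2; V1 \<inter> V2 = {}; s \<notin> V1; a \<in> B (insert s V1); b \<in> B V2\<rbrakk>
      \<Longrightarrow> supp (c V2 s a b) \<subseteq> B (V1 \<union> V2)"
    and natural: "\<And>V1 V2 s \<sigma> \<tau> a b. \<lbrakk>finite V1; finite V2; V1 \<inter> V2 = {}; s \<notin> V1; inj_on \<sigma> (insert s V1); inj_on \<tau> V2;
        \<sigma> ` V1 \<inter> \<tau> ` V2 = {}; a \<in> B (insert s V1); b \<in> B V2\<rbrakk> \<Longrightarrow>
        lin (\<lambda>b. basis (r (\<lambda>v. if v \<in> V1 then \<sigma> v else \<tau> v) b)) (c V2 s a b) =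
        c (\<tau> ` V2) (\<sigma> s) (r \<sigma> a) (r \<tau> b)"
    and parallel: "\<And>V1 V2 V3 s u a b d. \<lbrakk>finite V1; finite V2; finite V3; V1 \<inter> V2 = {}; V1 \<inter> V3 = {}; V2 \<inter> V3 = {};
        s \<noteq> u; s \<notin> V1 \<union> V3; u \<notin> V1 \<union> V2;
        a \<in> B (insert s (insert u V1)); b \<in> B V2; d \<in> B V3\<rbrakk> \<Longrightarrow>
        bilin (c V3 u) (c V2 s a b) (basis d) = bilin (c V2 s) (c V3 u a d) (basis b)"
    and sequential: "\<And>V1 V2 V3 s u a b d. \<lbrakk>finite V1; finite V2; finite V3; V1 \<inter> V2 = {}; V1 \<inter> V3 = {}; V2 \<inter> V3 = {};
        s \<notin> V1; u \<notin> V1 \<union> V2;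
        a \<in> B (insert s V1); b \<in> B (insert u V2); d \<in> B V3\<rbrakk> \<Longrightarrow>
        bilin (c V3 u) (c (insert u V2) s a b) (basis d) =
        bilin (c (V2 \<union> V3) s) (basis a) (c V3 u b d)"
    and left: "\<And>V s b. \<lbrakk>finite V; b \<in> B V\<rbrakk> \<Longrightarrow> c V s (e s) b = basis b"
    and right: "\<And>V s v a. \<lbrakk>finite V; s \<notin> V; v \<notin> V; a \<in> B (insert s V)\<rbrakk> \<Longrightarrow>
      c {v} s a (e v) = basis (r (id(s := v)) a)"
  shows "operad (free_operad B r e c)"
proof (intro operad.intro species.intro operad_axioms.intro, goal_cases)
  case 1 then show ?case by (simp add: vector_space_on_free[unfolded subset_iff] subset_iff)
next
  case (2 V \<sigma> x)
  then show ?case using supp_lin_basis[of "r \<sigma>" x] r_closed by fastforce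
next
  case (5 V \<sigma> \<tau> x)
  then show ?case by (auto intro!: lin_cong arg_cong[of _ _ basis] r_cong[of V])
next
  case 6 then show ?case by (simp add: r_id)
next
  case 7 then show ?case by (simp add: lin_lin r_comp)
next
  case 8 then show ?case by (simp add: empty)
next
  case 9 then show ?case by (simp add: e)
next
  case 10 then show ?case by (simp add: e)
next
  case (11 V1 V2 s x y)
  then show ?case using supp_bilin[of "c V2 s" x y] c_closed[of V1 V2 s] by fastforce
next
  case (16 V1 V2 s \<sigma> \<tau> x y)
  let ?\<rho> = "\<lambda>v. if v \<in> V1 then \<sigma> v else \<tau> v"
  have "lin (\<lambda>b. basis (r ?\<rho> b)) (bilin (c V2 s) x y) =
      bilin (\<lambda>a b. lin (\<lambda>b. basis (r ?\<rho> b)) (c V2 s a b)) x y"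
    by (rule lin_bilin)
  also have "\<dots> = bilin (\<lambda>a b. c (\<tau> ` V2) (\<sigma> s) (r \<sigma> a) (r \<tau> b)) x y"
    using 16 by (intro bilin_cong natural) auto
  also have "\<dots> = bilin (c (\<tau> ` V2) (\<sigma> s)) (lin (\<lambda>b. basis (r \<sigma> b)) x) (lin (\<lambda>b. basis (r \<tau> b)) y)"
    by (simp add: bilin_lin_lin)
  finally show ?case by simp
next
  case (17 V1 V2 V3 s u x y z)
  have "bilin (c V3 u) (bilin (c V2 s) x y) z =
      lin (\<lambda>a. lin (\<lambda>b. lin (\<lambda>d. bilin (c V3 u) (c V2 s a b) (basis d)) z) y) x"
    by (rule bilin_bilin_left)
  also have "\<dots> = lin (\<lambda>a. lin (\<lambda>b. lin (\<lambda>d. bilin (c V2 s) (c V3 u a d) (basis b)) z) y) x"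
    using 17 by (intro lin_cong parallel[of V1 V2 V3]) auto
  \<comment> \<open>The axiom inserts the second and third factors in the opposite order, so their
    two sums are exchanged.\<close>
  also have "\<dots> = lin (\<lambda>a. lin (\<lambda>d. lin (\<lambda>b. bilin (c V2 s) (c V3 u a d) (basis b)) y) z) x"
    by (intro lin_cong lin_swap)
  also have "\<dots> = bilin (c V2 s) (bilin (c V3 u) x z) y"
    by (rule bilin_bilin_left[symmetric])
  finally show ?case by simp
next
  case (18 V1 V2 V3 s u x y z)
  have "bilin (c V3 u) (bilin (c (insert u V2) s) x y) z =
      lin (\<lambda>a. lin (\<lambda>b. lin (\<lambda>d. bilin (c V3 u) (c (insert u V2) s a b) (basis d)) z) y) x"
    by (rule bilin_bilin_left)
  also have "\<dots> = lin (\<lambda>a. lin (\<lambda>b. lin (\<lambda>d. bilin (c (V2 \<union> V3) s) (basis a) (c V3 u b d)) z) y) x"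
    using 18 by (intro lin_cong sequential[of V1 V2 V3]) auto
  also have "\<dots> = bilin (c (V2 \<union> V3) s) x (bilin (c V3 u) y z)"
    by (rule bilin_bilin_right[symmetric])
  finally show ?case by simp
next
  case (19 V x s)
  have "lin (c V s (e s)) x = lin basis x"
    using 19 left[of V] by (intro lin_cong) auto
  then show ?case by (simp add: bilin_def)
next
  case (20 V s v x)
  then show ?case using right by (auto simp: bilin_def intro!: lin_cong)
qed (simp_all add: lin_add lin_smul bilin_add_left bilin_add_right bilin_smul_left bilin_smul_right)

section \<open>Transport of the operad axioms along structure-preserving maps\<close>

definition structure_map ::
    "('v, 'k::field, 'e) operad_data \<Rightarrow> ('v, 'k, 'f) operad_data \<Rightarrow> ('v set \<Rightarrow> 'e \<Rightarrow> 'f) \<Rightarrow> bool" where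
  "structure_map P Q f \<longleftrightarrow>
    (\<forall>V. finite V \<longrightarrow>
      (\<forall>x\<in>space P V. f V x \<in> space Q V) \<and>
      (\<forall>x\<in>space P V. \<forall>y\<in>space P V. f V (vadd P V x y) = vadd Q V (f V x) (f V y)) \<and>
      (\<forall>c. \<forall>x\<in>space P V. f V (vsmult P V c x) = vsmult Q V c (f V x)) \<and>
      (\<forall>\<sigma>. inj_on \<sigma> V \<longrightarrow>
        (\<forall>x\<in>space P V. f (\<sigma> ` V) (relabel P V \<sigma> x) = relabel Q V \<sigma> (f V x)))) \<and>
    (\<forall>v. f {v} (ident P v) = ident Q v) \<and>
    (\<forall>V1 V2 s. finite V1 \<longrightarrow> finite V2 \<longrightarrow> V1 \<inter> V2 = {} \<longrightarrow> s \<notin> V1 \<longrightarrow>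
      (\<forall>x\<in>space P (insert s V1). \<forall>y\<in>space P V2.
        f (V1 \<union> V2) (pcomp P V1 V2 s x y) = pcomp Q V1 V2 s (f (insert s V1) x) (f V2 y)))"

lemma operad_hom_iff: "operad_hom P Q f \<longleftrightarrow> operad P \<and> operad Q \<and> structure_map P Q f"
  by (simp add: operad_hom_def structure_map_def)

lemma structure_mapD:
  assumes "structure_map P Q f"
  shows "finite V \<Longrightarrow> x \<in> space P V \<Longrightarrow> f V x \<in> space Q V"
    and "finite V \<Longrightarrow> x \<in> space P V \<Longrightarrow> y \<in> space P V \<Longrightarrow> f V (vadd P V x y) = vadd Q V (f V x) (f V y)"
    and "finite V \<Longrightarrow> x \<in> space P V \<Longrightarrow> f V (vsmult P V c x) = vsmult Q V c (f V x)"
    and "finite V \<Longrightarrow> inj_on \<sigma> V \<Longrightarrow> x \<in> space P V \<Longrightarrow> f (\<sigma> ` V) (relabel P V \<sigma> x) = relabel Q V \<sigma> (f V x)"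
    and "f {v} (ident P v) = ident Q v"
    and "finite V1 \<Longrightarrow> finite V2 \<Longrightarrow> V1 \<inter> V2 = {} \<Longrightarrow> s \<notin> V1 \<Longrightarrow> x \<in> space P (insert s V1) \<Longrightarrow> y \<in> space P V2 \<Longrightarrow>
        f (V1 \<union> V2) (pcomp P V1 V2 s x y) = pcomp Q V1 V2 s (f (insert s V1) x) (f V2 y)"
  using assms by (simp_all add: structure_map_def)

lemma image_glue:
  assumes "V1 \<inter> V2 = {}"
  shows "(\<lambda>v. if v \<in> V1 then \<sigma> v else \<tau> v) ` (V1 \<union> V2) = \<sigma> ` V1 \<union> \<tau> ` V2"
proof -
  have 1: "(\<lambda>v. if v \<in> V1 then \<sigma> v else \<tau> v) ` V1 = \<sigma> ` V1"
    by (intro image_cong) auto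
  have 2: "(\<lambda>v. if v \<in> V1 then \<sigma> v else \<tau> v) ` V2 = \<tau> ` V2"
    using assms by (intro image_cong) auto
  show ?thesis by (simp only: image_Un 1 2)
qed

lemma inj_on_glue:
  assumes "V1 \<inter> V2 = {}" "inj_on \<sigma> V1" "inj_on \<tau> V2" "\<sigma> ` V1 \<inter> \<tau> ` V2 = {}"
  shows "inj_on (\<lambda>v. if v \<in> V1 then \<sigma> v else \<tau> v) (V1 \<union> V2)"
proof (rule inj_onI)
  fix v w
  assume "v \<in> V1 \<union> V2" "w \<in> V1 \<union> V2"
    "(if v \<in> V1 then \<sigma> v else \<tau> v) = (if w \<in> V1 then \<sigma> w else \<tau> w)"
  then show "v = w"
    using assms(4) inj_onD[OF assms(2), of v w] inj_onD[OF assms(3), of v w]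
    by (auto simp: disjoint_iff split: if_splits)
qed

text \<open>A surjection that preserves the operations carries every identity of \<open>P\<close>
  over to \<open>Q\<close>. For this use \<open>structure_map\<close> leaves out the demand of
  \<open>operad_hom\<close> that both sides be operads; as \<open>Q\<close> is mere data at this
  point, \<open>vzero Q\<close> has to be tied to \<open>P\<close> separately.\<close>

lemma operad_image:
  assumes "operad P" and f: "structure_map P Q f"
    and zero: "\<And>V. finite V \<Longrightarrow> f V (vzero P V) = vzero Q V"
    and onto: "\<And>V. finite V \<Longrightarrow> f V ` space P V = space Q V"
  shows "operad Q"
proof -
  interpret P: operad P by fact
  note fD = structure_mapD[OF f]
  have preim: "\<exists>x'\<in>space P V. x = f V x'" if "finite V" "x \<in> space Q V" for V x
    using onto[OF that(1)] that(2) by (metis imageE)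
  have zeroP: "vzero P V \<in> space P V" if "finite V" for V
    using vector_space_on.zero_closed[OF P.vector_space_on[OF that]] .
  have zeroQ: "vzero Q V = f V (vzero P V)" if "finite V" for V
    using zero[OF that] by simp
  have closed: "f V x \<in> space Q V" if "finite V" "x \<in> space P V" for V x
    using structure_mapD(1)[OF f that] .
  have addP: "vadd P V x y \<in> space P V" if "finite V" "x \<in> space P V" "y \<in> space P V" for V x y
    using vector_space_on.add_closed[OF P.vector_space_on[OF that(1)] that(2,3)] .
  have smultP: "vsmult P V c x \<in> space P V" if "finite V" "x \<in> space P V" for V c x
    using vector_space_on.scl_closed[OF P.vector_space_on[OF that(1)] that(2)] .
  show ?thesis
  proof (intro operad.intro species.intro operad_axioms.intro, goal_cases)
    case (1 V)
    interpret vP: vector_space_on "space P V" "vzero P V" "vadd P V" "vsmult P V"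
      using 1 by (rule P.vector_space_on)
    note [simp] = 1 zeroQ[OF 1] closed addP smultP zeroP fD(2,3)[symmetric]
    show ?case
    proof (rule vector_space_on.intro, goal_cases)
      case (4 x y w)
      then obtain x' y' w' where "x' \<in> space P V" "y' \<in> space P V" "w' \<in> space P V"
        "x = f V x'" "y = f V y'" "w = f V w'" using preim 1 by meson
      then show ?case by (simp add: vP.add_assoc)
    next
      case (5 x y)
      then obtain x' y' where "x' \<in> space P V" "y' \<in> space P V"
        "x = f V x'" "y = f V y'" using preim 1 by meson
      then show ?case by (simp add: vP.add_commute)
    next
      case (2 x y)
      then obtain x' y' where "x' \<in> space P V" "y' \<in> space P V"
        "x = f V x'" "y = f V y'" using preim 1 by meson
      then show ?case by simp
    next
      case (8 x y c)
      then obtain x' y' where "x' \<in> space P V" "y' \<in> space P V"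
        "x = f V x'" "y = f V y'" using preim 1 by meson
      then show ?case by (simp add: vP.scl_add)
    next
      case (7 x)
      then obtain x' where x': "x' \<in> space P V" "x = f V x'" using preim 1 by meson
      obtain y where y: "y \<in> space P V" "vadd P V x' y = vzero P V"
        using vP.add_inverse x' by blast
      show ?case by (rule bexI[of _ "f V y"]) (use x' y in simp_all)
    next
      case 1 then show ?case by simp
    next
      case (3 x)
      then obtain x' where "x' \<in> space P V" "x = f V x'" using preim \<open>finite V\<close> by meson
      then show ?case by simp
    next
      case (6 x)
      then obtain x' where "x' \<in> space P V" "x = f V x'" using preim \<open>finite V\<close> by meson
      then show ?case by (simp add: vP.add_zero)
    next
      case (9 x)
      then obtain x' where "x' \<in> space P V" "x = f V x'" using preim \<open>finite V\<close> by meson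
      then show ?case by (simp add: vP.add_scl)
    next
      case (10 x)
      then obtain x' where "x' \<in> space P V" "x = f V x'" using preim \<open>finite V\<close> by meson
      then show ?case by (simp add: vP.scl_scl)
    next
      case (11 x)
      then obtain x' where "x' \<in> space P V" "x = f V x'" using preim \<open>finite V\<close> by meson
      then show ?case by (simp add: vP.scl_one)
    qed
  next
    case (2 V \<sigma> x)
    obtain x' where x': "x' \<in> space P V"
      "x = f V x'"
      using preim[OF 2(1) 2(3)] by blast
    with 2 x' show ?case by (simp add: closed P.relabel_closed flip: fD(4))
  next
    case (3 V \<sigma> x y)
    obtain x' y' where x': "x' \<in> space P V" "y' \<in> space P V"
      "x = f V x'" "y = f V y'"
      using preim[OF 3(1) 3(3)] preim[OF 3(1) 3(4)] by blast
    with 3 x' show ?case by (simp add: closed P.relabel_closed P.relabel_add addP flip: fD(2,4))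
  next
    case (4 V \<sigma> x c)
    obtain x' where x': "x' \<in> space P V"
      "x = f V x'"
      using preim[OF 4(1) 4(3)] by blast
    with 4 x' show ?case by (simp add: closed P.relabel_closed P.relabel_smult smultP flip: fD(3,4))
  next
    case (5 V \<sigma> \<tau> x)
    obtain x' where x': "x' \<in> space P V" "x = f V x'"
      using preim[OF 5(1) 5(4)] by blast
    \<comment> \<open>The map \<open>f\<close> is indexed by the set of labels, so both relabellings
      must be seen to have the same image.\<close>
    have "inj_on \<tau> V" "\<tau> ` V = \<sigma> ` V" using 5 by (auto cong: inj_on_cong image_cong)
    with 5 x' have "relabel Q V \<tau> x = f (\<sigma> ` V) (relabel P V \<tau> x')"
      by (metis fD(4))
    also have "relabel P V \<tau> x' = relabel P V \<sigma> x'"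
      using 5 x'(1) by (intro P.relabel_cong[symmetric])
    also have "f (\<sigma> ` V) (relabel P V \<sigma> x') = relabel Q V \<sigma> x"
      unfolding x' using 5 x'(1) by (intro fD(4))
    finally show ?case by (rule sym)
  next
    case (6 V x)
    obtain x' where x': "x' \<in> space P V" "x = f V x'"
      using preim[OF 6(1) 6(2)] by blast
    have "relabel Q V id x = f (id ` V) (relabel P V id x')"
      unfolding x' using 6 x'(1) by (intro fD(4)[symmetric]) auto
    with 6 x' show ?case by (simp add: P.relabel_id)
  next
    case (7 V \<sigma> \<tau> x)
    obtain x' where x': "x' \<in> space P V" "x = f V x'"
      using preim[OF 7(1) 7(4)] by blast
    have "relabel Q (\<sigma> ` V) \<tau> (relabel Q V \<sigma> x) = relabel Q (\<sigma> ` V) \<tau> (f (\<sigma> ` V) (relabel P V \<sigma> x'))"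
      unfolding x' using 7 x'(1) by (simp add: fD(4))
    also have "\<dots> = f (\<tau> ` \<sigma> ` V) (relabel P (\<sigma> ` V) \<tau> (relabel P V \<sigma> x'))"
      using 7 x'(1) by (intro fD(4)[symmetric]) (auto intro: P.relabel_closed)
    also have "\<dots> = f ((\<tau> \<circ> \<sigma>) ` V) (relabel P V (\<tau> \<circ> \<sigma>) x')"
      using 7 x'(1) by (simp add: P.relabel_comp image_comp)
    also have "\<dots> = relabel Q V (\<tau> \<circ> \<sigma>) x"
      unfolding x' using 7 x'(1) by (intro fD(4)) (auto intro: comp_inj_on)
    finally show ?case .
  next
    case 8
    then show ?case using onto[of "{}"] P.space_empty zero[of "{}"] by simp
  next
    case (9 v)
    show ?case using closed[of "{v}" "ident P v"] by (simp add: P.ident_closed fD(5))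
  next
    case (10 v \<sigma>)
    have "relabel Q {v} \<sigma> (ident Q v) = relabel Q {v} \<sigma> (f {v} (ident P v))"
      by (simp only: fD(5))
    also have "\<dots> = f (\<sigma> ` {v}) (relabel P {v} \<sigma> (ident P v))"
      by (intro fD(4)[symmetric]) (auto intro: P.ident_closed)
    also have "\<dots> = ident Q (\<sigma> v)"
      by (simp add: P.ident_natural fD(5))
    finally show ?case .
  next
    case (11 V1 V2 s x y)
    obtain x' y' where x': "x' \<in> space P (insert s V1)" "y' \<in> space P V2"
      "x = f (insert s V1) x'" "y = f V2 y'"
      using preim[OF finite.insertI[OF 11(1)] 11(5)] preim[OF 11(2) 11(6)] by blast
    with 11 x' show ?case by (simp add: closed P.pcomp_closed flip: fD(6))
  next
    case (12 V1 V2 s x x2 y)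
    obtain x' x2' y' where x': "x' \<in> space P (insert s V1)" "x2' \<in> space P (insert s V1)" "y' \<in> space P V2"
      "x = f (insert s V1) x'" "x2 = f (insert s V1) x2'" "y = f V2 y'"
      using preim[OF finite.insertI[OF 12(1)] 12(5)] preim[OF finite.insertI[OF 12(1)] 12(6)] preim[OF 12(2) 12(7)] by blast
    with 12 x' show ?case by (simp add: P.pcomp_closed P.pcomp_add_left addP flip: fD(2,3,6))
  next
    case (13 V1 V2 s x y)
    obtain x' y' where x': "x' \<in> space P (insert s V1)" "y' \<in> space P V2"
      "x = f (insert s V1) x'" "y = f V2 y'"
      using preim[OF finite.insertI[OF 13(1)] 13(5)] preim[OF 13(2) 13(6)] by blast
    with 13 x' show ?case by (simp add: P.pcomp_closed P.pcomp_smult_left smultP flip: fD(2,3,6))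
  next
    case (14 V1 V2 s x y y2)
    obtain x' y2' y' where x': "x' \<in> space P (insert s V1)" "y2' \<in> space P V2" "y' \<in> space P V2"
      "x = f (insert s V1) x'" "y2 = f V2 y2'" "y = f V2 y'"
      using preim[OF finite.insertI[OF 14(1)] 14(5)] preim[OF 14(2) 14(7)] preim[OF 14(2) 14(6)] by blast
    with 14 x' show ?case by (simp add: P.pcomp_closed P.pcomp_add_right addP flip: fD(2,3,6))
  next
    case (15 V1 V2 s x y)
    obtain x' y' where x': "x' \<in> space P (insert s V1)" "y' \<in> space P V2"
      "x = f (insert s V1) x'" "y = f V2 y'"
      using preim[OF finite.insertI[OF 15(1)] 15(5)] preim[OF 15(2) 15(6)] by blast
    with 15 x' show ?case by (simp add: P.pcomp_closed P.pcomp_smult_right smultP flip: fD(2,3,6))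
  next
    case (16 V1 V2 s \<sigma> \<tau> x y)
    obtain x' y' where x': "x' \<in> space P (insert s V1)" "y' \<in> space P V2"
      "x = f (insert s V1) x'" "y = f V2 y'"
      using preim[OF finite.insertI[OF 16(1)] 16(8)] preim[OF 16(2) 16(9)] by blast
    let ?\<rho> = "\<lambda>v. if v \<in> V1 then \<sigma> v else \<tau> v"
    have inj: "inj_on ?\<rho> (V1 \<union> V2)"
      using 16(3,5-7) by (intro inj_on_glue) auto
    have im: "?\<rho> ` (V1 \<union> V2) = \<sigma> ` V1 \<union> \<tau> ` V2"
      using 16(3) by (rule image_glue)
    have s: "\<sigma> s \<notin> \<sigma> ` V1" using 16(4,5) by auto
    have ins: "insert (\<sigma> s) (\<sigma> ` V1) = \<sigma> ` insert s V1" by simp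
    have "relabel Q (V1 \<union> V2) ?\<rho> (pcomp Q V1 V2 s x y) =
        relabel Q (V1 \<union> V2) ?\<rho> (f (V1 \<union> V2) (pcomp P V1 V2 s x' y'))"
      unfolding x' using 16 x'(1,2) by (simp add: fD(6))
    also have "\<dots> = f (?\<rho> ` (V1 \<union> V2)) (relabel P (V1 \<union> V2) ?\<rho> (pcomp P V1 V2 s x' y'))"
      using 16 x'(1,2) inj by (intro fD(4)[symmetric] P.pcomp_closed) auto
    also have "?\<rho> ` (V1 \<union> V2) = \<sigma> ` V1 \<union> \<tau> ` V2" by (fact im)
    also have "f (\<sigma> ` V1 \<union> \<tau> ` V2) (relabel P (V1 \<union> V2) ?\<rho> (pcomp P V1 V2 s x' y')) = f (\<sigma> ` V1 \<union> \<tau> ` V2)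
        (pcomp P (\<sigma> ` V1) (\<tau> ` V2) (\<sigma> s) (relabel P (insert s V1) \<sigma> x') (relabel P V2 \<tau> y'))"
      using 16 x' by (simp add: P.pcomp_natural)
    also have "\<dots> = pcomp Q (\<sigma> ` V1) (\<tau> ` V2) (\<sigma> s)
        (f (insert (\<sigma> s) (\<sigma> ` V1)) (relabel P (insert s V1) \<sigma> x')) (f (\<tau> ` V2) (relabel P V2 \<tau> y'))"
      using 16 x' s P.relabel_closed[of "insert s V1" \<sigma> x'] P.relabel_closed[of V2 \<tau> y']
      by (intro structure_mapD(6)[OF f]) auto
    also have "\<dots> = pcomp Q (\<sigma> ` V1) (\<tau> ` V2) (\<sigma> s) (relabel Q (insert s V1) \<sigma> x) (relabel Q V2 \<tau> y)"
      unfolding ins x' using 16 x'(1,2) by (simp add: fD(4) del: image_insert)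
    finally show ?case .
  next
    case (17 V1 V2 V3 s u x y z)
    obtain x' y' z' where x': "x' \<in> space P (insert s (insert u V1))" "y' \<in> space P V2" "z' \<in> space P V3"
      "x = f (insert s (insert u V1)) x'" "y = f V2 y'" "z = f V3 z'"
      using preim[OF finite.insertI[OF finite.insertI[OF 17(1)]] 17(10)] preim[OF 17(2) 17(11)] preim[OF 17(3) 17(12)] by blast
    have x2: "x' \<in> space P (insert u (insert s V1))" "x = f (insert u (insert s V1)) x'"
      using x' by (simp_all add: insert_commute)
    have "pcomp Q (V1 \<union> V2) V3 u (pcomp Q (insert u V1) V2 s x y) z =
        pcomp Q (V1 \<union> V2) V3 u (f (insert u (V1 \<union> V2)) (pcomp P (insert u V1) V2 s x' y')) z"
      using 17 x' fD(6)[of "insert u V1" V2 s x' y'] by (simp add: insert_commute)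
    also have "\<dots> = f (V1 \<union> V2 \<union> V3) (pcomp P (V1 \<union> V2) V3 u (pcomp P (insert u V1) V2 s x' y') z')"
      unfolding x' using 17 x' P.pcomp_closed[of "insert u V1" V2 s x' y']
      by (intro fD(6)[symmetric]) (auto simp: Int_Un_distrib2)
    also have "pcomp P (V1 \<union> V2) V3 u (pcomp P (insert u V1) V2 s x' y') z' =
        pcomp P (V1 \<union> V3) V2 s (pcomp P (insert s V1) V3 u x' z') y'"
      using 17 x' by (intro P.pcomp_parallel)
    also have "V1 \<union> V2 \<union> V3 = V1 \<union> V3 \<union> V2" by auto
    also have "f (V1 \<union> V3 \<union> V2) (pcomp P (V1 \<union> V3) V2 s (pcomp P (insert s V1) V3 u x' z') y') =
        pcomp Q (V1 \<union> V3) V2 s (f (insert s (V1 \<union> V3)) (pcomp P (insert s V1) V3 u x' z')) y"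
      unfolding x' using 17 x' x2 P.pcomp_closed[of "insert s V1" V3 u x' z']
      by (intro fD(6)) (auto simp: Int_Un_distrib2)
    also have "f (insert s (V1 \<union> V3)) (pcomp P (insert s V1) V3 u x' z') = pcomp Q (insert s V1) V3 u x z"
      using 17 x2 x'(3,6) fD(6)[of "insert s V1" V3 u x' z'] by simp
    finally show ?case .
  next
    case (18 V1 V2 V3 s u x y z)
    obtain x' y' z' where x': "x' \<in> space P (insert s V1)" "y' \<in> space P (insert u V2)" "z' \<in> space P V3"
      "x = f (insert s V1) x'" "y = f (insert u V2) y'" "z = f V3 z'"
      using preim[OF finite.insertI[OF 18(1)] 18(9)] preim[OF finite.insertI[OF 18(2)] 18(10)] preim[OF 18(3) 18(11)] by blast
    have "pcomp Q (V1 \<union> V2) V3 u (pcomp Q V1 (insert u V2) s x y) z =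
        pcomp Q (V1 \<union> V2) V3 u (f (insert u (V1 \<union> V2)) (pcomp P V1 (insert u V2) s x' y')) z"
      using 18 x' fD(6)[of V1 "insert u V2" s x' y'] by simp
    also have "\<dots> = f (V1 \<union> V2 \<union> V3) (pcomp P (V1 \<union> V2) V3 u (pcomp P V1 (insert u V2) s x' y') z')"
      unfolding x' using 18 x' P.pcomp_closed[of V1 "insert u V2" s x' y']
      by (intro fD(6)[symmetric]) (auto simp: Int_Un_distrib2)
    also have "pcomp P (V1 \<union> V2) V3 u (pcomp P V1 (insert u V2) s x' y') z' =
        pcomp P V1 (V2 \<union> V3) s x' (pcomp P V2 V3 u y' z')"
      using 18 x' by (intro P.pcomp_sequential)
    also have "V1 \<union> V2 \<union> V3 = V1 \<union> (V2 \<union> V3)" by auto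
    also have "f (V1 \<union> (V2 \<union> V3)) (pcomp P V1 (V2 \<union> V3) s x' (pcomp P V2 V3 u y' z')) =
        pcomp Q V1 (V2 \<union> V3) s x (f (V2 \<union> V3) (pcomp P V2 V3 u y' z'))"
      unfolding x' using 18 x' P.pcomp_closed[of V2 V3 u y' z']
      by (intro fD(6)) (auto simp: Int_Un_distrib)
    also have "f (V2 \<union> V3) (pcomp P V2 V3 u y' z') = pcomp Q V2 V3 u y z"
      using 18 x' fD(6)[of V2 V3 u y' z'] by simp
    finally show ?case .
  next
    case (19 V x s)
    obtain x' where x': "x' \<in> space P V" "x = f V x'"
      using preim[OF 19(1) 19(2)] by blast
    have "pcomp Q {} V s (ident Q s) x = f ({} \<union> V) (pcomp P {} V s (ident P s) x')"
      unfolding x' fD(5)[symmetric] using 19 x'(1)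
      by (intro fD(6)[symmetric]) (auto intro: P.ident_closed)
    also have "\<dots> = x"
      using 19 x' by (simp add: P.ident_left)
    finally show ?case .
  next
    case (20 V s v x)
    obtain x' where x': "x' \<in> space P (insert s V)" "x = f (insert s V) x'"
      using preim[OF finite.insertI[OF 20(1)] 20(4)] by blast
    have inj: "inj_on (id(s := v)) (insert s V)" and im: "(id(s := v)) ` insert s V = V \<union> {v}"
      using 20 by (auto simp: inj_on_def)
    have "pcomp Q V {v} s x (ident Q v) = f (V \<union> {v}) (pcomp P V {v} s x' (ident P v))"
      unfolding x' fD(5)[symmetric] using 20 x'(1)
      by (intro fD(6)[symmetric]) (auto intro: P.ident_closed)
    also have "\<dots> = f ((id(s := v)) ` insert s V) (relabel P (insert s V) (id(s := v)) x')"
      unfolding im using 20 x' by (simp add: P.ident_right)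
    also have "\<dots> = relabel Q (insert s V) (id(s := v)) x"
      unfolding x' using 20 x'(1) inj by (intro fD(4)) auto
    finally show ?case .
  qed
qed

section \<open>Zero vectors, sub-operads and factorisation of maps\<close>

lemma (in vector_space_on) add_cancel:
  assumes "a \<in> S" "add a a = a"
  shows "a = z"
proof -
  obtain y where y: "y \<in> S" "add a y = z" using add_inverse assms(1) by blast
  have "add (add a a) y = add a (add a y)" using assms(1) y(1) by (intro add_assoc)
  then show ?thesis
    using assms y add_zero[of a] add_commute[of a z] zero_closed by simp
qed

lemma (in vector_space_on) zero_scl: "x \<in> S \<Longrightarrow> scl 0 x = z"
  using add_scl[of x 0 0] by (intro add_cancel scl_closed) simp_all

lemma (in vector_space_on) scl_zero: "scl c z = z"
  using zero_scl[OF zero_closed] scl_scl[OF zero_closed, of c 0] by simp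

context operad
begin

lemma
  assumes "finite V"
  shows zero_mem: "vzero P V \<in> space P V"
    and add_mem: "x \<in> space P V \<Longrightarrow> y \<in> space P V \<Longrightarrow> vadd P V x y \<in> space P V"
    and smult_mem: "x \<in> space P V \<Longrightarrow> vsmult P V c x \<in> space P V"
    and smult_0: "x \<in> space P V \<Longrightarrow> vsmult P V 0 x = vzero P V"
    and smult_vzero: "vsmult P V c (vzero P V) = vzero P V"
    and zero_add: "x \<in> space P V \<Longrightarrow> vadd P V (vzero P V) x = x"
proof -
  interpret V: vector_space_on "space P V" "vzero P V" "vadd P V" "vsmult P V"
    using assms by (rule vector_space_on)
  show "vzero P V \<in> space P V"
    and "x \<in> space P V \<Longrightarrow> y \<in> space P V \<Longrightarrow> vadd P V x y \<in> space P V"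
    and "x \<in> space P V \<Longrightarrow> vsmult P V c x \<in> space P V"
    and "x \<in> space P V \<Longrightarrow> vsmult P V 0 x = vzero P V"
    and "vsmult P V c (vzero P V) = vzero P V"
    and "x \<in> space P V \<Longrightarrow> vadd P V (vzero P V) x = x"
    by (fact V.zero_closed V.add_closed V.scl_closed V.zero_scl V.scl_zero V.add_zero)+
qed

lemma relabel_zero: "finite V \<Longrightarrow> inj_on \<sigma> V \<Longrightarrow> relabel P V \<sigma> (vzero P V) = vzero P (\<sigma> ` V)"
  using relabel_smult[of V \<sigma> "vzero P V" 0] relabel_closed[of V \<sigma> "vzero P V"]
  by (simp add: zero_mem smult_vzero smult_0)

lemma
  assumes "finite V1" "finite V2" "V1 \<inter> V2 = {}" "s \<notin> V1"
  shows pcomp_zero_left: "y \<in> space P V2 \<Longrightarrow> pcomp P V1 V2 s (vzero P (insert s V1)) y = vzero P (V1 \<union> V2)"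
    and pcomp_zero_right: "x \<in> space P (insert s V1) \<Longrightarrow> pcomp P V1 V2 s x (vzero P V2) = vzero P (V1 \<union> V2)"
proof -
  assume y: "y \<in> space P V2"
  have "pcomp P V1 V2 s (vsmult P (insert s V1) 0 (vzero P (insert s V1))) y = vzero P (V1 \<union> V2)"
    using assms y by (subst pcomp_smult_left) (auto intro: zero_mem smult_0 pcomp_closed)
  then show "pcomp P V1 V2 s (vzero P (insert s V1)) y = vzero P (V1 \<union> V2)"
    using assms by (simp add: smult_vzero)
next
  assume x: "x \<in> space P (insert s V1)"
  have "pcomp P V1 V2 s x (vsmult P V2 0 (vzero P V2)) = vzero P (V1 \<union> V2)"
    using assms x by (subst pcomp_smult_right) (auto intro: zero_mem smult_0 pcomp_closed)
  then show "pcomp P V1 V2 s x (vzero P V2) = vzero P (V1 \<union> V2)"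
    using assms by (simp add: smult_vzero)
qed

end

lemma operad_sub_data:
  assumes "operad P" and S: "subspecies P S" and ident: "\<And>v. ident P v \<in> S {v}"
    and pcomp: "\<And>V1 V2 s x y. \<lbrakk>finite V1; finite V2; V1 \<inter> V2 = {}; s \<notin> V1; x \<in> S (insert s V1); y \<in> S V2\<rbrakk>
      \<Longrightarrow> pcomp P V1 V2 s x y \<in> S (V1 \<union> V2)"
  shows "operad (sub_data P S)"
proof -
  interpret P: operad P by fact
  have sub: "x \<in> space P V" if "finite V" "x \<in> S V" for V x
    using S that by (auto simp: subspecies_def)
  have zero: "vzero P V \<in> S V" if "finite V" for V
    using S that by (auto simp: subspecies_def)
  have add: "vadd P V x y \<in> S V" if "finite V" "x \<in> S V" "y \<in> S V" for V x y
    using S that by (auto simp: subspecies_def)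
  have scl: "vsmult P V c x \<in> S V" if "finite V" "x \<in> S V" for V c x
    using S that by (auto simp: subspecies_def)
  have rel: "relabel P V \<sigma> x \<in> S (\<sigma> ` V)" if "finite V" "inj_on \<sigma> V" "x \<in> S V" for V \<sigma> x
    using S that by (auto simp: subspecies_def)
  show ?thesis
  proof (intro operad.intro species.intro operad_axioms.intro, unfold sub_data_sel, goal_cases)
    case (1 V)
    interpret vP: vector_space_on "space P V" "vzero P V" "vadd P V" "vsmult P V"
      using 1 by (rule P.vector_space_on)
    note sub = sub[OF 1]
    show ?case
    proof (rule vector_space_on.intro, goal_cases)
      case (7 x)
      obtain y where y: "y \<in> space P V" "vadd P V x y = vzero P V"
        using vP.add_inverse[OF sub[OF 7]] by blast
      \<comment> \<open>The negative must lie in \<open>S V\<close> itself; closure under scalars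
        provides it as the multiple by \<open>- 1\<close>.\<close>
      have "vadd P V (vsmult P V 1 x) (vsmult P V (- 1) x) = vzero P V"
        using vP.add_scl[OF sub[OF 7], of 1 "- 1"] vP.zero_scl[OF sub[OF 7]] by simp
      then show ?case
        using vP.scl_one[OF sub[OF 7]] scl[OF 1 7] by auto
    qed (use 1 in \<open>auto intro: zero add scl sub vP.add_assoc vP.add_commute vP.add_zero vP.scl_add
        vP.add_scl vP.scl_scl vP.scl_one\<close>)
  next
    case (2 V \<sigma> x) then show ?case by (rule rel)
  next
    case (3 V \<sigma> x y) then show ?case by (intro P.relabel_add sub)
  next
    case (4 V \<sigma> x c) then show ?case by (intro P.relabel_smult sub)
  next
    case (5 V \<sigma> \<tau> x) then show ?case by (intro P.relabel_cong sub)
  next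
    case (6 V x) then show ?case by (intro P.relabel_id sub)
  next
    case (7 V \<sigma> \<tau> x) then show ?case by (intro P.relabel_comp sub)
  next
    case 8
    have "S {} \<subseteq> {vzero P {}}" using sub[of "{}"] P.space_empty by blast
    then show ?case using zero[of "{}"] by blast
  next
    case (9 v) show ?case by (rule ident)
  next
    case (10 v \<sigma>) show ?case by (rule P.ident_natural)
  next
    case (11 V1 V2 s x y) then show ?case by (rule pcomp)
  next
    case (12 V1 V2 s x x' y) then show ?case by (intro P.pcomp_add_left sub finite.insertI)
  next
    case (13 V1 V2 s x y c) then show ?case by (intro P.pcomp_smult_left sub finite.insertI)
  next
    case (14 V1 V2 s x y y') then show ?case by (intro P.pcomp_add_right sub finite.insertI)
  next
    case (15 V1 V2 s x y c) then show ?case by (intro P.pcomp_smult_right sub finite.insertI)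
  next
    case (16 V1 V2 s \<sigma> \<tau> x y) then show ?case by (intro P.pcomp_natural sub finite.insertI)
  next
    case (17 V1 V2 V3 s u x y z) then show ?case by (intro P.pcomp_parallel sub finite.insertI)
  next
    case (18 V1 V2 V3 s u x y z) then show ?case by (intro P.pcomp_sequential sub finite.insertI)
  next
    case (19 V x s) then show ?case by (intro P.ident_left sub)
  next
    case (20 V s v x) then show ?case by (intro P.ident_right sub finite.insertI)
  qed
qed

lemma structure_map_sub_data:
  assumes "structure_map P Q f"
    and "\<And>V x. finite V \<Longrightarrow> x \<in> S V \<Longrightarrow> x \<in> space P V"
    and "\<And>V x. finite V \<Longrightarrow> x \<in> S V \<Longrightarrow> f V x \<in> R V"
  shows "structure_map (sub_data P S) (sub_data Q R) f"
  unfolding structure_map_def sub_data_sel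
  by (intro conjI allI impI ballI) (auto intro: structure_mapD[OF assms(1)] assms)

text \<open>Every element of \<open>Q\<close> is an image under \<open>f\<close>, so compatibility
  of \<open>g\<close> can be tested after composing with \<open>f\<close>, where it becomes that of
  \<open>c\<close>.\<close>

lemma structure_map_factor:
  assumes "operad P" and f: "structure_map P Q f"
    and onto: "\<And>V. finite V \<Longrightarrow> f V ` space P V = space Q V"
    and c: "structure_map P R c"
    and g: "\<And>V x. finite V \<Longrightarrow> x \<in> space P V \<Longrightarrow> g V (f V x) = c V x"
  shows "structure_map Q R g"
proof -
  interpret P: operad P by fact
  note fD = structure_mapD[OF f] and cD = structure_mapD[OF c]
  have preim: "\<exists>x'\<in>space P V. x = f V x'" if "finite V" "x \<in> space Q V" for V x
    using onto[OF that(1)] that(2) by (metis imageE)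
  show ?thesis
    unfolding structure_map_def
  proof (intro conjI allI impI ballI, goal_cases)
    case (1 V x)
    then show ?case using preim[OF 1] g cD(1) by auto
  next
    case (2 V x y)
    obtain x' where x': "x' \<in> space P V" "x = f V x'" using preim[OF 2(1,2)] by blast
    obtain y' where y': "y' \<in> space P V" "y = f V y'" using preim[OF 2(1,3)] by blast
    have "g V (vadd Q V x y) = g V (f V (vadd P V x' y'))"
      by (simp add: x' y' fD 2)
    then show ?case using 2(1) by (simp add: x' y' g P.add_mem cD)
  next
    case (3 V c' x)
    obtain x' where x': "x' \<in> space P V" "x = f V x'" using preim[OF 3(1,2)] by blast
    have "g V (vsmult Q V c' x) = g V (f V (vsmult P V c' x'))"
      by (simp add: x' fD 3)
    then show ?case using 3(1) by (simp add: x' g P.smult_mem cD)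
  next
    case (4 V \<sigma> x)
    obtain x' where x': "x' \<in> space P V" "x = f V x'" using preim[OF 4(1,3)] by blast
    have "g (\<sigma> ` V) (relabel Q V \<sigma> x) = g (\<sigma> ` V) (f (\<sigma> ` V) (relabel P V \<sigma> x'))"
      by (simp add: x' fD 4)
    then show ?case using 4(1,2) by (simp add: x' g P.relabel_closed cD)
  next
    case (5 v)
    have "g {v} (f {v} (ident P v)) = c {v} (ident P v)"
      by (intro g) (auto intro: P.ident_closed)
    then show ?case by (simp add: fD cD)
  next
    case (6 V1 V2 s x y)
    obtain x' where x': "x' \<in> space P (insert s V1)" "x = f (insert s V1) x'"
      using preim[OF finite.insertI[OF 6(1)] 6(5)] by blast
    obtain y' where y': "y' \<in> space P V2" "y = f V2 y'" using preim[OF 6(2,6)] by blast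
    have "g (V1 \<union> V2) (pcomp Q V1 V2 s x y) = g (V1 \<union> V2) (f (V1 \<union> V2) (pcomp P V1 V2 s x' y'))"
      by (simp add: x' y' fD 6)
    then show ?case using 6(1-4) by (simp add: x' y' g P.pcomp_closed cD)
  qed
qed

text \<open>The inverse of \<open>f\<close> is the identity of \<open>P\<close> factored through
  \<open>f\<close>. The isomorphisms that add orientations or roots are obtained in this way from
  the forgetful maps, whose compatibility is the easier one to check.\<close>

lemma operad_iso_inverse:
  assumes "operad P" "operad Q" and f: "structure_map P Q f"
    and g: "\<And>V y. finite V \<Longrightarrow> y \<in> space Q V \<Longrightarrow> g V y \<in> space P V \<and> f V (g V y) = y"
    and gf: "\<And>V x. finite V \<Longrightarrow> x \<in> space P V \<Longrightarrow> g V (f V x) = x"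
  shows "operad_iso Q P g"
proof -
  have onto: "f V ` space P V = space Q V" if "finite V" for V
    using g[OF that] structure_mapD(1)[OF f that] by (force simp: image_iff)
  have id: "structure_map P P (\<lambda>V x. x)"
    by (simp add: structure_map_def)
  have "structure_map Q P g"
    by (rule structure_map_factor[OF assms(1) f onto id gf])
  moreover have "bij_betw (g V) (space Q V) (space P V)" if "finite V" for V
    using g[OF that] gf[OF that] structure_mapD(1)[OF f that]
    by (intro bij_betw_byWitness[of _ "f V"]) auto
  ultimately show ?thesis
    using assms by (simp add: operad_iso_def operad_hom_iff)
qed

section \<open>Quotients by kernels of surjections\<close>

lemma UN1_const: "a \<in> A \<Longrightarrow> (\<And>x. x \<in> A \<Longrightarrow> F x = C) \<Longrightarrow> (\<Union>x\<in>A. F x) = C"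
  by blast

lemma UN2_const:
  "a \<in> A \<Longrightarrow> b \<in> B \<Longrightarrow> (\<And>x y. x \<in> A \<Longrightarrow> y \<in> B \<Longrightarrow> F x y = C) \<Longrightarrow> (\<Union>x\<in>A. \<Union>y\<in>B. F x y) = C"
  by blast

text \<open>The setting of the first isomorphism theorem: a surjection with kernel \<open>I\<close>.
  Only \<open>P\<close> is assumed to be an operad; that \<open>Q\<close> and the quotient are
  operads is a consequence.\<close>

locale operad_epi =
  fixes P :: "('v, 'k::field, 'e) operad_data" and Q :: "('v, 'k, 'f) operad_data"
    and f :: "'v set \<Rightarrow> 'e \<Rightarrow> 'f" and I :: "'v set \<Rightarrow> 'e set"
  assumes operad_P: "operad P" and f: "structure_map P Q f"
    and zero: "\<And>V. finite V \<Longrightarrow> f V (vzero P V) = vzero Q V"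
    and onto: "\<And>V. finite V \<Longrightarrow> f V ` space P V = space Q V"
    and kernel: "\<And>V. finite V \<Longrightarrow> I V = {x \<in> space P V. f V x = vzero Q V}"
begin

sublocale P: operad P by (rule operad_P)

sublocale Q: operad Q by (rule operad_image[OF operad_P f zero onto])

lemmas fD = structure_mapD[OF f]

lemma operad_ideal: "operad_ideal P I"
  unfolding operad_ideal_def subspecies_def
proof (intro conjI allI impI ballI, goal_cases)
  case 1 show ?case by (rule operad_P)
next
  case (2 V) then show ?case by (auto simp: kernel)
next
  case (3 V) then show ?case by (simp add: kernel P.zero_mem zero)
next
  case (4 V x y)
  then show ?case by (simp add: kernel P.add_mem fD Q.zero_add Q.zero_mem)
next
  case (5 V c x)
  then show ?case by (simp add: kernel P.smult_mem fD Q.smult_vzero)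
next
  case (6 V \<sigma> x)
  then show ?case by (simp add: kernel P.relabel_closed fD Q.relabel_zero)
next
  case (7 V1 V2 s x y)
  then have "f (V1 \<union> V2) (pcomp P V1 V2 s x y) = vzero Q (V1 \<union> V2)"
    using Q.pcomp_zero_left[of V1 V2 s "f V2 y"] Q.pcomp_zero_right[of V1 V2 s "f (insert s V1) x"]
    by (auto simp: fD kernel)
  with 7 show ?case by (simp add: kernel P.pcomp_closed)
qed

text \<open>Classes modulo the kernel are the fibres of \<open>f\<close>, which replaces all
  reasoning with representatives \<open>vadd P V x i\<close>.\<close>

lemma coset_eq:
  assumes "finite V" "x \<in> space P V"
  shows "coset P I V x = {x' \<in> space P V. f V x' = f V x}"
proof -
  interpret V: vector_space_on "space P V" "vzero P V" "vadd P V" "vsmult P V"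
    using assms(1) by (rule P.vector_space_on)
  interpret W: vector_space_on "space Q V" "vzero Q V" "vadd Q V" "vsmult Q V"
    using assms(1) by (rule Q.vector_space_on)
  show ?thesis
  proof (intro set_eqI iffI)
    fix x' assume "x' \<in> coset P I V x"
    then obtain i where i: "i \<in> space P V" "f V i = vzero Q V" "x' = vadd P V x i"
      using assms(1) by (auto simp: coset_def kernel)
    have "vadd Q V (f V x) (vzero Q V) = f V x"
      using W.add_commute[OF fD(1)[OF assms] W.zero_closed] W.add_zero[OF fD(1)[OF assms]] by simp
    with i assms show "x' \<in> {x' \<in> space P V. f V x' = f V x}"
      by (simp add: V.add_closed fD)
  next
    fix x' assume "x' \<in> {x' \<in> space P V. f V x' = f V x}"
    then have x': "x' \<in> space P V" "f V x' = f V x" by auto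
    \<comment> \<open>With \<open>y\<close> the negative of \<open>x\<close>, the difference
      \<open>vadd P V x' y\<close> is the kernel element that moves \<open>x\<close> to
      \<open>x'\<close>.\<close>
    obtain y where y: "y \<in> space P V" "vadd P V x y = vzero P V"
      using V.add_inverse[OF assms(2)] by blast
    have "f V (vadd P V x' y) = f V (vadd P V x y)"
      using x' y(1) assms by (simp add: fD)
    then have "vadd P V x' y \<in> I V"
      using assms x' y by (simp add: kernel zero V.add_closed)
    moreover have "vadd P V x (vadd P V x' y) = x'"
    proof -
      have "vadd P V x (vadd P V x' y) = vadd P V x (vadd P V y x')"
        using x' y by (simp add: V.add_commute)
      also have "\<dots> = vadd P V (vadd P V x y) x'"
        using V.add_assoc[OF assms(2) y(1) x'(1)] by simp
      also have "\<dots> = x'" using x' y by (simp add: V.add_zero)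
      finally show ?thesis .
    qed
    ultimately show "x' \<in> coset P I V x"
      unfolding coset_def by force
  qed
qed

text \<open>Well-definedness of the quotient operations: representatives of one class have the same
  value under \<open>f\<close>, so do the results computed from them, and all members of the
  defining unions coincide.\<close>

lemma structure_map_coset: "structure_map P (quotient P I) (coset P I)"
proof -
  have mem: "x \<in> coset P I V x" if "finite V" "x \<in> space P V" for V x
    using that by (simp add: coset_eq)
  have cong: "coset P I V x = coset P I V y"
    if "finite V" "x \<in> space P V" "y \<in> space P V" "f V x = f V y" for V x y
    using that by (simp add: coset_eq)
  show ?thesis
    unfolding structure_map_def
  proof (intro conjI allI impI ballI, goal_cases)
    case (1 V x)
    then show ?case by (simp add: quotient_def)
  next
    case (2 V x y)
    have "coset P I V (vadd P V x' y') = coset P I V (vadd P V x y)"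
      if "x' \<in> coset P I V x" "y' \<in> coset P I V y" for x' y'
      using that 2 by (intro cong) (auto simp: coset_eq P.add_mem fD)
    note UN2_const[OF mem[OF 2(1,2)] mem[OF 2(1,3)] this]
    then show ?case
      by (simp only: quotient_def operad_data.select_convs)
  next
    case (3 V c x)
    have "coset P I V (vsmult P V c x') = coset P I V (vsmult P V c x)"
      if "x' \<in> coset P I V x" for x'
      using that 3 by (intro cong) (auto simp: coset_eq P.smult_mem fD)
    note UN1_const[OF mem[OF 3] this]
    then show ?case
      by (simp only: quotient_def operad_data.select_convs)
  next
    case (4 V \<sigma> x)
    have "coset P I (\<sigma> ` V) (relabel P V \<sigma> x') = coset P I (\<sigma> ` V) (relabel P V \<sigma> x)"
      if "x' \<in> coset P I V x" for x'
      using that 4 by (intro cong) (auto simp: coset_eq P.relabel_closed fD)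
    note UN1_const[OF mem[OF 4(1,3)] this]
    then show ?case
      by (simp only: quotient_def operad_data.select_convs)
  next
    case (5 v)
    show ?case by (simp add: quotient_def)
  next
    case (6 V1 V2 s x y)
    have "coset P I (V1 \<union> V2) (pcomp P V1 V2 s x' y') = coset P I (V1 \<union> V2) (pcomp P V1 V2 s x y)"
      if "x' \<in> coset P I (insert s V1) x" "y' \<in> coset P I V2 y" for x' y'
      using that 6 by (intro cong) (auto simp: coset_eq P.pcomp_closed fD)
    note UN2_const[OF mem[OF finite.insertI[OF 6(1)] 6(5)] mem[OF 6(2,6)] this]
    then show ?case
      by (simp only: quotient_def operad_data.select_convs)
  qed
qed

lemma operad_quotient: "operad (quotient P I)"
  by (rule operad_image[OF operad_P structure_map_coset]) (simp_all add: quotient_def)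

text \<open>Fibres of a surjection are nonempty, hence distinct, and the fibre over
  \<open>f V x\<close> is the class of \<open>x\<close>. Compatibility is that of
  \<open>coset P I\<close> factored through \<open>f\<close>.\<close>

lemma operad_iso_fibre: "operad_iso Q (quotient P I) (\<lambda>V y. {x \<in> space P V. f V x = y})"
proof -
  have "structure_map Q (quotient P I) (\<lambda>V y. {x \<in> space P V. f V x = y})"
    by (rule structure_map_factor[OF operad_P f onto structure_map_coset]) (simp_all add: coset_eq)
  moreover have "bij_betw (\<lambda>y. {x \<in> space P V. f V x = y}) (space Q V) (space (quotient P I) V)"
    if V: "finite V" for V
  proof (rule bij_betw_imageI)
    show "inj_on (\<lambda>y. {x \<in> space P V. f V x = y}) (space Q V)"
    proof (rule inj_onI)
      fix y y' assume y: "y \<in> space Q V"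
        and eq: "{x \<in> space P V. f V x = y} = {x \<in> space P V. f V x = y'}"
      obtain x where "x \<in> space P V" "f V x = y"
        using y onto[OF V] by (metis imageE)
      then show "y = y'" using eq by blast
    qed
    have "space (quotient P I) V = coset P I V ` space P V"
      by (simp add: quotient_def)
    also have "\<dots> = (\<lambda>x. {x' \<in> space P V. f V x' = f V x}) ` space P V"
      using V by (intro image_cong) (simp_all add: coset_eq)
    also have "\<dots> = (\<lambda>y. {x \<in> space P V. f V x = y}) ` f V ` space P V"
      by (simp add: image_image)
    finally show "(\<lambda>y. {x \<in> space P V. f V x = y}) ` space Q V = space (quotient P I) V"
      by (simp add: onto[OF V])
  qed
  ultimately show ?thesis
    by (simp add: operad_iso_def operad_hom_iff operad_quotient Q.operad_axioms)
qed

end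


section \<open>Reconnecting edge ends\<close>

definition ends :: "'a uprod multiset \<Rightarrow> 'a set" where
  "ends g = (\<Union>e\<in>set_mset g. set_uprod e)"

lemma ends_simps [simp]:
  "ends {#} = {}"
  "ends (add_mset e g) = set_uprod e \<union> ends g"
  "ends (g + g') = ends g \<union> ends g'"
  "ends (image_mset (map_uprod f) g) = f ` ends g"
  by (auto simp: ends_def uprod.set_map)

lemma mgraph_on_iff: "mgraph_on V g \<longleftrightarrow> ends g \<subseteq> V"
  by (auto simp: mgraph_on_def ends_def)

text \<open>This is \<open>reconnect_edge\<close> with a possibly different type for the new ends.
  The extra freedom makes forgetting the labels of ends an instance too, with the single choice
  \<open>fst a\<close> for the end \<open>a\<close>.\<close>

lift_definition rewire_edge ::
    "('a \<Rightarrow> 'b set) \<Rightarrow> 'a uprod \<Rightarrow> ('b uprod multiset \<Rightarrow>\<^sub>0 'k::field)" is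
  "\<lambda>A (a, b). \<Sum>a'\<in>A a. \<Sum>b'\<in>A b. basis {#Upair a' b'#}"
proof -
  fix A :: "'a \<Rightarrow> 'b set" and e e' :: "'a \<times> 'a"
  have "(\<Sum>x\<in>A a. \<Sum>y\<in>A b. basis {#Upair x y#} :: 'b uprod multiset \<Rightarrow>\<^sub>0 'k) =
        (\<Sum>y\<in>A b. \<Sum>x\<in>A a. basis {#Upair y x#})" for a b
  proof -
    have "Upair x y = Upair y x" for x y :: 'b by simp
    then show ?thesis by (subst sum.swap) presburger
  qed
  then show "eq_upair e e' \<Longrightarrow>
      (case e of (a, b) \<Rightarrow>
        (\<Sum>a'\<in>A a. \<Sum>b'\<in>A b. basis {#Upair a' b'#} :: 'b uprod multiset \<Rightarrow>\<^sub>0 'k)) =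
      (case e' of (a, b) \<Rightarrow> (\<Sum>a'\<in>A a. \<Sum>b'\<in>A b. basis {#Upair a' b'#}))"
    by (auto simp: eq_upair_def)
qed

lemma rewire_edge_Upair:
  "rewire_edge A (Upair a b) = (\<Sum>a'\<in>A a. \<Sum>b'\<in>A b. basis {#Upair a' b'#})"
  by transfer simp

lemma reconnect_edge_eq: "reconnect_edge = rewire_edge"
proof (intro ext)
  fix A :: "'a \<Rightarrow> 'a set" and e :: "'a uprod"
  show "reconnect_edge A e = (rewire_edge A e :: 'a uprod multiset \<Rightarrow>\<^sub>0 'k::field)"
    by transfer simp
qed

definition rewire ::
    "('a \<Rightarrow> 'b set) \<Rightarrow> 'a uprod multiset \<Rightarrow> ('b uprod multiset \<Rightarrow>\<^sub>0 'k::field)" where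
  "rewire A g = prod_mset (image_mset (rewire_edge A) g)"

lemma reconnect_eq: "reconnect = rewire"
  by (intro ext) (simp add: reconnect_def rewire_def reconnect_edge_eq)

lemma rewire_empty [simp]: "rewire A {#} = 1"
  and rewire_add_mset [simp]: "rewire A (add_mset e g) = rewire_edge A e * rewire A g"
  and rewire_plus [simp]: "rewire A (g + g') = rewire A g * rewire A g'"
  by (simp_all add: rewire_def)

lemma rewire_edge_cong:
  "(\<And>a. a \<in> set_uprod e \<Longrightarrow> A a = B a) \<Longrightarrow> rewire_edge A e = rewire_edge B e"
  by (cases e) (simp add: rewire_edge_Upair)

lemma rewire_cong: "(\<And>a. a \<in> ends g \<Longrightarrow> A a = B a) \<Longrightarrow> rewire A g = rewire B g"
  by (induction g) (auto simp: rewire_edge_cong[of _ A B])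

lemma rewire_singleton: "rewire (\<lambda>a. {f a}) g = basis (image_mset (map_uprod f) g)"
proof (induction g)
  case (add e g)
  then show ?case by (cases e) (simp add: rewire_edge_Upair basis_mult)
qed simp

lemma map_uprod_ident: "map_uprod (\<lambda>a. a) = (\<lambda>e. e)"
  by (rule ext) (rule uprod.map_ident)

lemma rewire_id:
  "(\<And>a. a \<in> ends g \<Longrightarrow> A a = {a}) \<Longrightarrow> rewire A g = (basis g :: 'a uprod multiset \<Rightarrow>\<^sub>0 'b::field)"
proof -
  assume "\<And>a. a \<in> ends g \<Longrightarrow> A a = {a}"
  then have "rewire A g = (rewire (\<lambda>a. {a}) g :: 'a uprod multiset \<Rightarrow>\<^sub>0 'b)"
    by (rule rewire_cong)
  also have "\<dots> = basis g"
    using rewire_singleton[of "\<lambda>a. a" g] by (simp add: map_uprod_ident)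
  finally show ?thesis .
qed

lemma rewire_image: "rewire A (image_mset (map_uprod f) g) = rewire (\<lambda>a. A (f a)) g"
proof (induction g)
  case (add e g)
  then show ?case by (cases e) (simp add: rewire_edge_Upair)
qed simp

text \<open>The product is the bilinear extension of addition of monomials, so multiplicativity on
  monomials is enough.\<close>

lemma lin_mult_hom:
  fixes f :: "'b::cancel_comm_monoid_add \<Rightarrow> ('c::cancel_comm_monoid_add \<Rightarrow>\<^sub>0 'k::field)"
  assumes "\<And>a b. f (a + b) = f a * f b"
  shows "lin f (x * y) = lin f x * lin f y"
proof -
  have "x * y = lin (\<lambda>a. lin (\<lambda>b. basis (a + b)) y) x"
    using lin_mult_left[of basis x y] lin_mult_right[of _ basis y] by (simp add: basis_mult)
  then have "lin f (x * y) = lin (\<lambda>a. lin (\<lambda>b. f a * f b) y) x"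
    by (simp add: lin_lin assms)
  then show ?thesis
    by (simp add: lin_mult_left) (simp add: lin_mult_right)
qed

lemma lin_rewire_mult: "lin (rewire B) (x * y) = lin (rewire B) x * lin (rewire B) y"
  by (rule lin_mult_hom) simp

lemma lin_rewire_edge:
  fixes A :: "'a \<Rightarrow> 'b set" and B :: "'b \<Rightarrow> 'c set"
  assumes "\<And>a. a \<in> set_uprod e \<Longrightarrow> finite (A a)"
    and "\<And>a b. a \<in> set_uprod e \<Longrightarrow> b \<in> A a \<Longrightarrow> finite (B b)"
    and "\<And>a. a \<in> set_uprod e \<Longrightarrow> disjoint_family_on B (A a)"
  shows "lin (rewire B) (rewire_edge A e) =
    (rewire_edge (\<lambda>a. \<Union>b\<in>A a. B b) e :: 'c uprod multiset \<Rightarrow>\<^sub>0 'k::field)"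
proof (cases e)
  case (Upair a b)
  have U: "sum h (\<Union>b\<in>A c. B b) = (\<Sum>b\<in>A c. sum h (B b))" if "c \<in> set_uprod e"
    for c and h :: "'c \<Rightarrow> 'c uprod multiset \<Rightarrow>\<^sub>0 'k"
    using assms[OF that] by (intro sum.UNION_disjoint) (auto simp: disjoint_family_on_def)
  show ?thesis
    by (simp add: Upair rewire_edge_Upair lin_sum U) (rule sum.cong[OF refl], rule sum.swap)
qed

text \<open>Both sides are multiplicative in the edges, so one edge decides. Disjointness matters
  because a union forgets multiplicities: an end reached through two intermediate ends would be
  counted twice on the left and once on the right.\<close>

lemma lin_rewire_rewire:
  fixes A :: "'a \<Rightarrow> 'b set" and B :: "'b \<Rightarrow> 'c set"
  assumes "\<And>a. a \<in> ends g \<Longrightarrow> finite (A a)"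
    and "\<And>a b. a \<in> ends g \<Longrightarrow> b \<in> A a \<Longrightarrow> finite (B b)"
    and "\<And>a. a \<in> ends g \<Longrightarrow> disjoint_family_on B (A a)"
  shows "lin (rewire B) (rewire A g) = (rewire (\<lambda>a. \<Union>b\<in>A a. B b) g :: 'c uprod multiset \<Rightarrow>\<^sub>0 'k::field)"
  using assms
proof (induction g)
  case empty
  show ?case using lin_basis[of "rewire B" "{#}"] by simp
next
  case (add e g)
  have "lin (rewire B) (rewire_edge A e) =
      (rewire_edge (\<lambda>a. \<Union>b\<in>A a. B b) e :: 'c uprod multiset \<Rightarrow>\<^sub>0 'k)"
    using add.prems by (intro lin_rewire_edge) auto
  moreover have "lin (rewire B) (rewire A g) =
      (rewire (\<lambda>a. \<Union>b\<in>A a. B b) g :: 'c uprod multiset \<Rightarrow>\<^sub>0 'k)"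
    using add.prems by (intro add.IH) auto
  ultimately show ?case by (simp add: lin_rewire_mult)
qed

section \<open>Supports of reconnections, as a relation between multigraphs\<close>

definition choices :: "('a \<Rightarrow> 'b set) \<Rightarrow> 'a uprod \<Rightarrow> 'b uprod set" where
  "choices A e = {Upair a' b' | a b a' b'. e = Upair a b \<and> a' \<in> A a \<and> b' \<in> A b}"

lemma choices_Upair: "choices A (Upair a b) = {Upair a' b' | a' b'. a' \<in> A a \<and> b' \<in> A b}"
  by (auto simp: choices_def) (metis Upair_inject)+

text \<open>What remains of \<open>rewire\<close> when coefficients are dropped: a matching of edges
  in which each new edge is an admissible choice for the old one. Closure of a basis under
  composition only needs this much.\<close>

definition rewiring :: "('a \<Rightarrow> 'b set) \<Rightarrow> 'a uprod multiset \<Rightarrow> 'b uprod multiset \<Rightarrow> bool" where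
  "rewiring A = rel_mset (\<lambda>e e'. e' \<in> choices A e)"

lemma rewiring_empty_iff: "rewiring A {#} g' \<longleftrightarrow> g' = {#}"
  by (auto simp: rewiring_def rel_mset_Zero msed_rel_invL dest: rel_mset_size)

lemma rewiring_add_msetE:
  assumes "rewiring A (add_mset e g) g'"
  obtains e' g'' where "g' = add_mset e' g''" "e' \<in> choices A e" "rewiring A g g''"
  using msed_rel_invL[of "\<lambda>e e'. e' \<in> choices A e" e g g'] assms
  by (auto simp: rewiring_def)

lemma rewiring_add_mset:
  "e' \<in> choices A e \<Longrightarrow> rewiring A g g' \<Longrightarrow> rewiring A (add_mset e g) (add_mset e' g')"
  unfolding rewiring_def by (rule rel_mset_Plus)

lemma rewiring_induct [consumes 1, case_names empty add]:
  assumes "rewiring A g g'"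
    and "Q {#} {#}"
    and "\<And>e g e' g'. rewiring A g g' \<Longrightarrow> Q g g' \<Longrightarrow> e' \<in> choices A e \<Longrightarrow>
      Q (add_mset e g) (add_mset e' g')"
  shows "Q g g'"
  using assms(1)
proof (induction g arbitrary: g')
  case empty
  then show ?case using assms(2) by (simp add: rewiring_empty_iff)
next
  case (add e g)
  obtain e' g'' where g': "g' = add_mset e' g''" "e' \<in> choices A e" "rewiring A g g''"
    using add.prems by (rule rewiring_add_msetE)
  show ?case unfolding g'(1) by (rule assms(3)[OF g'(3) add.IH[OF g'(3)] g'(2)])
qed

lemma supp_rewire_edge: "supp (rewire_edge A e) \<subseteq> (\<lambda>e'. {#e'#}) ` choices A e"
proof (cases e)
  case (Upair a b)
  have "supp (rewire_edge A e) \<subseteq> (\<Union>a'\<in>A a. \<Union>b'\<in>A b. {{#Upair a' b'#}})"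
    unfolding Upair rewire_edge_Upair
    by (rule order.trans[OF supp_sum UN_mono[OF order.refl order.trans[OF supp_sum]]]) auto
  also have "\<dots> \<subseteq> (\<lambda>e'. {#e'#}) ` choices A e"
    unfolding Upair choices_Upair by blast
  finally show ?thesis .
qed

lemma supp_rewire: "g' \<in> supp (rewire A g :: _ \<Rightarrow>\<^sub>0 'k::field) \<Longrightarrow> rewiring A g g'"
proof (induction g arbitrary: g')
  case empty
  then show ?case by (simp add: rewiring_empty_iff)
next
  case (add e g)
  then obtain a b where ab: "g' = a + b" "a \<in> supp (rewire_edge A e :: _ \<Rightarrow>\<^sub>0 'k)"
      "b \<in> supp (rewire A g :: _ \<Rightarrow>\<^sub>0 'k)"
    using keys_mult[of "rewire_edge A e :: _ \<Rightarrow>\<^sub>0 'k" "rewire A g"] by auto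
  then obtain e' where "a = {#e'#}" "e' \<in> choices A e"
    using supp_rewire_edge[of A e] by blast
  with ab add.IH show ?case by (simp add: rewiring_add_mset)
qed

lemma rewiring_ends:
  assumes "rewiring A g g'"
  shows "ends g' \<subseteq> (\<Union>a\<in>ends g. A a)"
  using assms
proof (induction rule: rewiring_induct)
  case (add e g e' g')
  then show ?case by (cases e) (auto simp: choices_Upair)
qed simp

text \<open>Each new end comes from an old one, and \<phi> sees only this origin. The intended
  \<phi> contracts the inserted vertices back to the point they replaced.\<close>

lemma rewiring_map:
  assumes "rewiring A g g'"
    and "\<And>a b. a \<in> ends g \<Longrightarrow> b \<in> A a \<Longrightarrow> \<phi> b = \<psi> a"
  shows "image_mset (map_uprod \<phi>) g' = image_mset (map_uprod \<psi>) g"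
proof -
  have "(\<forall>a\<in>ends g. \<forall>b\<in>A a. \<phi> b = \<psi> a) \<longrightarrow> image_mset (map_uprod \<phi>) g' = image_mset (map_uprod \<psi>) g"
    using assms(1)
  proof (induction rule: rewiring_induct)
    case (add e g e' g')
    then show ?case by (cases e) (auto simp: choices_Upair)
  qed simp
  with assms(2) show ?thesis by blast
qed

text \<open>When edges are indexed by a set, a reconnection is a choice for each index. For the
  edges of a rooted tree, indexed by the vertices other than the root, it amounts to a new parent
  function.\<close>

lemma rewiring_image_mset_set:
  assumes "finite M" "rewiring A (image_mset f (mset_set M)) g'"
  shows "\<exists>f'. (\<forall>m\<in>M. f' m \<in> choices A (f m)) \<and> g' = image_mset f' (mset_set M)"
  using assms
proof (induction M arbitrary: g' rule: finite_induct)
  case empty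
  then show ?case by (simp add: rewiring_empty_iff)
next
  case (insert m M)
  then have "rewiring A (add_mset (f m) (image_mset f (mset_set M))) g'"
    by simp
  then obtain e' g'' where e': "g' = add_mset e' g''" "e' \<in> choices A (f m)"
    "rewiring A (image_mset f (mset_set M)) g''"
    by (rule rewiring_add_msetE)
  obtain f' where f': "\<forall>m\<in>M. f' m \<in> choices A (f m)" "g'' = image_mset f' (mset_set M)"
    using insert.IH[OF e'(3)] by blast
  have "image_mset (f'(m := e')) (mset_set M) = image_mset f' (mset_set M)"
    using insert.hyps by (intro image_mset_cong) auto
  with e' f' insert.hyps have "g' = image_mset (f'(m := e')) (mset_set (insert m M))"
    by (simp add: fun_upd_same del: fun_upd_apply)
  moreover have "\<forall>k\<in>insert m M. (f'(m := e')) k \<in> choices A (f k)"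
    using e' f' by auto
  ultimately show ?case by blast
qed

lemma rewiring_plusE:
  assumes "rewiring A (g1 + g2) g'"
  obtains g1' g2' where "g' = g1' + g2'" "rewiring A g1 g1'" "rewiring A g2 g2'"
  using assms
proof (induction g1 arbitrary: g' thesis)
  case empty
  then show ?case by (simp add: rewiring_empty_iff)
next
  case (add e g1)
  have "rewiring A (add_mset e (g1 + g2)) g'" using add.prems(2) by simp
  then obtain e' g'' where e': "g' = add_mset e' g''" "e' \<in> choices A e" "rewiring A (g1 + g2) g''"
    by (rule rewiring_add_msetE)
  obtain g1' g2' where "g'' = g1' + g2'" "rewiring A g1 g1'" "rewiring A g2 g2'"
    using add.IH[OF _ e'(3)] by blast
  with e' show ?case
    by (intro add.prems(1)[of "add_mset e' g1'" g2']) (simp_all add: rewiring_add_mset)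
qed


section \<open>The operad of pointed oriented multigraphs\<close>

definition plug :: "'v set \<Rightarrow> 'v \<Rightarrow> 'v \<Rightarrow> 'v \<times> end_label \<Rightarrow> ('v \<times> end_label) set" where
  "plug V2 s r = (\<lambda>(v, l). if v \<noteq> s then {(v, l)} else
    (case l of Source \<Rightarrow> {(r, Source)} | Target \<Rightarrow> (\<lambda>w. (w, Target)) ` V2))"

lemma plug_simps:
  "v \<noteq> s \<Longrightarrow> plug V2 s r (v, l) = {(v, l)}"
  "plug V2 s r (s, Source) = {(r, Source)}"
  "plug V2 s r (s, Target) = (\<lambda>w. (w, Target)) ` V2"
  by (simp_all add: plug_def)

lemma plug_cases:
  obtains "fst a \<noteq> s" "plug V2 s r a = {a}"
  | "a = (s, Source)" "plug V2 s r a = {(r, Source)}"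
  | "a = (s, Target)" "plug V2 s r a = (\<lambda>w. (w, Target)) ` V2"
  by (cases a; cases "snd a") (auto simp: plug_def)

lemma finite_plug: "finite V2 \<Longrightarrow> finite (plug V2 s r a)"
  by (rule plug_cases[of a s V2 r]) simp_all

lemma plug_subset: "r \<in> V2 \<Longrightarrow> fst a \<in> insert s V1 \<Longrightarrow> fst ` plug V2 s r a \<subseteq> V1 \<union> V2"
  by (rule plug_cases[of a s V2 r]) auto

lemma MGor_pcomp_eq: "MGor_pcomp V2 s (h1, v1) (h2, v2) =
    lin (\<lambda>h. basis (h, if v1 \<noteq> s then v1 else v2)) (rewire (plug V2 s v2) h1 * basis h2)"
  by (simp add: MGor_pcomp_def plug_def reconnect_eq)

lemma MGor_pcomp_left:
  "bilin (MGor_pcomp V s) (lin (\<lambda>h. basis (h, r)) x) (basis (h', r')) =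
    lin (\<lambda>h. basis (h, if r \<noteq> s then r else r')) (lin (rewire (plug V s r')) x * basis h')"
  unfolding bilin_def lin_lin lin_basis lin_mult_left MGor_pcomp_eq ..

lemma MGor_pcomp_right:
  "bilin (MGor_pcomp V s) (basis (h', r')) (lin (\<lambda>h. basis (h, r)) x) =
    lin (\<lambda>h. basis (h, if r' \<noteq> s then r' else r)) (rewire (plug V s r) h' * x)"
proof -
  have "rewire (plug V s r) h' * x = lin (\<lambda>h. rewire (plug V s r) h' * basis h) x"
    using lin_mult_right[of _ basis x] by simp
  then show ?thesis
    by (simp only: bilin_def lin_lin lin_basis MGor_pcomp_eq)
qed

text \<open>Source and target ends at \<open>s\<close> go to ends with different labels, so a
  collision could only involve an end left in place at a vertex of \<open>V\<close>.\<close>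

lemma disjoint_family_on_plug:
  assumes "r \<in> V" "\<And>w l. (w, l) \<in> S \<Longrightarrow> w \<noteq> s \<Longrightarrow> w \<notin> V"
  shows "disjoint_family_on (plug V s r) S"
  unfolding disjoint_family_on_def
proof (intro ballI impI)
  fix a b assume "a \<in> S" "b \<in> S" "a \<noteq> b"
  with assms show "plug V s r a \<inter> plug V s r b = {}"
    by (cases rule: plug_cases[of a s V r]; cases rule: plug_cases[of b s V r]; cases a; cases b) auto
qed

lemma disjoint_family_on_singleton [simp]: "disjoint_family_on F {a}"
  by (simp add: disjoint_family_on_def)

lemma ends_in: "mgraph_on V (underlying h) \<Longrightarrow> (v, l) \<in> ends h \<Longrightarrow> v \<in> V"
  by (force simp: mgraph_on_iff underlying_def)

lemma plug_id:
  assumes "mgraph_on V (underlying h)" "s \<notin> V"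
  shows "rewire (plug W s r) h = basis h"
proof (rule rewire_id)
  fix a assume "a \<in> ends h"
  then have "fst a \<noteq> s"
    using ends_in[OF assms(1), of "fst a" "snd a"] assms(2) by auto
  then show "plug W s r a = {a}"
    by (cases a) (simp add: plug_simps)
qed

lemma supp_MGor_pcomp:
  assumes "(h, r) \<in> supp (MGor_pcomp V2 s (h1, r1) (h2, r2) :: _ \<Rightarrow>\<^sub>0 'k::field)"
  obtains h' where "rewiring (plug V2 s r2) h1 h'" "h = h' + h2" "r = (if r1 \<noteq> s then r1 else r2)"
proof -
  let ?x = "rewire (plug V2 s r2) h1 * basis h2 :: _ \<Rightarrow>\<^sub>0 'k"
  have "(h, r) \<in> (\<lambda>h. (h, if r1 \<noteq> s then r1 else r2)) ` supp ?x"
    using subsetD[OF supp_lin_basis assms[unfolded MGor_pcomp_eq]] .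
  then have "h \<in> supp ?x" and r: "r = (if r1 \<noteq> s then r1 else r2)" by auto
  then obtain h' where "h' \<in> supp (rewire (plug V2 s r2) h1 :: _ \<Rightarrow>\<^sub>0 'k)" "h = h' + h2"
    using keys_mult[of "rewire (plug V2 s r2) h1 :: _ \<Rightarrow>\<^sub>0 'k" "basis h2"] by auto
  with r that show ?thesis using supp_rewire by blast
qed

lemma underlying_simps [simp]:
  "underlying {#} = {#}"
  "underlying (add_mset e h) = add_mset (map_uprod fst e) (underlying h)"
  "underlying (h + h') = underlying h + underlying h'"
  "ends (underlying h) = fst ` ends h"
  by (simp_all add: underlying_def)

definition relabel_ends :: "('v \<Rightarrow> 'v) \<Rightarrow> 'v omgraph \<Rightarrow> 'v omgraph" where
  "relabel_ends \<sigma> = image_mset (map_uprod (map_prod \<sigma> id))"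

lemma ends_relabel_ends [simp]: "ends (relabel_ends \<sigma> h) = map_prod \<sigma> id ` ends h"
  by (simp add: relabel_ends_def)

lemma relabel_ends_cong:
  assumes "\<And>a. a \<in> ends h \<Longrightarrow> \<sigma> (fst a) = \<tau> (fst a)"
  shows "relabel_ends \<sigma> h = relabel_ends \<tau> h"
  unfolding relabel_ends_def
  by (intro image_mset_cong uprod.map_cong refl) (use assms in \<open>force simp: ends_def\<close>)

lemma underlying_relabel_ends: "underlying (relabel_ends \<sigma> h) = image_mset (map_uprod \<sigma>) (underlying h)"
  unfolding underlying_def relabel_ends_def
  by (simp add: multiset.map_comp o_def uprod.map_comp)

text \<open>Reconnection fixes the factors that do not contain the marked vertex, so each axiom says
  that two composite rules \<open>plug\<close> agree at every end of the first factor and that the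
  roots agree.\<close>

lemma operad_MGor: "operad (MGor :: ('v, 'k::field, 'v omgraph \<times> 'v \<Rightarrow>\<^sub>0 'k) operad_data)"
  unfolding MGor_def
proof (rule free_operadI, goal_cases)
  case 1 show ?case by auto
next
  case (2 v) show ?case by (simp add: mgraph_on_iff)
next
  case (3 \<sigma> v) show ?case by simp
next
  case (4 V \<sigma> b)
  then show ?case
    by (cases b) (auto simp: mgraph_on_iff simp flip: relabel_ends_def)
next
  case (5 V \<sigma> \<tau> b)
  then show ?case
    by (cases b) (auto simp: mgraph_on_iff simp flip: relabel_ends_def intro!: relabel_ends_cong)
next
  case (6 b)
  show ?case by (cases b) (simp add: prod.map_id0 uprod.map_id0 multiset.map_id0)
next
  case (7 \<sigma> \<tau> b)
  show ?case
    by (cases b) (simp add: multiset.map_comp o_def uprod.map_comp prod.map_comp id_def)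
next
  case (8 V1 V2 s a b)
  obtain h1 r1 h2 r2 where ab: "a = (h1, r1)" "b = (h2, r2)" by (cases a; cases b)
  show ?case
  proof (rule subsetI)
    fix p
    assume p: "p \<in> supp (MGor_pcomp V2 s a b :: _ \<Rightarrow>\<^sub>0 'k)"
    obtain h r where hr: "p = (h, r)" by (cases p)
    obtain h' where h': "rewiring (plug V2 s r2) h1 h'" "h = h' + h2"
      "r = (if r1 \<noteq> s then r1 else r2)"
      using p unfolding hr ab by (rule supp_MGor_pcomp)
    have "r \<in> V1 \<union> V2" using 8 ab h'(3) by auto
    have "fst ` plug V2 s r2 c \<subseteq> V1 \<union> V2" if "c \<in> ends h1" for c
      using 8 ab that by (intro plug_subset) (auto simp: mgraph_on_iff)
    with rewiring_ends[OF h'(1)] have "fst ` ends h' \<subseteq> V1 \<union> V2" by blast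
    then have "mgraph_on (V1 \<union> V2) (underlying h)"
      using 8 ab h' by (auto simp: mgraph_on_iff)
    with \<open>r \<in> V1 \<union> V2\<close> show "p \<in> {(h, v). mgraph_on (V1 \<union> V2) (underlying h) \<and> v \<in> V1 \<union> V2}"
      by (simp add: hr)
  qed
next
  case (9 V1 V2 s \<sigma> \<tau> a b)
  obtain h1 r1 h2 r2 where ab: "a = (h1, r1)" "b = (h2, r2)" by (cases a; cases b)
  let ?\<rho> = "\<lambda>v. if v \<in> V1 then \<sigma> v else \<tau> v"
  have in1: "v = s \<or> v \<in> V1" if "(v, l) \<in> ends h1" for v l
    using 9(8,9) ab that by (auto dest: ends_in)
  have in2: "v \<in> V2" if "(v, l) \<in> ends h2" for v l
    using 9(8,9) ab that by (auto dest: ends_in)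
  have r: "r1 = s \<or> r1 \<in> V1" "r2 \<in> V2" using 9 ab by auto
  have \<sigma>: "\<sigma> v \<noteq> \<sigma> s" if "v \<in> V1" for v
    using 9(4,5) that by (auto simp: inj_on_def)
  have notin: "v \<notin> V1" if "v \<in> V2" for v using 9(3) that by auto
  \<comment> \<open>Relabelling is a rewiring in which every end has exactly one choice.\<close>
  have single: "lin (\<lambda>h. basis (relabel_ends \<rho> h)) x = lin (rewire (\<lambda>a. {map_prod \<rho> id a})) x"
    for \<rho> and x :: "'v omgraph \<Rightarrow>\<^sub>0 'k"
    unfolding relabel_ends_def by (rule lin_cong) (simp add: rewire_singleton)
  have dis: "disjoint_family_on (\<lambda>a. {map_prod ?\<rho> id a}) (plug V2 s r2 a)" for a
    using 9(6) notin by (cases rule: plug_cases[of a s V2 r2]) (auto simp: disjoint_family_on_def inj_on_def)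
  have un: "(\<Union>b\<in>plug V2 s r2 a. {map_prod ?\<rho> id b}) = plug (\<tau> ` V2) (\<sigma> s) (\<tau> r2) (map_prod \<sigma> id a)"
    if "a \<in> ends h1" for a
  proof (cases rule: plug_cases[of a s V2 r2])
    case 1
    with that in1[of "fst a" "snd a"] \<sigma> show ?thesis by (cases a) (auto simp: plug_simps)
  next
    case 2
    with r notin show ?thesis by (simp add: plug_simps)
  next
    case 3
    have e1: "(\<lambda>x. (?\<rho> x, Target)) ` V2 = (\<lambda>x. (\<tau> x, Target)) ` V2"
      using notin by (intro image_cong) auto
    have e2: "(\<Union>b\<in>(\<lambda>w. (w, Target)) ` V2. {map_prod \<rho> id b}) = (\<lambda>x. (\<rho> x, Target)) ` V2" for \<rho>
      by auto
    have "(\<Union>b\<in>plug V2 s r2 a. {map_prod ?\<rho> id b}) = (\<lambda>x. (\<tau> x, Target)) ` V2"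
      unfolding 3(2) e2 by (rule e1)
    with 3(1) show ?thesis by (simp add: plug_simps image_image)
  qed
  have "lin (rewire (\<lambda>a. {map_prod ?\<rho> id a})) (rewire (plug V2 s r2) h1) =
      rewire (\<lambda>a. \<Union>b\<in>plug V2 s r2 a. {map_prod ?\<rho> id b}) h1"
    using dis 9(2) by (intro lin_rewire_rewire) (auto simp: finite_plug)
  also have "\<dots> = rewire (plug (\<tau> ` V2) (\<sigma> s) (\<tau> r2)) (relabel_ends \<sigma> h1)"
    unfolding relabel_ends_def rewire_image by (intro rewire_cong un)
  finally have 1: "lin (rewire (\<lambda>a. {map_prod ?\<rho> id a})) (rewire (plug V2 s r2) h1) =
      (rewire (plug (\<tau> ` V2) (\<sigma> s) (\<tau> r2)) (relabel_ends \<sigma> h1) :: _ \<Rightarrow>\<^sub>0 'k)" .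
  have 2: "relabel_ends ?\<rho> h2 = relabel_ends \<tau> h2"
    using in2 notin by (intro relabel_ends_cong) force
  have 3: "?\<rho> (if r1 \<noteq> s then r1 else r2) = (if \<sigma> r1 \<noteq> \<sigma> s then \<sigma> r1 else \<tau> r2)"
    using r \<sigma> notin by auto
  have "lin (\<lambda>(h, v). basis (relabel_ends ?\<rho> h, ?\<rho> v)) (MGor_pcomp V2 s a b :: _ \<Rightarrow>\<^sub>0 'k) =
      lin (\<lambda>h. basis (h, ?\<rho> (if r1 \<noteq> s then r1 else r2)))
        (lin (\<lambda>h. basis (relabel_ends ?\<rho> h)) (rewire (plug V2 s r2) h1 * basis h2))"
    unfolding ab MGor_pcomp_eq lin_lin lin_basis by simp
  also have "\<dots> = lin (\<lambda>h. basis (h, ?\<rho> (if r1 \<noteq> s then r1 else r2)))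
        (rewire (plug (\<tau> ` V2) (\<sigma> s) (\<tau> r2)) (relabel_ends \<sigma> h1) * basis (relabel_ends \<tau> h2))"
    unfolding single lin_rewire_mult 1 lin_basis rewire_singleton
    by (simp only: 2 flip: relabel_ends_def)
  also have "\<dots> = MGor_pcomp (\<tau> ` V2) (\<sigma> s) (relabel_ends \<sigma> h1, \<sigma> r1) (relabel_ends \<tau> h2, \<tau> r2)"
    unfolding MGor_pcomp_eq 3 ..
  finally show ?case
    by (simp add: ab relabel_ends_def case_prod_unfold)
next
  case (10 V1 V2 V3 s u a b d)
  obtain h1 r1 h2 r2 h3 r3 where ab: "a = (h1, r1)" "b = (h2, r2)" "d = (h3, r3)"
    by (cases a; cases b; cases d)
  have r: "r2 \<in> V2" "r3 \<in> V3" "r2 \<noteq> u" "r3 \<noteq> s" and nin: "u \<notin> V2" "s \<notin> V3" using 10 ab by auto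
  have dis2: "disjoint_family_on (plug V3 u r3) (plug V2 s r2 a)" for a
    using 10 r by (cases rule: plug_cases[of a s V2 r2]) (auto intro!: disjoint_family_on_plug)
  have dis3: "disjoint_family_on (plug V2 s r2) (plug V3 u r3 a)" for a
    using 10 r by (cases rule: plug_cases[of a u V3 r3]) (auto intro!: disjoint_family_on_plug)
  \<comment> \<open>Neither reconnection creates ends at the marked vertex of the other, so they
    commute end by end.\<close>
  have un: "(\<Union>b\<in>plug V2 s r2 a. plug V3 u r3 b) = (\<Union>b\<in>plug V3 u r3 a. plug V2 s r2 b)" for a
    using 10(7) r nin
    by (cases a; cases "snd a"; cases "fst a = s"; cases "fst a = u") (auto simp: plug_def)
  have "lin (rewire (plug V3 u r3)) (rewire (plug V2 s r2) h1) =
      (rewire (\<lambda>a. \<Union>b\<in>plug V2 s r2 a. plug V3 u r3 b) h1 :: _ \<Rightarrow>\<^sub>0 'k)"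
    using dis2 10 by (intro lin_rewire_rewire) (auto simp: finite_plug)
  also have "\<dots> = lin (rewire (plug V2 s r2)) (rewire (plug V3 u r3) h1)"
    unfolding un using dis3 10 by (intro lin_rewire_rewire[symmetric]) (auto simp: finite_plug)
  finally have 1: "lin (rewire (plug V3 u r3)) (rewire (plug V2 s r2) h1) =
      (lin (rewire (plug V2 s r2)) (rewire (plug V3 u r3) h1) :: _ \<Rightarrow>\<^sub>0 'k)" .
  have 2: "rewire (plug V3 u r3) h2 = (basis h2 :: _ \<Rightarrow>\<^sub>0 'k)"
    "rewire (plug V2 s r2) h3 = (basis h3 :: _ \<Rightarrow>\<^sub>0 'k)"
    using 10 ab by (auto intro!: plug_id)
  show ?case
    unfolding ab MGor_pcomp_eq MGor_pcomp_left lin_rewire_mult lin_basis 1 2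
    using r 10(7) by (auto simp: mult_ac)
next
  case (11 V1 V2 V3 s u a b d)
  obtain h1 r1 h2 r2 h3 r3 where ab: "a = (h1, r1)" "b = (h2, r2)" "d = (h3, r3)"
    by (cases a; cases b; cases d)
  have r: "r2 = u \<or> r2 \<in> V2" "r3 \<in> V3" "r1 = s \<or> r1 \<in> V1" using 11 ab by auto
  have nin: "u \<notin> V1" "u \<notin> V2" "s \<notin> V1" using 11 by auto
  have in1: "v = s \<or> v \<in> V1" if "(v, l) \<in> ends h1" for v l
    using 11(9) ab that by (auto dest: ends_in)
  have dis: "disjoint_family_on (plug V3 u r3) (plug (insert u V2) s r2 a)" for a
    using 11 r by (cases rule: plug_cases[of a s "insert u V2" r2]) (auto intro!: disjoint_family_on_plug)
  \<comment> \<open>A source end at \<open>s\<close> moves to \<open>r2\<close>, and on to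
    \<open>r3\<close> if \<open>r2 = u\<close>; this is the root of the composite of the last two
    factors.\<close>
  have un: "(\<Union>b\<in>plug (insert u V2) s r2 a. plug V3 u r3 b) =
      plug (V2 \<union> V3) s (if r2 \<noteq> u then r2 else r3) a" if "a \<in> ends h1" for a
  proof (cases rule: plug_cases[of a s "insert u V2" r2])
    case 1
    with that in1[of "fst a" "snd a"] nin show ?thesis by (cases a) (auto simp: plug_def)
  next
    case 2
    then show ?thesis by (simp add: plug_def)
  next
    case 3
    have "(\<Union>b\<in>(\<lambda>w. (w, Target)) ` V2. plug V3 u r3 b) = (\<lambda>w. (w, Target)) ` V2"
      using nin by (auto simp: plug_def)
    with 3 show ?thesis by (auto simp: plug_simps)
  qed
  have "lin (rewire (plug V3 u r3)) (rewire (plug (insert u V2) s r2) h1) =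
      (rewire (\<lambda>a. \<Union>b\<in>plug (insert u V2) s r2 a. plug V3 u r3 b) h1 :: _ \<Rightarrow>\<^sub>0 'k)"
    using dis 11 by (intro lin_rewire_rewire) (auto simp: finite_plug)
  also have "\<dots> = rewire (plug (V2 \<union> V3) s (if r2 \<noteq> u then r2 else r3)) h1"
    by (intro rewire_cong un)
  finally have 1: "lin (rewire (plug V3 u r3)) (rewire (plug (insert u V2) s r2) h1) =
      (rewire (plug (V2 \<union> V3) s (if r2 \<noteq> u then r2 else r3)) h1 :: _ \<Rightarrow>\<^sub>0 'k)" .
  have 2: "(if (if r1 \<noteq> s then r1 else r2) \<noteq> u then (if r1 \<noteq> s then r1 else r2) else r3) =
      (if r1 \<noteq> s then r1 else if r2 \<noteq> u then r2 else r3)"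
    using r nin by auto
  show ?case
    unfolding ab MGor_pcomp_eq MGor_pcomp_left MGor_pcomp_right lin_rewire_mult lin_basis 1 2
    by (simp only: mult.assoc)
next
  case (12 V s b)
  then show ?case by (cases b) (simp add: MGor_pcomp_eq)
next
  case (13 V s v a)
  obtain h r where a: "a = (h, r)" by (cases a)
  have "plug {v} s v = (\<lambda>c. {map_prod (id(s := v)) id c})"
    by (auto simp: plug_def fun_eq_iff split: end_label.split)
  then show ?case
    by (simp add: a MGor_pcomp_eq rewire_singleton)
qed


section \<open>Rooted spanning trees and parent functions\<close>

text \<open>The strictly decreasing rank \<open>d\<close> forces every vertex to reach
  \<open>r\<close> by iterating \<open>p\<close>. Outside \<open>V - {r}\<close> the function
  \<open>p\<close> is unconstrained, so it is not determined by the tree.\<close>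

definition rooting :: "'v set \<Rightarrow> 'v \<Rightarrow> ('v \<Rightarrow> 'v) \<Rightarrow> bool" where
  "rooting V r p \<longleftrightarrow> r \<in> V \<and> p ` (V - {r}) \<subseteq> V \<and> (\<exists>d :: 'v \<Rightarrow> nat. \<forall>v\<in>V - {r}. d (p v) < d v)"

definition parent_tree :: "'v set \<Rightarrow> 'v \<Rightarrow> ('v \<Rightarrow> 'v) \<Rightarrow> 'v mgraph" where
  "parent_tree V r p = image_mset (\<lambda>v. Upair v (p v)) (mset_set (V - {r}))"

text \<open>Every vertex other than the root carries exactly one source end, on the edge to its
  parent, and the root carries none. The comparison of compositions depends on this count.\<close>

definition arcs :: "'v set \<Rightarrow> 'v \<Rightarrow> ('v \<Rightarrow> 'v) \<Rightarrow> 'v omgraph" where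
  "arcs V r p = image_mset (\<lambda>v. Upair (v, Source) (p v, Target)) (mset_set (V - {r}))"

definition targets :: "'v mgraph \<Rightarrow> 'v omgraph" where
  "targets k = image_mset (map_uprod (\<lambda>v. (v, Target))) k"

lemma underlying_arcs [simp]: "underlying (arcs V r p) = parent_tree V r p"
  by (simp add: underlying_def arcs_def parent_tree_def multiset.map_comp o_def)

lemma underlying_targets [simp]: "underlying (targets k) = k"
  by (simp add: underlying_def targets_def multiset.map_comp o_def uprod.map_comp map_uprod_ident)

lemma targets_simps [simp]: "targets {#} = {#}" "targets (k + k') = targets k + targets k'"
  by (simp_all add: targets_def)

lemma ends_targets [simp]: "ends (targets k) = (\<lambda>v. (v, Target)) ` ends k"
  by (simp add: targets_def)

lemma targetsI:
  assumes "\<And>v l. (v, l) \<in> ends h \<Longrightarrow> l = Target"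
  shows "h = targets (underlying h)"
proof -
  have "targets (underlying h) = image_mset (map_uprod (\<lambda>a. (fst a, Target))) h"
    by (simp add: targets_def underlying_def multiset.map_comp o_def uprod.map_comp)
  also have "\<dots> = image_mset (map_uprod (\<lambda>a. a)) h"
    by (intro image_mset_cong uprod.map_cong refl) (use assms in \<open>force simp: ends_def\<close>)
  finally show ?thesis by (simp add: map_uprod_ident)
qed

lemma sym_adj: "sym (adj g)"
proof (rule symI)
  fix u v assume "(u, v) \<in> adj g"
  moreover have "Upair u v = Upair v u" by simp
  ultimately show "(v, u) \<in> adj g" unfolding adj_def by simp
qed

lemma adj_mono: "g \<subseteq># g' \<Longrightarrow> adj g \<subseteq> adj g'"
  by (auto simp: adj_def mset_subset_eqD)

lemma connected_on_mono:
  assumes "connected_on V g" "g \<subseteq># g'" "mgraph_on V g'"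
  shows "connected_on V g'"
  using assms rtrancl_mono[OF adj_mono[OF assms(2)]] unfolding connected_on_def by blast

lemma gdist_walk: "(u, v) \<in> (adj g)\<^sup>* \<Longrightarrow> (u, v) \<in> adj g ^^ gdist g u v"
  unfolding gdist_def by (rule LeastI_ex) (simp add: rtrancl_power)

lemma gdist_le: "(u, v) \<in> adj g ^^ n \<Longrightarrow> gdist g u v \<le> n"
  unfolding gdist_def by (rule Least_le)

section \<open>Trees given by parent functions\<close>

lemma mem_parent_tree:
  assumes "finite V"
  shows "e \<in># parent_tree V r p \<longleftrightarrow> (\<exists>v\<in>V - {r}. e = Upair v (p v))"
  using assms by (auto simp: parent_tree_def)

lemma adj_parent_tree:
  assumes "finite V"
  shows "(u, v) \<in> adj (parent_tree V r p) \<longleftrightarrow> (u \<in> V - {r} \<and> v = p u) \<or> (v \<in> V - {r} \<and> u = p v)"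
  using assms by (auto simp: adj_def mem_parent_tree)

lemma rooting_ne: "rooting V r p \<Longrightarrow> v \<in> V \<Longrightarrow> v \<noteq> r \<Longrightarrow> p v \<noteq> v"
  by (force simp: rooting_def)

text \<open>Two vertices with the same parent edge would be parents of each other, against the
  decrease of the rank.\<close>

lemma inj_on_parent_edge:
  assumes "rooting V r p"
  shows "inj_on (\<lambda>v. Upair v (p v)) (V - {r})"
proof (rule inj_onI)
  fix v w assume *: "v \<in> V - {r}" "w \<in> V - {r}" "Upair v (p v) = Upair w (p w)"
  obtain d :: "'a \<Rightarrow> nat" where "\<forall>v\<in>V - {r}. d (p v) < d v"
    using assms by (auto simp: rooting_def)
  with * have "d (p v) < d v" "d (p w) < d w" by auto
  with *(3) show "v = w" by auto
qed

lemma count_parent_tree: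
  assumes "finite V" "rooting V r p" "e \<in># parent_tree V r p"
  shows "count (parent_tree V r p) e = 1"
proof -
  have eq: "parent_tree V r p = mset_set ((\<lambda>v. Upair v (p v)) ` (V - {r}))"
    using inj_on_parent_edge[OF assms(2)] by (simp add: parent_tree_def image_mset_mset_set)
  then have "e \<in> (\<lambda>v. Upair v (p v)) ` (V - {r})"
    using assms(1,3) by simp
  then show ?thesis
    unfolding eq using assms(1) by (intro count_mset_set(1)) auto
qed

lemma mgraph_on_parent_tree:
  assumes "finite V" "rooting V r p"
  shows "mgraph_on V (parent_tree V r p)"
  using assms by (auto simp: mgraph_on_def mem_parent_tree rooting_def)

lemma connected_parent_tree:
  assumes "finite V" "rooting V r p"
  shows "connected_on V (parent_tree V r p)"
proof -
  let ?A = "adj (parent_tree V r p)"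
  obtain d :: "'a \<Rightarrow> nat" where d: "\<forall>v\<in>V - {r}. d (p v) < d v"
    using assms by (auto simp: rooting_def)
  have to_root: "(v, r) \<in> ?A\<^sup>*" if "v \<in> V" for v
    using that
  proof (induction "d v" arbitrary: v rule: less_induct)
    case less
    show ?case
    proof (cases "v = r")
      case False
      then have "(v, p v) \<in> ?A" "p v \<in> V" "d (p v) < d v"
        using less.prems d assms by (auto simp: adj_parent_tree rooting_def)
      then show ?thesis using less.hyps by (meson converse_rtrancl_into_rtrancl)
    qed simp
  qed
  have "(u, v) \<in> ?A\<^sup>*" if "u \<in> V" "v \<in> V" for u v
    using to_root[OF that(1)] symD[OF sym_rtrancl[OF sym_adj] to_root[OF that(2)]] by (rule rtrancl_trans)
  then show ?thesis
    using mgraph_on_parent_tree[OF assms] assms(2) by (auto simp: connected_on_def rooting_def)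
qed

text \<open>At a vertex of maximal rank on a cycle both neighbours must be its parent, hence equal,
  which length at least 3 forbids.\<close>

lemma acyclic_parent_tree:
  assumes "finite V" "rooting V r p"
  shows "\<not> cycle (parent_tree V r p) vs"
proof
  assume c: "cycle (parent_tree V r p) vs"
  obtain d :: "'a \<Rightarrow> nat" where d: "\<forall>v\<in>V - {r}. d (p v) < d v"
    using assms by (auto simp: rooting_def)
  define n where "n = length vs"
  have n: "n \<ge> 3" and dist: "distinct vs"
    and adj: "\<And>i. i < n \<Longrightarrow> (vs ! i, vs ! (Suc i mod n)) \<in> adj (parent_tree V r p)"
    using c by (auto simp: cycle_def n_def)
  have "finite ((\<lambda>i. d (vs ! i)) ` {..<n})" "(\<lambda>i. d (vs ! i)) ` {..<n} \<noteq> {}"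
    using n by (auto simp: lessThan_empty_iff)
  from Max_in[OF this] obtain i where i: "i < n" "Max ((\<lambda>i. d (vs ! i)) ` {..<n}) = d (vs ! i)"
    by auto
  have max: "d (vs ! j) \<le> d (vs ! i)" if "j < n" for j
    using that by (simp flip: i(2))
  \<comment> \<open>\<open>j\<close> and \<open>k\<close> are the cyclic predecessor and successor
    of \<open>i\<close>; they differ because \<open>n\<close> is at least 3.\<close>
  define j where "j = (if i = 0 then n - 1 else i - 1)"
  define k where "k = Suc i mod n"
  have jk: "j < n" "k < n" "Suc j mod n = i" using n i by (auto simp: j_def k_def)
  have "j \<noteq> k" using n i by (auto simp: j_def k_def mod_Suc split: if_splits)
  have parent: "w = p (vs ! i)"
    if "(vs ! i, w) \<in> adj (parent_tree V r p)" "d w \<le> d (vs ! i)" for w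
  proof -
    have "\<not> (w \<in> V - {r} \<and> vs ! i = p w)" using d that(2) by (metis not_le)
    then show ?thesis using that(1) assms(1) by (auto simp: adj_parent_tree)
  qed
  have "vs ! k = p (vs ! i)"
    using adj[OF i(1)] max[OF jk(2)] by (intro parent) (simp_all add: k_def)
  moreover have "vs ! j = p (vs ! i)"
    using symD[OF sym_adj adj[OF jk(1)]] max[OF jk(1)] jk(3) by (intro parent) simp_all
  ultimately show False
    using \<open>j \<noteq> k\<close> jk(1,2) dist by (metis n_def nth_eq_iff_index_eq)
qed

lemma tree_on_parent_tree:
  assumes "finite V" "rooting V r p"
  shows "tree_on V (parent_tree V r p)"
proof -
  have "proper_uprod e" if "e \<in># parent_tree V r p" for e
    using that rooting_ne[OF assms(2)] by (force simp: mem_parent_tree[OF assms(1)])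
  then have "simple_mgraph (parent_tree V r p)"
    using count_parent_tree[OF assms] by (simp add: simple_mgraph_def)
  then show ?thesis
    using connected_parent_tree[OF assms] acyclic_parent_tree[OF assms] by (simp add: tree_on_def)
qed

text \<open>\<open>orientation\<close> compares distances where \<open>arcs\<close> uses parents.
  The last step of a walk from \<open>r\<close> to \<open>v\<close> comes from \<open>p v\<close> or
  from a child of \<open>v\<close>; in the second case the walk to that child already passed through
  \<open>v\<close>, so \<open>p v\<close> is always reached strictly sooner.\<close>

lemma gdist_parent:
  assumes "finite V" "rooting V r p" "v \<in> V - {r}"
  shows "gdist (parent_tree V r p) r (p v) < gdist (parent_tree V r p) r v"
proof -
  let ?A = "adj (parent_tree V r p)"
  have walk: "\<exists>m<n. (r, p v) \<in> ?A ^^ m" if "(r, v) \<in> ?A ^^ n" "v \<in> V - {r}" for n v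
    using that
  proof (induction n arbitrary: v rule: less_induct)
    case (less n)
    obtain m where m: "n = Suc m" using less.prems by (cases n) auto
    then obtain u where u: "(r, u) \<in> ?A ^^ m" "(u, v) \<in> ?A" using less.prems by auto
    from u(2) consider "u = p v" | "u \<in> V - {r}" "v = p u"
      unfolding adj_parent_tree[OF assms(1)] by blast
    then show ?case
    proof cases
      case 1
      then show ?thesis using u(1) m by blast
    next
      case 2
      obtain m' where m': "m' < m" "(r, v) \<in> ?A ^^ m'"
        using less.IH[of m u] u(1) 2 m by auto
      then obtain m'' where "m'' < m'" "(r, p v) \<in> ?A ^^ m''"
        using less.IH[of m' v] less.prems(2) m by auto
      with m' m show ?thesis by (intro exI[of _ m'']) simp
    qed
  qed
  have "(r, v) \<in> ?A\<^sup>*"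
    using connected_parent_tree[OF assms(1,2)] assms by (auto simp: connected_on_def rooting_def)
  from walk[OF gdist_walk[OF this] assms(3)] gdist_le show ?thesis
    by (metis le_less_trans)
qed

lemma orient_edge_Upair: "orient_edge t r (Upair a b) =
    Upair (a, if gdist t r a < gdist t r b then Target else Source)
      (b, if gdist t r b < gdist t r a then Target else Source)"
  by transfer simp

lemma orientation_parent_tree:
  assumes "finite V" "rooting V r p"
  shows "orientation (parent_tree V r p + k) (parent_tree V r p) r = arcs V r p + targets k"
proof -
  have "image_mset (orient_edge (parent_tree V r p) r) (parent_tree V r p) = arcs V r p"
    unfolding arcs_def parent_tree_def[of V r p] multiset.map_comp
    unfolding parent_tree_def[of V r p, symmetric]
  proof (intro image_mset_cong)
    fix v assume "v \<in># mset_set (V - {r})"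
    then have "gdist (parent_tree V r p) r (p v) < gdist (parent_tree V r p) r v"
      using assms by (intro gdist_parent) auto
    then show "(orient_edge (parent_tree V r p) r \<circ> (\<lambda>v. Upair v (p v))) v = Upair (v, Source) (p v, Target)"
      by (simp add: orient_edge_Upair)
  qed
  then show ?thesis by (simp add: orientation_def targets_def)
qed

text \<open>Breadth-first search: a shortest walk from \<open>r\<close> provides a neighbour nearer
  to \<open>r\<close> as parent, and the distance from \<open>r\<close> is the rank.\<close>

lemma rooting_exists:
  assumes "finite V" "connected_on V g" "r \<in> V"
  shows "\<exists>p. rooting V r p \<and> parent_tree V r p \<subseteq># g"
proof -
  have "\<exists>u. u \<in> V \<and> (u, v) \<in> adj g \<and> gdist g r u < gdist g r v" if "v \<in> V - {r}" for v
  proof -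
    have "(r, v) \<in> (adj g)\<^sup>*" using assms that by (auto simp: connected_on_def)
    then have "(r, v) \<in> adj g ^^ gdist g r v" by (rule gdist_walk)
    moreover with that obtain n where n: "gdist g r v = Suc n" by (cases "gdist g r v") auto
    ultimately obtain u where u: "(r, u) \<in> adj g ^^ n" "(u, v) \<in> adj g" by auto
    have "u \<in> V" using u(2) assms(2) by (auto simp: adj_def connected_on_def mgraph_on_def)
    with u gdist_le[OF u(1)] n show ?thesis by auto
  qed
  then obtain p where p: "\<And>v. v \<in> V - {r} \<Longrightarrow> p v \<in> V \<and> (p v, v) \<in> adj g \<and> gdist g r (p v) < gdist g r v"
    by metis
  then have root: "rooting V r p" using assms(3) by (auto simp: rooting_def intro!: exI[of _ "gdist g r"])
  have "count (parent_tree V r p) e \<le> count g e" for e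
  proof (cases "e \<in># parent_tree V r p")
    case True
    then obtain v where v: "v \<in> V - {r}" "e = Upair v (p v)"
      using mem_parent_tree[OF assms(1)] by blast
    have "(v, p v) \<in> adj g" using p[OF v(1)] sym_adj by (meson symD)
    then have "e \<in># g" using v(2) by (simp add: adj_def)
    then have "count g e \<ge> 1" by simp
    then show ?thesis using count_parent_tree[OF assms(1) root True] by simp
  qed (simp add: not_in_iff)
  with root show ?thesis by (auto simp: subseteq_mset_def)
qed

lemma distinct_walk:
  assumes "(u, w) \<in> R\<^sup>*"
  shows "\<exists>vs. vs \<noteq> [] \<and> hd vs = u \<and> last vs = w \<and> distinct vs \<and> successively (\<lambda>a b. (a, b) \<in> R) vs"
  using assms
proof (induction rule: converse_rtrancl_induct)
  case base
  show ?case by (intro exI[of _ "[w]"]) simp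
next
  case (step u u')
  then obtain vs where vs: "vs \<noteq> []" "hd vs = u'" "last vs = w" "distinct vs"
    "successively (\<lambda>a b. (a, b) \<in> R) vs" by blast
  show ?case
  proof (cases "u \<in> set vs")
    case True
    then obtain xs ys where "vs = xs @ u # ys" by (meson split_list)
    with vs show ?thesis by (intro exI[of _ "u # ys"]) (auto simp: successively_append_iff)
  next
    case False
    with vs step.hyps show ?thesis by (intro exI[of _ "u # vs"]) (auto simp: successively_Cons)
  qed
qed

text \<open>Since \<open>t\<close> is simple, an edge of \<open>t\<close> missing from the multiset
  inclusion is absent from the search tree. Together with a walk without repetition in that tree
  between its ends, it closes a cycle of \<open>t\<close>.\<close>

lemma tree_rooting:
  assumes "finite V" "tree_on V t" "r \<in> V"
  shows "\<exists>p. rooting V r p \<and> t = parent_tree V r p"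
proof -
  obtain p where p: "rooting V r p" "parent_tree V r p \<subseteq># t"
    using rooting_exists[OF assms(1) _ assms(3)] assms(2) by (auto simp: tree_on_def)
  have "t \<subseteq># parent_tree V r p"
  proof (rule ccontr)
    assume "\<not> t \<subseteq># parent_tree V r p"
    then obtain e where e: "count (parent_tree V r p) e < count t e"
      by (auto simp: subseteq_mset_def not_le)
    then have et: "e \<in># t" using gr_implies_not_zero by fastforce
    then have "proper_uprod e" "count t e = 1"
      using assms(2) by (auto simp: tree_on_def simple_mgraph_def)
    with e have ep: "e \<notin># parent_tree V r p" by (simp add: not_in_iff)
    obtain u w where uw: "e = Upair u w" "u \<noteq> w" using \<open>proper_uprod e\<close> by (cases e) auto
    have "u \<in> V" "w \<in> V"
      using et uw assms(2) by (auto simp: tree_on_def connected_on_def mgraph_on_def)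
    then have "(u, w) \<in> (adj (parent_tree V r p))\<^sup>*"
      using connected_parent_tree[OF assms(1) p(1)] by (simp add: connected_on_def)
    from distinct_walk[OF this] obtain vs where vs: "vs \<noteq> []" "hd vs = u" "last vs = w" "distinct vs"
      "successively (\<lambda>a b. (a, b) \<in> adj (parent_tree V r p)) vs" by blast
    define n where "n = length vs"
    have step: "(vs ! i, vs ! Suc i) \<in> adj (parent_tree V r p)" if "Suc i < n" for i
      using successively_nth[OF vs(5)] that by (simp add: n_def)
    have hd: "vs ! 0 = u" and last: "vs ! (n - 1) = w"
      using vs by (simp_all add: hd_conv_nth last_conv_nth n_def)
    have "n \<noteq> 0" "n \<noteq> 1" using vs(1) uw(2) hd last by (auto simp: n_def)
    \<comment> \<open>A walk with two vertices would be the missing edge itself, inside the parent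
      tree.\<close>
    moreover have "n \<noteq> 2"
    proof
      assume "n = 2"
      then have "(u, w) \<in> adj (parent_tree V r p)" using step[of 0] hd last by simp
      then show False using ep uw by (simp add: adj_def)
    qed
    ultimately have n: "n \<ge> 3" by simp
    have "cycle t vs"
      unfolding cycle_def n_def[symmetric]
    proof (intro conjI allI impI n vs(4))
      fix i assume "i < n"
      show "(vs ! i, vs ! (Suc i mod n)) \<in> adj t"
      proof (cases "Suc i < n")
        case True
        then show ?thesis using step[OF True] adj_mono[OF p(2)] by auto
      next
        case False
        then have "Suc i = n" using \<open>i < n\<close> by simp
        then have "vs ! i = w" "vs ! (Suc i mod n) = u" using hd last by auto
        moreover have "(u, w) \<in> adj t" using et uw by (simp add: adj_def)
        ultimately show ?thesis using symD[OF sym_adj] by metis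
      qed
    qed
    then show False using assms(2) by (simp add: tree_on_def)
  qed
  with p show ?thesis by (meson subset_mset.antisym)
qed

lemma spanning_tree_exists:
  assumes "finite V" "connected_on V g"
  shows "\<exists>t. spanning_tree V g t"
proof -
  obtain r where "r \<in> V" using assms(2) by (auto simp: connected_on_def)
  then show ?thesis
    using rooting_exists[OF assms] tree_on_parent_tree[OF assms(1)]
    unfolding spanning_tree_def by blast
qed

section \<open>Bases of \<open>ST\<close> and \<open>PLie\<close>, and their closure under
  composition\<close>

definition ST_basis :: "'v set \<Rightarrow> ('v omgraph \<times> 'v) set" where
  "ST_basis V = {(arcs V r p + targets k, r) | r p k. rooting V r p \<and> mgraph_on V k}"

definition PLie_basis :: "'v set \<Rightarrow> ('v omgraph \<times> 'v) set" where
  "PLie_basis V = {(arcs V r p, r) | r p. rooting V r p}"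

text \<open>A multigraph with a chosen spanning tree is a tree plus an arbitrary rest
  \<open>k\<close>, connectedness being automatic. In this form a composition can be followed
  separately on the tree edges and on the rest.\<close>

lemma ST_basis_eq:
  assumes "finite V"
  shows "ST_basis V = {(orientation g t r, r) | g t r. connected_on V g \<and> r \<in> V \<and> spanning_tree V g t}"
proof (intro set_eqI iffI)
  fix x assume "x \<in> ST_basis V"
  then obtain r p k where x: "x = (arcs V r p + targets k, r)" "rooting V r p" "mgraph_on V k"
    by (auto simp: ST_basis_def)
  let ?t = "parent_tree V r p"
  have "mgraph_on V (?t + k)"
    using mgraph_on_parent_tree[OF assms x(2)] x(3) by (auto simp: mgraph_on_iff)
  then have "connected_on V (?t + k)"
    by (intro connected_on_mono[OF connected_parent_tree[OF assms x(2)]]) simp_all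
  moreover have "spanning_tree V (?t + k) ?t"
    using tree_on_parent_tree[OF assms x(2)] by (simp add: spanning_tree_def)
  moreover have "x = (orientation (?t + k) ?t r, r)"
    by (simp add: x(1) orientation_parent_tree[OF assms x(2)])
  moreover have "r \<in> V" using x(2) by (simp add: rooting_def)
  ultimately show "x \<in> {(orientation g t r, r) | g t r. connected_on V g \<and> r \<in> V \<and> spanning_tree V g t}"
    by blast
next
  fix x assume "x \<in> {(orientation g t r, r) | g t r. connected_on V g \<and> r \<in> V \<and> spanning_tree V g t}"
  then obtain g t r where x: "x = (orientation g t r, r)" "connected_on V g" "r \<in> V" "spanning_tree V g t"
    by blast
  then obtain p where p: "rooting V r p" "t = parent_tree V r p"
    using tree_rooting[OF assms] by (auto simp: spanning_tree_def)
  have g: "g = t + (g - t)" using x(4) by (simp add: spanning_tree_def)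
  have "mgraph_on V (g - t)" using x(2) by (auto simp: connected_on_def mgraph_on_def dest: in_diffD)
  moreover have "orientation g t r = arcs V r p + targets (g - t)"
    using orientation_parent_tree[OF assms p(1), of "g - t"] g p(2) by simp
  ultimately show "x \<in> ST_basis V" using x(1) p(1) by (auto simp: ST_basis_def)
qed

lemma underlying_orientation:
  assumes "finite V" "r \<in> V" "spanning_tree V g t"
  shows "underlying (orientation g t r) = g"
proof -
  obtain p where p: "rooting V r p" "t = parent_tree V r p"
    using tree_rooting[OF assms(1) _ assms(2)] assms(3) by (auto simp: spanning_tree_def)
  have "g = t + (g - t)" using assms(3) by (simp add: spanning_tree_def)
  then show ?thesis
    using orientation_parent_tree[OF assms(1) p(1), of "g - t"] p(2) by simp
qed

lemma connected_ST_basis: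
  assumes "finite V" "(h, r) \<in> ST_basis V"
  shows "connected_on V (underlying h)" "r \<in> V"
  using assms underlying_orientation[OF assms(1)] by (auto simp: ST_basis_eq)

text \<open>Each vertex keeps one parent: a child of \<open>s\<close> receives a vertex of
  \<open>V2\<close> through \<open>q\<close>, and the root of the second tree inherits the parent of
  \<open>s\<close>. What has to be constructed is a rank.\<close>

lemma rooting_compose:
  assumes fin: "finite V2" and V: "V1 \<inter> V2 = {}" "s \<notin> V1"
    and p1: "rooting (insert s V1) r1 p1" and p2: "rooting V2 r2 p2"
    and q: "\<And>v. v \<in> V1 - {r1} \<Longrightarrow> if p1 v = s then q v \<in> V2 else q v = p1 v"
  shows "rooting (V1 \<union> V2) (if r1 \<noteq> s then r1 else r2)
    (\<lambda>v. if v \<in> V1 then q v else if v = r2 then p1 s else p2 v)"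
proof -
  obtain d1 :: "'a \<Rightarrow> nat" where d1: "\<And>v. v \<in> insert s V1 \<Longrightarrow> v \<noteq> r1 \<Longrightarrow> d1 (p1 v) < d1 v"
    using p1 by (auto simp: rooting_def)
  obtain d2 :: "'a \<Rightarrow> nat" where d2: "\<And>v. v \<in> V2 \<Longrightarrow> v \<noteq> r2 \<Longrightarrow> d2 (p2 v) < d2 v"
    using p2 by (auto simp: rooting_def)
  have r1: "r1 = s \<or> r1 \<in> V1" and in1: "\<And>v. v \<in> insert s V1 \<Longrightarrow> v \<noteq> r1 \<Longrightarrow> p1 v = s \<or> p1 v \<in> V1"
    using p1 by (auto simp: rooting_def)
  have r2: "r2 \<in> V2" "r2 \<notin> V1" and in2: "\<And>v. v \<in> V2 \<Longrightarrow> v \<noteq> r2 \<Longrightarrow> p2 v \<in> V2"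
    using p2 V by (auto simp: rooting_def)
  \<comment> \<open>\<open>N\<close> exceeds every rank in \<open>V2\<close>, so \<open>d\<close>
    compares lexicographically: by the rank in the first tree, with all of \<open>V2\<close> at the
    level of \<open>s\<close>, then by the rank in the second.\<close>
  define N where "N = Suc (\<Sum>v\<in>V2. d2 v)"
  have N: "d2 v < N" if "v \<in> V2" for v
    using member_le_sum[OF that, of d2] fin by (simp add: N_def)
  have N0: "0 < N" by (simp add: N_def)
  define d where "d v = (if v \<in> V1 then d1 v * N else d1 s * N + d2 v)" for v
  let ?p = "\<lambda>v. if v \<in> V1 then q v else if v = r2 then p1 s else p2 v"
  let ?r = "if r1 \<noteq> s then r1 else r2"
  have notin: "v \<notin> V1" if "v \<in> V2" for v using V that by auto
  have *: "?p v \<in> V1 \<union> V2 \<and> d (?p v) < d v" if v: "v \<in> V1 \<union> V2" "v \<noteq> ?r" for v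
  proof (cases "v \<in> V1")
    case True
    then have vr: "v \<noteq> r1" "v \<in> insert s V1" using v(2) V by (auto split: if_splits)
    show ?thesis
    proof (cases "p1 v = s")
      case T: True
      then have qv: "q v \<in> V2" using q[of v] True vr by auto
      have "d1 s * N + d2 (q v) < Suc (d1 s) * N" using N[OF qv] by simp
      also have "\<dots> \<le> d1 v * N" using d1[OF vr(2,1)] T by (intro mult_le_mono1) simp
      finally show ?thesis using True qv notin[OF qv] by (simp add: d_def)
    next
      case F: False
      then have "q v = p1 v" "p1 v \<in> V1" using q[of v] True vr in1[OF vr(2,1)] by auto
      then show ?thesis using True d1[OF vr(2,1)] N0 by (simp add: d_def)
    qed
  next
    case False
    then have vV: "v \<in> V2" using v by auto
    show ?thesis
    proof (cases "v = r2")
      case True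
      then have "r1 \<noteq> s" using v(2) by auto
      then have "p1 s \<noteq> s" "d1 (p1 s) < d1 s" using rooting_ne[OF p1, of s] d1[of s] by auto
      moreover then have "p1 s \<in> V1" using in1[of s] \<open>r1 \<noteq> s\<close> by auto
      moreover have "d1 (p1 s) * N < d1 s * N + d2 r2"
        using \<open>d1 (p1 s) < d1 s\<close> N0 by (intro trans_less_add1) simp
      ultimately show ?thesis using True False by (simp add: d_def)
    next
      case F: False
      then show ?thesis using in2[OF vV F] d2[OF vV F] False notin by (simp add: d_def)
    qed
  qed
  have "?r \<in> V1 \<union> V2" using r1 r2 by auto
  with * show ?thesis unfolding rooting_def by blast
qed

text \<open>Vertices of \<open>V1\<close> keep their source ends and at most change parent. If
  \<open>s\<close> is not the root, its own arc now starts at \<open>r2\<close>, because source ends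
  follow the root; this is exactly the arc that \<open>r2\<close> lacks in the second tree.\<close>

lemma rewiring_arcs:
  assumes fin: "finite V1" "finite V2" and V: "V1 \<inter> V2 = {}" "s \<notin> V1"
    and p1: "rooting (insert s V1) r1 p1" and p2: "rooting V2 r2 p2"
    and h: "rewiring (plug V2 s r2) (arcs (insert s V1) r1 p1) h"
  shows "\<exists>p. rooting (V1 \<union> V2) (if r1 \<noteq> s then r1 else r2) p \<and>
    h + arcs V2 r2 p2 = arcs (V1 \<union> V2) (if r1 \<noteq> s then r1 else r2) p"
proof -
  let ?M = "insert s V1 - {r1}"
  have "finite ?M" using fin by simp
  from rewiring_image_mset_set[OF this h[unfolded arcs_def]] obtain f where
    f: "\<And>m. m \<in> ?M \<Longrightarrow> f m \<in> choices (plug V2 s r2) (Upair (m, Source) (p1 m, Target))"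
    and h': "h = image_mset f (mset_set ?M)" by blast
  have "\<exists>w. f m = Upair (m, Source) (w, Target) \<and> (if p1 m = s then w \<in> V2 else w = p1 m)"
    if "m \<in> V1 - {r1}" for m
  proof -
    have "m \<in> ?M" "m \<noteq> s" using that V by auto
    with f[of m] show ?thesis
      by (cases "p1 m = s") (auto simp: choices_Upair plug_simps)
  qed
  then obtain q where q: "\<And>m. m \<in> V1 - {r1} \<Longrightarrow> f m = Upair (m, Source) (q m, Target) \<and>
      (if p1 m = s then q m \<in> V2 else q m = p1 m)"
    by metis
  let ?p = "\<lambda>v. if v \<in> V1 then q v else if v = r2 then p1 s else p2 v"
  let ?r = "if r1 \<noteq> s then r1 else r2"
  let ?arc = "\<lambda>v. Upair (v, Source) (?p v, Target)"
  have root: "rooting (V1 \<union> V2) ?r ?p"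
    by (rule rooting_compose[OF fin(2) V p1 p2]) (use q in blast)
  have r1: "r1 = s \<or> r1 \<in> V1" and r2: "r2 \<in> V2" using p1 p2 by (auto simp: rooting_def)
  have notin: "v \<notin> V1" if "v \<in> V2" for v using V that by auto
  have A: "image_mset f (mset_set (V1 - {r1})) = image_mset ?arc (mset_set (V1 - {r1}))"
    using q fin by (intro image_mset_cong) auto
  have B: "arcs V2 r2 p2 = image_mset ?arc (mset_set (V2 - {r2}))"
    unfolding arcs_def using notin fin by (intro image_mset_cong) auto
  have "h + arcs V2 r2 p2 = arcs (V1 \<union> V2) ?r ?p"
  proof (cases "r1 = s")
    case True
    then have "?M = V1 - {r1}" using V by auto
    moreover have "V1 \<union> V2 - {?r} = (V1 - {r1}) \<union> (V2 - {r2})"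
      using True V r2 by auto
    moreover have "mset_set ((V1 - {r1}) \<union> (V2 - {r2})) = mset_set (V1 - {r1}) + mset_set (V2 - {r2})"
      using fin V by (intro mset_set_Union) auto
    ultimately show ?thesis
      unfolding h' B by (simp only: A arcs_def image_mset_union)
  next
    case False
    then have M: "?M = insert s (V1 - {r1})" by auto
    have "f s = Upair (r2, Source) (p1 s, Target)"
      using f[of s] False rooting_ne[OF p1, of s] by (auto simp: choices_Upair plug_simps)
    then have fs: "f s = ?arc r2" using notin[OF r2] by simp
    have "V1 \<union> V2 - {?r} = (V1 - {r1}) \<union> insert r2 (V2 - {r2})"
      using False V r1 r2 by auto
    moreover have "mset_set ((V1 - {r1}) \<union> insert r2 (V2 - {r2})) =
        mset_set (V1 - {r1}) + mset_set (insert r2 (V2 - {r2}))"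
      using fin V r2 by (intro mset_set_Union) auto
    moreover have "mset_set (insert r2 (V2 - {r2})) = add_mset r2 (mset_set (V2 - {r2}))"
      using fin by (intro mset_set.insert) auto
    ultimately have "arcs (V1 \<union> V2) ?r ?p = image_mset ?arc (mset_set (V1 - {r1})) +
        add_mset (?arc r2) (image_mset ?arc (mset_set (V2 - {r2})))"
      by (simp only: arcs_def image_mset_union image_mset_add_mset)
    moreover have "h = add_mset (f s) (image_mset f (mset_set (V1 - {r1})))"
      unfolding h' M using fin V by simp
    ultimately show ?thesis
      unfolding A B fs by simp
  qed
  with root show ?thesis by blast
qed

lemma rewiring_targets:
  assumes "r2 \<in> V2" "mgraph_on (insert s V1) k" "rewiring (plug V2 s r2) (targets k) h"
  shows "\<exists>k'. h = targets k' \<and> mgraph_on (V1 \<union> V2) k'"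
proof (intro exI conjI)
  have *: "ends h \<subseteq> (V1 \<union> V2) \<times> {Target}"
  proof -
    have "plug V2 s r2 (v, Target) \<subseteq> (V1 \<union> V2) \<times> {Target}" if "v \<in> insert s V1" for v
      using that by (cases "v = s") (auto simp: plug_simps)
    then have "(\<Union>a\<in>ends (targets k). plug V2 s r2 a) \<subseteq> (V1 \<union> V2) \<times> {Target}"
      using assms(2) unfolding mgraph_on_iff ends_targets by blast
    with rewiring_ends[OF assms(3)] show ?thesis by (rule order.trans)
  qed
  then show "h = targets (underlying h)" by (intro targetsI) auto
  show "mgraph_on (V1 \<union> V2) (underlying h)" using * by (auto simp: mgraph_on_iff)
qed

lemma PLie_basis_subset: "PLie_basis V \<subseteq> ST_basis V"
proof
  fix x assume "x \<in> PLie_basis V"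
  then obtain r p where "x = (arcs V r p + targets {#}, r)" "rooting V r p"
    by (auto simp: PLie_basis_def)
  moreover have "mgraph_on V {#}" by (simp add: mgraph_on_iff)
  ultimately show "x \<in> ST_basis V" unfolding ST_basis_def by blast
qed

lemma PLie_basis_pcomp:
  assumes "finite V1" "finite V2" "V1 \<inter> V2 = {}" "s \<notin> V1"
    and "a \<in> PLie_basis (insert s V1)" "b \<in> PLie_basis V2"
  shows "supp (MGor_pcomp V2 s a b :: _ \<Rightarrow>\<^sub>0 'k::field) \<subseteq> PLie_basis (V1 \<union> V2)"
proof
  fix x assume x: "x \<in> supp (MGor_pcomp V2 s a b :: _ \<Rightarrow>\<^sub>0 'k)"
  obtain r1 p1 where a: "a = (arcs (insert s V1) r1 p1, r1)" "rooting (insert s V1) r1 p1"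
    using assms(5) by (auto simp: PLie_basis_def)
  obtain r2 p2 where b: "b = (arcs V2 r2 p2, r2)" "rooting V2 r2 p2"
    using assms(6) by (auto simp: PLie_basis_def)
  obtain h r where hr: "x = (h, r)" by (cases x)
  obtain h' where h': "rewiring (plug V2 s r2) (arcs (insert s V1) r1 p1) h'" "h = h' + arcs V2 r2 p2"
    "r = (if r1 \<noteq> s then r1 else r2)"
    using x unfolding hr a(1) b(1) by (rule supp_MGor_pcomp)
  show "x \<in> PLie_basis (V1 \<union> V2)"
    using rewiring_arcs[OF assms(1-4) a(2) b(2) h'(1)] h'(2,3) hr by (auto simp: PLie_basis_def)
qed

lemma ST_basis_pcomp:
  assumes "finite V1" "finite V2" "V1 \<inter> V2 = {}" "s \<notin> V1"
    and "a \<in> ST_basis (insert s V1)" "b \<in> ST_basis V2"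
  shows "supp (MGor_pcomp V2 s a b :: _ \<Rightarrow>\<^sub>0 'k::field) \<subseteq> ST_basis (V1 \<union> V2)"
proof
  fix x assume x: "x \<in> supp (MGor_pcomp V2 s a b :: _ \<Rightarrow>\<^sub>0 'k)"
  obtain r1 p1 k1 where a: "a = (arcs (insert s V1) r1 p1 + targets k1, r1)" "rooting (insert s V1) r1 p1"
      "mgraph_on (insert s V1) k1"
    using assms(5) by (auto simp: ST_basis_def)
  obtain r2 p2 k2 where b: "b = (arcs V2 r2 p2 + targets k2, r2)" "rooting V2 r2 p2" "mgraph_on V2 k2"
    using assms(6) by (auto simp: ST_basis_def)
  have r2: "r2 \<in> V2" using b(2) by (simp add: rooting_def)
  obtain h r where hr: "x = (h, r)" by (cases x)
  obtain h' where h': "rewiring (plug V2 s r2) (arcs (insert s V1) r1 p1 + targets k1) h'"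
    "h = h' + (arcs V2 r2 p2 + targets k2)" "r = (if r1 \<noteq> s then r1 else r2)"
    using x unfolding hr a(1) b(1) by (rule supp_MGor_pcomp)
  obtain h1 h2 where h12: "h' = h1 + h2" "rewiring (plug V2 s r2) (arcs (insert s V1) r1 p1) h1"
    "rewiring (plug V2 s r2) (targets k1) h2"
    using h'(1) by (rule rewiring_plusE)
  obtain p where p: "rooting (V1 \<union> V2) r p" "h1 + arcs V2 r2 p2 = arcs (V1 \<union> V2) r p"
    using rewiring_arcs[OF assms(1-4) a(2) b(2) h12(2)] h'(3) by blast
  obtain k' where k': "h2 = targets k'" "mgraph_on (V1 \<union> V2) k'"
    using rewiring_targets[OF r2 a(3) h12(3)] by blast
  have "h = arcs (V1 \<union> V2) r p + targets (k' + k2)"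
    unfolding h'(2) h12(1) k'(1) p(2)[symmetric] by simp
  moreover have "mgraph_on (V1 \<union> V2) (k' + k2)" using k'(2) b(3) by (auto simp: mgraph_on_iff)
  ultimately show "x \<in> ST_basis (V1 \<union> V2)" using p(1) hr unfolding ST_basis_def by blast
qed

section \<open>Relabelled spanning trees and compositions of simple graphs\<close>

lemma rooting_relabel:
  assumes "inj_on \<sigma> V" "rooting V r p"
  shows "rooting (\<sigma> ` V) (\<sigma> r) (\<lambda>v. \<sigma> (p (inv_into V \<sigma> v)))"
proof -
  obtain d :: "'a \<Rightarrow> nat" where d: "\<forall>v\<in>V - {r}. d (p v) < d v"
    using assms by (auto simp: rooting_def)
  have r: "r \<in> V" and p: "\<And>v. v \<in> V \<Longrightarrow> v \<noteq> r \<Longrightarrow> p v \<in> V" using assms(2) by (auto simp: rooting_def)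
  have im: "\<sigma> ` V - {\<sigma> r} = \<sigma> ` (V - {r})" using assms(1) r by (auto simp: inj_on_def)
  have inv: "inv_into V \<sigma> (\<sigma> (p v)) = p v" "inv_into V \<sigma> (\<sigma> v) = v" if "v \<in> V - {r}" for v
    using that p assms(1) by auto
  have "\<forall>v\<in>\<sigma> ` (V - {r}). d (inv_into V \<sigma> (\<sigma> (p (inv_into V \<sigma> v)))) < d (inv_into V \<sigma> v)"
    using d inv by simp
  moreover have "(\<lambda>v. \<sigma> (p (inv_into V \<sigma> v))) ` \<sigma> ` (V - {r}) \<subseteq> \<sigma> ` V"
    using p inv by auto
  ultimately show ?thesis
    using r unfolding rooting_def im
    by (intro conjI exI[of _ "\<lambda>v. d (inv_into V \<sigma> v)"] imageI) simp_all
qed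

lemma relabel_arcs:
  assumes "inj_on \<sigma> V" "rooting V r p"
  shows "relabel_ends \<sigma> (arcs V r p) = arcs (\<sigma> ` V) (\<sigma> r) (\<lambda>v. \<sigma> (p (inv_into V \<sigma> v)))"
proof -
  have r: "r \<in> V" using assms(2) by (simp add: rooting_def)
  have inj: "inj_on \<sigma> (V - {r})" using assms(1) by (rule inj_on_subset) auto
  have "\<sigma> ` V - {\<sigma> r} = \<sigma> ` (V - {r})" using assms(1) r by (auto simp: inj_on_def)
  then have "arcs (\<sigma> ` V) (\<sigma> r) (\<lambda>v. \<sigma> (p (inv_into V \<sigma> v))) =
      image_mset (\<lambda>v. Upair (\<sigma> v, Source) (\<sigma> (p (inv_into V \<sigma> (\<sigma> v))), Target)) (mset_set (V - {r}))"
    by (simp add: arcs_def multiset.map_comp o_def flip: image_mset_mset_set[OF inj])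
  also have "\<dots> = image_mset (\<lambda>v. Upair (\<sigma> v, Source) (\<sigma> (p v), Target)) (mset_set (V - {r}))"
    using assms(1) by (cases "finite V") (auto intro!: image_mset_cong)
  finally show ?thesis
    by (simp add: relabel_ends_def arcs_def multiset.map_comp o_def)
qed

lemma relabel_targets: "relabel_ends \<sigma> (targets k) = targets (image_mset (map_uprod \<sigma>) k)"
  by (simp add: relabel_ends_def targets_def multiset.map_comp o_def uprod.map_comp)

lemma relabel_ends_plus: "relabel_ends \<sigma> (h + h') = relabel_ends \<sigma> h + relabel_ends \<sigma> h'"
  by (simp add: relabel_ends_def)

lemma PLie_basis_relabel:
  "inj_on \<sigma> V \<Longrightarrow> (h, r) \<in> PLie_basis V \<Longrightarrow> (relabel_ends \<sigma> h, \<sigma> r) \<in> PLie_basis (\<sigma> ` V)"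
  using rooting_relabel relabel_arcs unfolding PLie_basis_def by fastforce

lemma ST_basis_relabel:
  assumes "inj_on \<sigma> V" "(h, r) \<in> ST_basis V"
  shows "(relabel_ends \<sigma> h, \<sigma> r) \<in> ST_basis (\<sigma> ` V)"
proof -
  obtain p k where "h = arcs V r p + targets k" and p: "rooting V r p" and k: "mgraph_on V k"
    using assms(2) by (auto simp: ST_basis_def)
  then have "relabel_ends \<sigma> h =
      arcs (\<sigma> ` V) (\<sigma> r) (\<lambda>v. \<sigma> (p (inv_into V \<sigma> v))) + targets (image_mset (map_uprod \<sigma>) k)"
    using assms(1) by (simp add: relabel_ends_plus relabel_arcs relabel_targets)
  moreover have "mgraph_on (\<sigma> ` V) (image_mset (map_uprod \<sigma>) k)"
    using k by (auto simp: mgraph_on_iff)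
  ultimately show ?thesis
    using rooting_relabel[OF assms(1) p] unfolding ST_basis_def by blast
qed

lemma PLie_basis_ident: "({#}, v) \<in> PLie_basis {v}"
proof -
  have "rooting {v} v id" "arcs {v} v id = {#}" by (simp_all add: rooting_def arcs_def)
  then show ?thesis unfolding PLie_basis_def by force
qed

lemma simple_pcomp:
  assumes V: "V1 \<inter> V2 = {}" and r2: "r2 \<in> V2"
    and h1: "mgraph_on (insert s V1) (underlying h1)" "simple_mgraph (underlying h1)"
    and h2: "mgraph_on V2 (underlying h2)" "simple_mgraph (underlying h2)"
    and h: "rewiring (plug V2 s r2) h1 h"
  shows "simple_mgraph (underlying (h + h2))"
proof -
  \<comment> \<open>Contracting \<open>V2\<close> to \<open>s\<close> recovers the first graph and turns the edges of the second into loops.\<close>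
  define \<gamma> where "\<gamma> v = (if v \<in> V2 then s else v)" for v
  have "image_mset (map_uprod (\<lambda>a. \<gamma> (fst a))) h = image_mset (map_uprod fst) h1"
  proof (rule rewiring_map[OF h])
    fix a b assume a: "a \<in> ends h1" and b: "b \<in> plug V2 s r2 a"
    have "fst a \<in> insert s V1" using h1(1) a by (auto simp: mgraph_on_iff)
    with a b V r2 show "\<gamma> (fst b) = fst a"
      by (cases rule: plug_cases[of a s V2 r2]) (auto simp: \<gamma>_def)
  qed
  then have contract: "image_mset (map_uprod \<gamma>) (underlying h) = underlying h1"
    by (simp add: underlying_def multiset.map_comp o_def uprod.map_comp)
  have 1: "proper_uprod (map_uprod \<gamma> e)" "count (underlying h) e \<le> 1" if "e \<in># underlying h" for e
  proof -
    have e: "map_uprod \<gamma> e \<in># underlying h1" using that contract by (metis image_eqI set_image_mset)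
    then show "proper_uprod (map_uprod \<gamma> e)" using h1(2) by (simp add: simple_mgraph_def)
    \<comment> \<open>The multiplicity of an image edge adds up those of all edges above it, so it
      bounds the multiplicity of \<open>e\<close>.\<close>
    have "count (underlying h) e \<le> count (image_mset (map_uprod \<gamma>) (underlying h)) (map_uprod \<gamma> e)"
      using that unfolding count_image_mset by (intro member_le_sum) auto
    also have "\<dots> = 1" using e h1(2) contract by (simp add: simple_mgraph_def)
    finally show "count (underlying h) e \<le> 1" .
  qed
  have 2: "\<not> proper_uprod (map_uprod \<gamma> e)" if "e \<in># underlying h2" for e
  proof -
    have "set_uprod e \<subseteq> V2" using h2(1) that by (auto simp: mgraph_on_def)
    then show ?thesis by (cases e) (simp add: \<gamma>_def)
  qed
  show ?thesis
    unfolding simple_mgraph_def underlying_simps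
  proof (intro allI impI)
    fix e assume e: "e \<in># underlying h + underlying h2"
    show "proper_uprod e \<and> count (underlying h + underlying h2) e = 1"
    proof (cases "e \<in># underlying h")
      case True
      then have "proper_uprod e" using 1(1)[OF True] by (cases e) auto
      moreover have "count (underlying h) e = 1"
        using 1(2)[OF True] True by (simp add: le_antisym Suc_leI)
      moreover have "e \<notin># underlying h2" using 1(1)[OF True] 2 by blast
      ultimately show ?thesis by (simp add: not_in_iff)
    next
      case False
      moreover then have "e \<in># underlying h2" using e by simp
      ultimately show ?thesis using h2(2) by (auto simp: simple_mgraph_def not_in_iff)
    qed
  qed
qed


section \<open>Sums over all roots\<close>

definition unorient :: "('v omgraph \<times> 'v \<Rightarrow>\<^sub>0 'k::field) \<Rightarrow> ('v mgraph \<times> 'v \<Rightarrow>\<^sub>0 'k)" where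
  "unorient = lin (\<lambda>(h, r). basis (underlying h, r))"

definition all_roots :: "'v set \<Rightarrow> ('v mgraph \<Rightarrow>\<^sub>0 'k::field) \<Rightarrow> ('v mgraph \<times> 'v \<Rightarrow>\<^sub>0 'k)" where
  "all_roots V = lin (\<lambda>g. \<Sum>r\<in>V. basis (g, r))"

text \<open>The combination \<open>a\<close> is read off from \<open>\<Sum>\<^sub>r (a, r)\<close> at a single root; if \<open>V\<close> is empty, then
  \<open>SOME\<close> is arbitrary but all spaces are zero.\<close>

definition unroot :: "'v set \<Rightarrow> ('v omgraph \<times> 'v \<Rightarrow>\<^sub>0 'k::field) \<Rightarrow> ('v mgraph \<Rightarrow>\<^sub>0 'k)" where
  "unroot V = lin (\<lambda>(h, r). if r = (SOME r. r \<in> V) then basis (underlying h) else 0)"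

text \<open>A section of the forgetful map on rooted connected multigraphs. The chosen tree depends
  on \<open>V\<close> and \<open>g\<close> only, so one tree serves all roots.\<close>

definition canonical_rooting :: "'v set \<Rightarrow> 'v mgraph \<times> 'v \<Rightarrow> 'v omgraph \<times> 'v" where
  "canonical_rooting V = (\<lambda>(g, r). (orientation g (SOME t. spanning_tree V g t) r, r))"

lemma unorient_simps:
  "unorient 0 = 0"
  "unorient (x + y) = unorient x + unorient y"
  "unorient (x - y) = unorient x - unorient y"
  "unorient (smul c x) = smul c (unorient x)"
  "unorient (sum f S) = (\<Sum>i\<in>S. unorient (f i))"
  "unorient (basis (h, r)) = basis (underlying h, r)"
  by (simp_all add: unorient_def lin_add lin_diff lin_smul lin_sum)

lemma all_roots_simps:
  "all_roots V 0 = 0"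
  "all_roots V (x + y) = all_roots V x + all_roots V y"
  "all_roots V (smul c x) = smul c (all_roots V x)"
  "all_roots V (basis g) = (\<Sum>r\<in>V. basis (g, r))"
  by (simp_all add: all_roots_def lin_add lin_smul)

lemma unroot_simps:
  "unroot V 0 = 0"
  "unroot V (x + y) = unroot V x + unroot V y"
  "unroot V (smul c x) = smul c (unroot V x)"
  by (simp_all add: unroot_def lin_add lin_smul)

text \<open>The terms at any one root determine \<open>a\<close>, so \<open>all_roots V\<close> is
  injective for nonempty \<open>V\<close>. Values of \<open>unroot\<close> are computed through this
  rule.\<close>

lemma unrootI:
  assumes "finite V" "V \<noteq> {}" "unorient x = all_roots V a"
  shows "unroot V x = a"
proof -
  let ?r = "SOME r. r \<in> V"
  let ?f = "\<lambda>(g, r). if r = ?r then basis g else 0"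
  have "?r \<in> V" using assms(2) by (simp add: some_in_eq)
  have "unroot V x = lin ?f (unorient x)"
    by (simp add: unroot_def unorient_def lin_lin) (intro lin_cong, auto)
  also have "\<dots> = lin (\<lambda>g. \<Sum>r\<in>V. if r = ?r then basis g else 0) a"
    by (simp add: assms(3) all_roots_def lin_lin lin_sum)
  also have "\<dots> = a" using assms(1) \<open>?r \<in> V\<close> by simp
  finally show ?thesis .
qed

lemma ST_basis_empty [simp]: "ST_basis {} = {}"
  by (auto simp: ST_basis_def rooting_def)

lemma space_ST:
  assumes "finite V"
  shows "space ST V = {x :: _ \<Rightarrow>\<^sub>0 'k::field. supp x \<subseteq> ST_basis V}"
proof -
  have "{basis (orientation g t r, r) | g t r. connected_on V g \<and> r \<in> V \<and> spanning_tree V g t} =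
      (basis ` ST_basis V :: (_ \<Rightarrow>\<^sub>0 'k) set)"
    unfolding ST_basis_eq[OF assms] by blast
  then show ?thesis by (simp add: ST_def span_basis)
qed

lemma canonical_rooting_mem:
  assumes "finite V" "connected_on V g" "r \<in> V"
  shows "canonical_rooting V (g, r) \<in> ST_basis V"
    and "unorient (basis (canonical_rooting V (g, r))) = basis (g, r)"
    and "spanning_tree V g (SOME t. spanning_tree V g t)"
proof -
  show t: "spanning_tree V g (SOME t. spanning_tree V g t)"
    using spanning_tree_exists[OF assms(1,2)] by (rule someI_ex)
  with assms show "canonical_rooting V (g, r) \<in> ST_basis V"
    unfolding ST_basis_eq[OF assms(1)] canonical_rooting_def by auto
  show "unorient (basis (canonical_rooting V (g, r))) = basis (g, r)"
    using underlying_orientation[OF assms(1,3) t] by (simp add: canonical_rooting_def unorient_simps)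
qed

lemma supp_unorient:
  fixes x :: "'a omgraph \<times> 'a \<Rightarrow>\<^sub>0 'b::field"
  assumes "finite V" "supp x \<subseteq> ST_basis V" "(g, r) \<in> supp (unorient x)"
  shows "connected_on V g" "r \<in> V"
proof -
  obtain b where b: "b \<in> supp x" "(g, r) \<in> supp ((case b of (h, r) \<Rightarrow> basis (underlying h, r)) :: _ \<Rightarrow>\<^sub>0 'b)"
    using assms(3) supp_lin[of "\<lambda>(h, r). basis (underlying h, r)" x] unfolding unorient_def by blast
  then obtain h where "b = (h, r)" "g = underlying h" by (cases b) auto
  with b(1) assms connected_ST_basis[OF assms(1), of h r] show "connected_on V g" "r \<in> V" by auto
qed

text \<open>Replacing each basis element by the canonical one with the same underlying rooted
  multigraph changes \<open>x\<close> by an element of \<I>. The replaced sum depends on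
  \<open>unorient x\<close> alone, so it vanishes when \<open>unorient x\<close> does.\<close>

lemma IST_eq:
  assumes "finite V"
  shows "IST V = {x :: _ \<Rightarrow>\<^sub>0 'k::field. supp x \<subseteq> ST_basis V \<and> unorient x = 0}"
proof
  let ?G = "{basis (orientation g t1 r, r) - basis (orientation g t2 r, r) :: _ \<Rightarrow>\<^sub>0 'k | g t1 t2 r.
      connected_on V g \<and> r \<in> V \<and> spanning_tree V g t1 \<and> spanning_tree V g t2}"
  show "IST V \<subseteq> {x :: _ \<Rightarrow>\<^sub>0 'k. supp x \<subseteq> ST_basis V \<and> unorient x = 0}"
  proof
    fix x :: "_ \<Rightarrow>\<^sub>0 'k" assume "x \<in> IST V"
    then have "x \<in> free.span ?G" by (simp add: IST_def)
    then show "x \<in> {x. supp x \<subseteq> ST_basis V \<and> unorient x = 0}"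
    proof (induction rule: free.span_induct_alt)
      case base
      show ?case by (simp add: unorient_simps)
    next
      case (step c x y)
      then obtain g t1 t2 r where x: "x = basis (orientation g t1 r, r) - basis (orientation g t2 r, r)"
        "connected_on V g" "r \<in> V" "spanning_tree V g t1" "spanning_tree V g t2" by blast
      have "unorient x = 0"
        using x underlying_orientation[OF assms x(3)] by (simp add: unorient_simps)
      moreover have mem: "(basis (orientation g t1 r, r) :: _ \<Rightarrow>\<^sub>0 'k) \<in> space ST V"
          "(basis (orientation g t2 r, r) :: _ \<Rightarrow>\<^sub>0 'k) \<in> space ST V"
        using x unfolding space_ST[OF assms] ST_basis_eq[OF assms] by auto
      have "x \<in> space ST V"
        unfolding x(1) using mem by (simp add: ST_def free.span_diff)
      moreover have "y \<in> space ST V" using step.IH space_ST[OF assms, where 'k='k] by blast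
      ultimately have "smul c x + y \<in> space ST V"
        by (simp add: ST_def free.span_add free.span_scale)
      then show ?case
        using \<open>unorient x = 0\<close> step.IH space_ST[OF assms, where 'k='k]
        by (simp add: unorient_simps)
    qed
  qed
  show "{x :: _ \<Rightarrow>\<^sub>0 'k. supp x \<subseteq> ST_basis V \<and> unorient x = 0} \<subseteq> IST V"
  proof safe
    fix x :: "_ \<Rightarrow>\<^sub>0 'k" assume x: "supp x \<subseteq> ST_basis V" "unorient x = 0"
    let ?c = "\<lambda>(h, r). canonical_rooting V (underlying h, r)"
    have "lin (\<lambda>b. basis (?c b)) x = lin (\<lambda>b. basis (canonical_rooting V b)) (unorient x)"
      by (simp add: unorient_def lin_lin) (intro lin_cong, auto)
    then have 0: "lin (\<lambda>b. basis (?c b)) x = 0" using x(2) by simp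
    have "x = lin (\<lambda>b. basis b - basis (?c b)) x + lin (\<lambda>b. basis (?c b)) x"
      by (simp flip: lin_fun_add)
    also have "\<dots> = lin (\<lambda>b. basis b - basis (?c b)) x" using 0 by simp
    also have "\<dots> \<in> IST V"
      unfolding IST_def
    proof (rule lin_mem_span, rule free.span_base)
      fix b assume "b \<in> supp x"
      then obtain g t r where b: "b = (orientation g t r, r)" "connected_on V g" "r \<in> V" "spanning_tree V g t"
        using x(1) unfolding ST_basis_eq[OF assms] by blast
      have "?c b = (orientation g (SOME t. spanning_tree V g t) r, r)"
        using underlying_orientation[OF assms b(3,4)] by (simp add: b(1) canonical_rooting_def)
      then have "basis b - basis (?c b) = (basis (orientation g t r, r) -
          basis (orientation g (SOME t. spanning_tree V g t) r, r) :: _ \<Rightarrow>\<^sub>0 'k)"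
        by (simp only: b(1))
      then show "basis b - basis (?c b) \<in> ?G"
        using b(2-4) canonical_rooting_mem(3)[OF assms b(2,3)] by blast
    qed
    finally show "x \<in> IST V" .
  qed
qed

text \<open>The linear section of \<open>unroot\<close>: it provides preimages in \<O> and, being in
  the span of the generators, a normal form to which any element with the same image is
  compared.\<close>

lemma section_all_roots:
  assumes "finite V" "supp a \<subseteq> {g. connected_on V g}"
  defines "x \<equiv> lin (\<lambda>g. \<Sum>r\<in>V. basis (canonical_rooting V (g, r))) a"
  shows "x \<in> free.span {(\<Sum>r\<in>V. basis (orientation g (t r) r, r)) | g t.
      connected_on V g \<and> (\<forall>r\<in>V. spanning_tree V g (t r))}"
    and "supp x \<subseteq> ST_basis V" and "unorient x = all_roots V a"
proof -
  show "x \<in> free.span {(\<Sum>r\<in>V. basis (orientation g (t r) r, r)) | g t.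
      connected_on V g \<and> (\<forall>r\<in>V. spanning_tree V g (t r))}" (is "_ \<in> free.span ?G")
    unfolding x_def
  proof (rule lin_mem_span, rule free.span_base)
    fix g assume "g \<in> supp a"
    then have g: "connected_on V g" using assms(2) by auto
    have "spanning_tree V g (SOME t. spanning_tree V g t)" if "r \<in> V" for r
      using assms(1) g that by (rule canonical_rooting_mem(3))
    then show "(\<Sum>r\<in>V. basis (canonical_rooting V (g, r))) \<in> ?G"
      unfolding canonical_rooting_def using g
      by (auto intro!: exI[of _ g] exI[of _ "\<lambda>r. SOME t. spanning_tree V g t"])
  qed
  have "supp x \<subseteq> (\<Union>g\<in>supp a. supp (\<Sum>r\<in>V. basis (canonical_rooting V (g, r)) :: _ \<Rightarrow>\<^sub>0 'b))"
    unfolding x_def by (rule supp_lin)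
  also have "\<dots> \<subseteq> (\<Union>g\<in>supp a. \<Union>r\<in>V. supp (basis (canonical_rooting V (g, r)) :: _ \<Rightarrow>\<^sub>0 'b))"
    by (intro UN_mono order.refl supp_sum)
  also have "\<dots> \<subseteq> ST_basis V"
    using canonical_rooting_mem(1)[OF assms(1)] assms(2) by auto
  finally show "supp x \<subseteq> ST_basis V" .
  have "unorient x = lin (\<lambda>g. \<Sum>r\<in>V. unorient (basis (canonical_rooting V (g, r)))) a"
    by (simp add: x_def unorient_def lin_lin lin_sum)
  also have "\<dots> = all_roots V a"
    unfolding all_roots_def
    by (intro lin_cong sum.cong refl canonical_rooting_mem(2)[OF assms(1)]) (use assms(2) in auto)
  finally show "unorient x = all_roots V a" .
qed

text \<open>Terms at different roots cannot cancel, as projecting to the root \<open>r\<close>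
  shows. Connectedness therefore passes from \<open>unorient x\<close> to the multigraphs of
  \<open>a\<close>.\<close>

lemma supp_all_roots:
  assumes "finite V" "r \<in> V" "g \<in> supp a"
  shows "(g, r) \<in> supp (all_roots V a :: _ \<Rightarrow>\<^sub>0 'k::field)"
proof -
  let ?f = "\<lambda>(g, r'). if r' = r then basis g else (0 :: _ \<Rightarrow>\<^sub>0 'k)"
  have "lin ?f (all_roots V a) = lin (\<lambda>g. \<Sum>r'\<in>V. if r' = r then basis g else 0) a"
    by (simp add: all_roots_def lin_lin lin_sum)
  also have "\<dots> = a" using assms(1,2) by simp
  finally have "g \<in> supp (lin ?f (all_roots V a))" using assms(3) by simp
  then obtain b where "b \<in> supp (all_roots V a)" "g \<in> supp (?f b)"
    using supp_lin[of ?f "all_roots V a"] by blast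
  then show ?thesis by (cases b) (auto split: if_splits)
qed

text \<open>For the converse inclusion, \<open>x\<close> and the canonical element with the same
  image differ by an element of \<I>, so everything rests on \<I> lying in the span of the
  generators of \<O>.\<close>

lemma space_OST:
  assumes "finite V"
  shows "space OST V = {x :: _ \<Rightarrow>\<^sub>0 'k::field. supp x \<subseteq> ST_basis V \<and> (\<exists>a. unorient x = all_roots V a)}"
proof
  let ?G = "{(\<Sum>r\<in>V. basis (orientation g (t r) r, r)) :: _ \<Rightarrow>\<^sub>0 'k | g t.
      connected_on V g \<and> (\<forall>r\<in>V. spanning_tree V g (t r))}"
  have OST: "space OST V = free.span ?G" by (simp add: OST_def)
  show "space OST V \<subseteq> {x :: _ \<Rightarrow>\<^sub>0 'k. supp x \<subseteq> ST_basis V \<and> (\<exists>a. unorient x = all_roots V a)}"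
  proof
    fix x :: "_ \<Rightarrow>\<^sub>0 'k" assume "x \<in> space OST V"
    then have "x \<in> free.span ?G" by (simp add: OST)
    then show "x \<in> {x. supp x \<subseteq> ST_basis V \<and> (\<exists>a. unorient x = all_roots V a)}"
    proof (induction rule: free.span_induct_alt)
      case base
      show ?case by (auto simp: unorient_simps intro!: exI[of _ 0] simp: all_roots_simps)
    next
      case (step c x y)
      then obtain g t where x: "x = (\<Sum>r\<in>V. basis (orientation g (t r) r, r))"
        "connected_on V g" "\<forall>r\<in>V. spanning_tree V g (t r)" by blast
      obtain a where a: "unorient y = all_roots V a" using step.IH by blast
      have "unorient x = all_roots V (basis g)"
        using x(3) underlying_orientation[OF assms] by (simp add: x(1) unorient_simps all_roots_simps)
      then have "unorient (smul c x + y) = all_roots V (smul c (basis g) + a)"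
        using a by (simp add: unorient_simps all_roots_simps)
      moreover have "(basis (orientation g (t r) r, r) :: _ \<Rightarrow>\<^sub>0 'k) \<in> space ST V" if "r \<in> V" for r
        using x that unfolding space_ST[OF assms] ST_basis_eq[OF assms] by auto
      then have "x \<in> space ST V"
        unfolding x(1) by (simp add: ST_def free.span_sum)
      moreover have "y \<in> space ST V" using step.IH space_ST[OF assms, where 'k='k] by blast
      ultimately have "smul c x + y \<in> space ST V"
        by (simp add: ST_def free.span_add free.span_scale)
      with \<open>unorient (smul c x + y) = all_roots V (smul c (basis g) + a)\<close> show ?case
        using space_ST[OF assms, where 'k='k] by blast
    qed
  qed
  show "{x :: _ \<Rightarrow>\<^sub>0 'k. supp x \<subseteq> ST_basis V \<and> (\<exists>a. unorient x = all_roots V a)} \<subseteq> space OST V"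
  proof safe
    fix x :: "_ \<Rightarrow>\<^sub>0 'k" and a
    assume x: "supp x \<subseteq> ST_basis V" and a: "unorient x = all_roots V a"
    show "x \<in> space OST V"
    proof (cases "V = {}")
      case True
      then have "x = 0" using x by simp
      then show ?thesis by (simp add: OST free.span_zero)
    next
      case False
      then obtain r where "r \<in> V" by auto
      then have conn: "supp a \<subseteq> {g. connected_on V g}"
        using supp_all_roots[OF assms] supp_unorient(1)[OF assms x] a by fastforce
      define y where "y = lin (\<lambda>g. \<Sum>r\<in>V. basis (canonical_rooting V (g, r)) :: _ \<Rightarrow>\<^sub>0 'k) a"
      note y = section_all_roots[OF assms conn, folded y_def]
      have "x \<in> space ST V" "y \<in> space ST V" using x y(2) space_ST[OF assms, where 'k='k] by auto
      then have "x - y \<in> space ST V" by (simp add: ST_def free.span_diff)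
      then have "x - y \<in> IST V"
        using a y(3) space_ST[OF assms, where 'k='k] by (simp add: IST_eq[OF assms] unorient_simps)
      moreover have "IST V \<subseteq> free.span ?G"
        unfolding IST_def
      proof (rule free.span_minimal)
        show "free.subspace (free.span ?G)" by (rule free.subspace_span)
        show "{basis (orientation g t1 r, r) - basis (orientation g t2 r, r) | g t1 t2 r.
          connected_on V g \<and> r \<in> V \<and> spanning_tree V g t1 \<and> spanning_tree V g t2} \<subseteq> free.span ?G"
        proof safe
          fix g t1 t2 r
          assume *: "connected_on V g" "r \<in> V" "spanning_tree V g t1" "spanning_tree V g t2"
          \<comment> \<open>The family uses \<open>t1\<close> at every root except \<open>r\<close>;
            exchanging the tree at \<open>r\<close> alone isolates a generator of \<I> as a
            difference of two generators of \<O>.\<close>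
          let ?s = "\<lambda>t. \<Sum>r'\<in>V. basis (orientation g (if r' = r then t else t1) r', r') :: _ \<Rightarrow>\<^sub>0 'k"
          have G: "?s t \<in> free.span ?G" if "spanning_tree V g t" for t
            using * that
            by (intro free.span_base) (auto intro!: exI[of _ g] exI[of _ "\<lambda>r'. if r' = r then t else t1"])
          have eq: "?s t = basis (orientation g t r, r) + (\<Sum>r'\<in>V - {r}. basis (orientation g t1 r', r'))" for t
            using *(2) assms by (simp add: sum.remove[of V r])
          then have "basis (orientation g t1 r, r) - basis (orientation g t2 r, r) = ?s t1 - ?s t2"
            by (simp only: eq add_diff_cancel_right)
          then show "basis (orientation g t1 r, r) - basis (orientation g t2 r, r) \<in> free.span ?G"
            using free.span_diff[OF G[OF *(3)] G[OF *(4)]] by simp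
        qed
      qed
      ultimately have "(x - y) + y \<in> free.span ?G"
        using y(1) by (intro free.span_add) auto
      then show ?thesis by (simp add: OST)
    qed
  qed
qed

lemma unroot_OST:
  assumes "finite V" "x \<in> space OST V"
  shows "unorient x = all_roots V (unroot V x)"
proof (cases "V = {}")
  case True
  then have "x = 0" using assms by (simp add: space_OST)
  then show ?thesis by (simp add: unorient_simps unroot_simps all_roots_simps)
next
  case False
  obtain a where a: "unorient x = all_roots V a" using assms by (auto simp: space_OST)
  show ?thesis using unrootI[OF assms(1) False a] a by simp
qed


section \<open>Compositions and sums over all roots\<close>

definition mplug :: "'v set \<Rightarrow> 'v \<Rightarrow> 'v \<Rightarrow> 'v set" where
  "mplug V2 s v = (if v = s then V2 else {v})"

lemma MG_pcomp_eq: "MG_pcomp V2 s g1 g2 = rewire (mplug V2 s) g1 * basis g2"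
  by (simp add: MG_pcomp_def reconnect_eq mplug_def[abs_def])

lemma lin_underlying: "lin (\<lambda>h. basis (underlying h)) = lin (rewire (\<lambda>a. {fst a}))"
  by (intro ext lin_cong) (simp add: rewire_singleton underlying_def)

lemma lin_underlying_mult:
  "lin (\<lambda>h. basis (underlying h)) (x * y) =
    (lin (\<lambda>h. basis (underlying h)) x * lin (\<lambda>h. basis (underlying h)) y :: _ \<Rightarrow>\<^sub>0 'k::field)"
  by (rule lin_mult_hom) (simp add: basis_mult)

lemma lin_underlying_plug:
  assumes "finite V2"
  shows "lin (\<lambda>h. basis (underlying h)) (rewire (plug V2 s r) h) =
    (rewire (\<lambda>a. fst ` plug V2 s r a) h :: _ \<Rightarrow>\<^sub>0 'k::field)"
proof -
  have dis: "disjoint_family_on (\<lambda>a. {fst a}) (plug V2 s r a)" for a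
    by (cases rule: plug_cases[of a s V2 r]) (auto simp: disjoint_family_on_def)
  have un: "(\<Union>b\<in>plug V2 s r a. {fst b}) = fst ` plug V2 s r a" for a by blast
  have "lin (rewire (\<lambda>a. {fst a})) (rewire (plug V2 s r) h) =
      (rewire (\<lambda>a. \<Union>b\<in>plug V2 s r a. {fst b}) h :: _ \<Rightarrow>\<^sub>0 'k)"
    using dis assms by (intro lin_rewire_rewire) (auto simp: finite_plug)
  then show ?thesis unfolding lin_underlying un .
qed

lemma unorient_pcomp:
  assumes "finite V2"
  shows "unorient (MGor_pcomp V2 s (h1, r1) (h2, r2) :: _ \<Rightarrow>\<^sub>0 'k::field) =
    lin (\<lambda>g. basis (g, if r1 \<noteq> s then r1 else r2))
      (rewire (\<lambda>a. fst ` plug V2 s r2 a) h1 * basis (underlying h2))"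
proof -
  have "unorient (MGor_pcomp V2 s (h1, r1) (h2, r2) :: _ \<Rightarrow>\<^sub>0 'k) =
      lin (\<lambda>g. basis (g, if r1 \<noteq> s then r1 else r2))
        (lin (\<lambda>h. basis (underlying h)) (rewire (plug V2 s r2) h1 * basis h2))"
    by (simp add: unorient_def MGor_pcomp_eq lin_lin)
  also have "lin (\<lambda>h. basis (underlying h)) (rewire (plug V2 s r2) h1 * basis h2) =
      (rewire (\<lambda>a. fst ` plug V2 s r2 a) h1 * basis (underlying h2) :: _ \<Rightarrow>\<^sub>0 'k)"
    by (simp add: lin_underlying_mult lin_underlying_plug[OF assms])
  finally show ?thesis .
qed

text \<open>Only source ends at \<open>s\<close> depend on the root \<open>r\<close>; the remaining
  ends follow the rule of \<open>MG\<close> once labels are forgotten.\<close>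

lemma rewire_fst_plug:
  assumes "(s, Source) \<notin> ends h"
  shows "rewire (\<lambda>a. fst ` plug V2 s r a) h = (rewire (mplug V2 s) (underlying h) :: _ \<Rightarrow>\<^sub>0 'k::field)"
  unfolding underlying_def rewire_image
proof (rule rewire_cong)
  fix a assume "a \<in> ends h"
  with assms show "fst ` plug V2 s r a = mplug V2 s (fst a)"
    by (cases rule: plug_cases[of a s V2 r]) (auto simp: mplug_def image_image)
qed

text \<open>The contribution of \<open>(g\<^sub>1, r\<^sub>1)\<close> to the image in rooted multigraphs of the composition at \<open>s\<close> with
  an element whose image is \<open>\<Sum>\<^sub>r (g\<^sub>2, r)\<close>.\<close>

definition star ::
    "'v set \<Rightarrow> 'v \<Rightarrow> 'v mgraph \<times> 'v \<Rightarrow> 'v mgraph \<Rightarrow> ('v mgraph \<times> 'v \<Rightarrow>\<^sub>0 'k::field)" where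
  "star V2 s = (\<lambda>(g1, r1) g2. if r1 \<noteq> s then lin (\<lambda>g. basis (g, r1)) (MG_pcomp V2 s g1 g2)
    else \<Sum>r\<in>V2. lin (\<lambda>g. basis (g, r)) (MG_pcomp V2 s g1 g2))"

lemma ends_arcs:
  assumes "finite V" "rooting V r p"
  shows "(v, Source) \<in> ends (arcs V r p) \<longleftrightarrow> v \<in> V - {r}"
  using assms by (auto simp: ends_def arcs_def)

text \<open>If \<open>r1 = s\<close>, there is no source end at \<open>s\<close> and the sum over
  \<open>r2\<close> only moves the root. Otherwise the root is fixed and the sum acts on a single
  factor of the product, the arc from \<open>s\<close> to its parent.\<close>

lemma sum_plug_eq_star:
  assumes fin: "finite V1" "finite V2" and s: "s \<notin> V1"
    and h1: "(h1, r1) \<in> ST_basis (insert s V1)"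
  shows "(\<Sum>r2\<in>V2. lin (\<lambda>g. basis (g, if r1 \<noteq> s then r1 else r2))
      (rewire (\<lambda>a. fst ` plug V2 s r2 a) h1 * basis g2)) =
    (star V2 s (underlying h1, r1) g2 :: _ \<Rightarrow>\<^sub>0 'k::field)"
proof -
  obtain p k where h: "h1 = arcs (insert s V1) r1 p + targets k" and p: "rooting (insert s V1) r1 p"
    using h1 by (auto simp: ST_basis_def)
  show ?thesis
  proof (cases "r1 = s")
    case True
    have "(s, Source) \<notin> ends h1"
      using fin ends_arcs[OF _ p] True by (auto simp: h)
    then show ?thesis
      using True by (simp add: star_def rewire_fst_plug MG_pcomp_eq)
  next
    case False
    let ?e = "Upair (s, Source) (p s, Target)"
    let ?h = "image_mset (\<lambda>v. Upair (v, Source) (p v, Target)) (mset_set (V1 - {r1})) + targets k"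
    have "insert s V1 - {r1} = insert s (V1 - {r1})" using False by auto
    then have h': "h1 = add_mset ?e ?h"
      using fin s by (simp add: h arcs_def)
    \<comment> \<open>The other end of the isolated edge is not at \<open>s\<close>, so it stays in
      place under both rules.\<close>
    have ps: "p s \<noteq> s" using rooting_ne[OF p, of s] False by auto
    have "(s, Source) \<notin> ends ?h" using fin s by (auto simp: ends_def targets_def uprod.set_map)
    note R = rewire_fst_plug[OF this, of V2, where 'k='k]
    have "(\<Sum>r2\<in>V2. rewire (\<lambda>a. fst ` plug V2 s r2 a) h1) =
        (\<Sum>r2\<in>V2. basis {#Upair r2 (p s)#} * rewire (mplug V2 s) (underlying ?h) :: _ \<Rightarrow>\<^sub>0 'k)"
      unfolding h' rewire_add_mset R using ps
      by (intro sum.cong refl arg_cong2[of _ _ _ _ "(*)"]) (simp add: rewire_edge_Upair plug_simps)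
    also have "\<dots> = rewire_edge (mplug V2 s) (Upair s (p s)) * rewire (mplug V2 s) (underlying ?h)"
      using ps by (simp only: sum_distrib_right rewire_edge_Upair) (simp add: mplug_def sum_distrib_right)
    also have "\<dots> = rewire (mplug V2 s) (underlying h1)"
      unfolding h' by simp
    finally have "(\<Sum>r2\<in>V2. rewire (\<lambda>a. fst ` plug V2 s r2 a) h1) =
        (rewire (mplug V2 s) (underlying h1) :: _ \<Rightarrow>\<^sub>0 'k)" .
    then show ?thesis
      using False by (simp add: star_def MG_pcomp_eq flip: lin_sum sum_distrib_right)
  qed
qed

text \<open>Only the second factor has to be a sum over roots. The first is arbitrary in the span of
  \<open>ST_basis\<close>, and its image under \<open>unorient\<close> already determines the
  result.\<close>

lemma unorient_bilin:
  assumes fin: "finite V1" "finite V2" and s: "s \<notin> V1"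
    and x: "supp x \<subseteq> ST_basis (insert s V1)" and y: "unorient y = all_roots V2 b"
  shows "unorient (bilin (MGor_pcomp V2 s) x y) = (bilin (star V2 s) (unorient x) b :: _ \<Rightarrow>\<^sub>0 'k::field)"
proof -
  \<comment> \<open>Once labels are forgotten, the second factor enters only through its underlying
    multigraph and its root, so \<open>unorient y\<close> can take its place. The first must keep
    its labels, which tell the source ends at \<open>s\<close> apart.\<close>
  define E :: "'a omgraph \<times> 'a \<Rightarrow> 'a mgraph \<times> 'a \<Rightarrow> ('a mgraph \<times> 'a \<Rightarrow>\<^sub>0 'k)" where
    "E = (\<lambda>(h1, r1) (g, r2). lin (\<lambda>g. basis (g, if r1 \<noteq> s then r1 else r2))
      (rewire (\<lambda>a. fst ` plug V2 s r2 a) h1 * basis g))"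
  have E: "unorient (MGor_pcomp V2 s a c :: _ \<Rightarrow>\<^sub>0 'k) = lin (E a) (unorient (basis c))" for a c
    by (cases a; cases c) (simp add: unorient_pcomp[OF fin(2)] unorient_simps E_def)
  have "unorient (bilin (MGor_pcomp V2 s) x y) = lin (\<lambda>a. lin (\<lambda>c. unorient (MGor_pcomp V2 s a c)) y) x"
    by (simp add: unorient_def bilin_def lin_lin)
  also have "\<dots> = lin (\<lambda>a. lin (E a) (unorient y)) x"
    unfolding E by (simp add: unorient_def lin_lin)
  also have "\<dots> = lin (\<lambda>a. lin (\<lambda>g. \<Sum>r\<in>V2. E a (g, r)) b) x"
    by (simp add: y all_roots_def lin_lin lin_sum)
  also have "\<dots> = lin (\<lambda>(h, r). lin (star V2 s (underlying h, r)) b) x"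
  proof (rule lin_cong, clarify)
    fix h r assume "(h, r) \<in> supp x"
    with x have "(h, r) \<in> ST_basis (insert s V1)" by auto
    then show "lin (\<lambda>g. \<Sum>r'\<in>V2. E (h, r) (g, r')) b = lin (star V2 s (underlying h, r)) b"
      by (intro lin_cong) (simp add: E_def sum_plug_eq_star[OF fin s])
  qed
  also have "\<dots> = bilin (star V2 s) (unorient x) b"
    by (simp add: bilin_def unorient_def lin_lin case_prod_unfold)
  finally show ?thesis .
qed

text \<open>A root in \<open>V1\<close> survives as itself and the root \<open>s\<close> is replaced
  by every vertex of \<open>V2\<close>, so each vertex of the union is the root exactly
  once.\<close>

lemma star_all_roots:
  assumes "finite V1" "finite V2" "V1 \<inter> V2 = {}" "s \<notin> V1"
  shows "bilin (star V2 s) (all_roots (insert s V1) a) b =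
    (all_roots (V1 \<union> V2) (bilin (MG_pcomp V2 s) a b) :: _ \<Rightarrow>\<^sub>0 'k::field)"
proof -
  have "(\<Sum>r\<in>insert s V1. star V2 s (g1, r) g2) = all_roots (V1 \<union> V2) (MG_pcomp V2 s g1 g2 :: _ \<Rightarrow>\<^sub>0 'k)"
    for g1 g2
  proof -
    have "(\<Sum>r\<in>V1. star V2 s (g1, r) g2 :: _ \<Rightarrow>\<^sub>0 'k) = (\<Sum>r\<in>V1. lin (\<lambda>g. basis (g, r)) (MG_pcomp V2 s g1 g2))"
      using assms(4) by (intro sum.cong) (auto simp: star_def)
    moreover have "all_roots (V1 \<union> V2) (MG_pcomp V2 s g1 g2 :: _ \<Rightarrow>\<^sub>0 'k) =
        (\<Sum>r\<in>V1 \<union> V2. lin (\<lambda>g. basis (g, r)) (MG_pcomp V2 s g1 g2))"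
      by (simp add: all_roots_def lin_fun_sum)
    ultimately show ?thesis
      using assms by (simp add: sum.union_disjoint star_def[of V2 s] add.commute)
  qed
  then show ?thesis
    by (simp add: bilin_def all_roots_def lin_lin lin_sum flip: lin_fun_sum)
qed


section \<open>The operads of the theorem\<close>

lemma MGor_sel [simp]:
  "vzero MGor V = 0" "vadd MGor V = (+)" "vsmult MGor V = smul" "ident MGor v = basis ({#}, v)"
  "relabel MGor V \<sigma> = lin (\<lambda>(h, v). basis (relabel_ends \<sigma> h, \<sigma> v))"
  "pcomp MGor V1 V2 s = bilin (MGor_pcomp V2 s)"
  "space MGor V = {x. supp x \<subseteq> {(h, v). mgraph_on V (underlying h) \<and> v \<in> V}}"
  by (simp_all add: MGor_def relabel_ends_def case_prod_unfold)

lemma MG_sel [simp]: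
  "vzero MG V = 0" "vadd MG V = (+)" "vsmult MG V = smul" "ident MG v = basis {#}"
  "relabel MG V \<sigma> = lin (\<lambda>g. basis (image_mset (map_uprod \<sigma>) g))"
  "pcomp MG V1 V2 s = bilin (MG_pcomp V2 s)"
  by (simp_all add: MG_def)

lemma PLie_sel [simp]:
  "vzero PLie V = 0" "vadd PLie V = (+)" "vsmult PLie V = smul" "ident PLie v = basis ({#}, v)"
  "relabel PLie V \<sigma> = lin (\<lambda>(t, r). basis (image_mset (map_uprod \<sigma>) t, \<sigma> r))"
  "pcomp PLie V1 V2 s = bilin (PLie_pcomp V2 s)"
  "space PLie V = {x. supp x \<subseteq> {(t, r). tree_on V t \<and> r \<in> V}}"
  by (simp_all add: PLie_def case_prod_unfold)

lemma sub_MGor: "ST = sub_data MGor (space ST)" "OST = sub_data MGor (space OST)"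
  "PLie_O = sub_data MGor (space PLie_O)" "OSTG = sub_data MGor (space OSTG)"
  by (simp_all add: ST_def MGorc_def OST_def PLie_O_def OSTG_def)

lemma OST_sel [simp]:
  "vzero OST V = 0" "vadd OST V = (+)" "vsmult OST V = smul" "ident OST v = basis ({#}, v)"
  "relabel OST V \<sigma> = lin (\<lambda>(h, v). basis (relabel_ends \<sigma> h, \<sigma> v))"
  "pcomp OST V1 V2 s = bilin (MGor_pcomp V2 s)"
  by (simp_all add: OST_def ST_def MGorc_def)

lemma PLie_O_sel [simp]:
  "vzero PLie_O V = 0" "vadd PLie_O V = (+)" "vsmult PLie_O V = smul" "ident PLie_O v = basis ({#}, v)"
  "relabel PLie_O V \<sigma> = lin (\<lambda>(h, v). basis (relabel_ends \<sigma> h, \<sigma> v))"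
  "pcomp PLie_O V1 V2 s = bilin (MGor_pcomp V2 s)"
  by (simp_all add: PLie_O_def ST_def MGorc_def)

lemma OSTG_sel [simp]:
  "vzero OSTG V = 0" "vadd OSTG V = (+)" "vsmult OSTG V = smul" "ident OSTG v = basis ({#}, v)"
  "relabel OSTG V \<sigma> = lin (\<lambda>(h, v). basis (relabel_ends \<sigma> h, \<sigma> v))"
  "pcomp OSTG V1 V2 s = bilin (MGor_pcomp V2 s)"
  by (simp_all add: OSTG_def)

lemma MGc_sel [simp]:
  "vzero MGc V = 0" "vadd MGc V = (+)" "vsmult MGc V = smul" "ident MGc v = basis {#}"
  "relabel MGc V \<sigma> = lin (\<lambda>g. basis (image_mset (map_uprod \<sigma>) g))"
  "pcomp MGc V1 V2 s = bilin (MG_pcomp V2 s)"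
  by (simp_all add: MGc_def)

lemma Gc_sel [simp]:
  "vzero Gc V = 0" "vadd Gc V = (+)" "vsmult Gc V = smul" "ident Gc v = basis {#}"
  "relabel Gc V \<sigma> = lin (\<lambda>g. basis (image_mset (map_uprod \<sigma>) g))"
  "pcomp Gc V1 V2 s = bilin (MG_pcomp V2 s)"
  by (simp_all add: Gc_def)

lemma T_sel [simp]:
  "vzero T V = 0" "vadd T V = (+)" "vsmult T V = smul" "ident T v = basis {#}"
  "relabel T V \<sigma> = lin (\<lambda>g. basis (image_mset (map_uprod \<sigma>) g))"
  "pcomp T V1 V2 s = bilin (MG_pcomp V2 s)"
  by (simp_all add: T_def)

lemma space_MGc: "space MGc V = {x. supp x \<subseteq> {g. connected_on V g}}"
  and space_Gc: "space Gc V = {x. supp x \<subseteq> {g. connected_on V g \<and> simple_mgraph g}}"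
  and space_T: "space T V = {x. supp x \<subseteq> {g. tree_on V g}}"
  by (simp_all add: MGc_def Gc_def T_def span_basis)

lemma space_Gorc: "space Gorc V =
    {x. supp x \<subseteq> {(h, v). connected_on V (underlying h) \<and> simple_mgraph (underlying h) \<and> v \<in> V}}"
  by (simp add: Gorc_def span_basis)

section \<open>Sub-operads of \<open>MGor\<close>\<close>

lemma ST_basis_subset:
  "finite V \<Longrightarrow> ST_basis V \<subseteq> {(h, v). mgraph_on V (underlying h) \<and> v \<in> V}"
  by (auto dest: connected_ST_basis[unfolded connected_on_def])

lemma supp_add_subset: "supp x \<subseteq> B \<Longrightarrow> supp y \<subseteq> B \<Longrightarrow> supp (x + y) \<subseteq> B"
  using keys_add[of x y] by blast

lemma supp_smul_subset: "supp x \<subseteq> B \<Longrightarrow> supp (smul c x) \<subseteq> B"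
  using supp_smul[of c x] by blast

lemma supp_relabel_subset:
  assumes "supp x \<subseteq> B" "\<And>h r. (h, r) \<in> B \<Longrightarrow> (relabel_ends \<sigma> h, \<sigma> r) \<in> B'"
  shows "supp (lin (\<lambda>(h, v). basis (relabel_ends \<sigma> h, \<sigma> v)) x) \<subseteq> B'"
proof -
  have "supp (lin (\<lambda>b. basis (case b of (h, v) \<Rightarrow> (relabel_ends \<sigma> h, \<sigma> v))) x) \<subseteq>
      (\<lambda>(h, v). (relabel_ends \<sigma> h, \<sigma> v)) ` supp x"
    using supp_lin_basis[of "\<lambda>(h, v). (relabel_ends \<sigma> h, \<sigma> v)" x] by (simp add: case_prod_unfold)
  also have "\<dots> \<subseteq> B'" using assms by auto
  finally show ?thesis by (simp add: case_prod_unfold)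
qed

lemma supp_bilin_subset:
  assumes "supp x \<subseteq> B1" "supp y \<subseteq> B2" "\<And>a b. a \<in> B1 \<Longrightarrow> b \<in> B2 \<Longrightarrow> supp (f a b) \<subseteq> B"
  shows "supp (bilin f x y) \<subseteq> B"
  using supp_bilin[of f x y] assms by blast

text \<open>Each sub-operad in question is given by a basis \<open>B\<close> for the supports and a
  further condition \<open>L\<close>. Closure of \<open>B\<close> is combinatorics on basis
  elements, closure of \<open>L\<close> concerns whole combinations, and the two are kept apart
  here.\<close>

lemma operad_sub_MGor:
  fixes S :: "'v set \<Rightarrow> ('v omgraph \<times> 'v \<Rightarrow>\<^sub>0 'k::field) set"
  assumes S: "\<And>V x. finite V \<Longrightarrow> x \<in> S V \<longleftrightarrow> supp x \<subseteq> B V \<and> L V x"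
    and B: "\<And>V. finite V \<Longrightarrow> B V \<subseteq> ST_basis V"
    and B_relabel: "\<And>V \<sigma> h r. finite V \<Longrightarrow> inj_on \<sigma> V \<Longrightarrow> (h, r) \<in> B V \<Longrightarrow>
      (relabel_ends \<sigma> h, \<sigma> r) \<in> B (\<sigma> ` V)"
    and B_ident: "\<And>v. ({#}, v) \<in> B {v}"
    and B_pcomp: "\<And>V1 V2 s a b. \<lbrakk>finite V1; finite V2; V1 \<inter> V2 = {}; s \<notin> V1; a \<in> B (insert s V1); b \<in> B V2\<rbrakk>
      \<Longrightarrow> supp (MGor_pcomp V2 s a b :: _ \<Rightarrow>\<^sub>0 'k) \<subseteq> B (V1 \<union> V2)"
    and L_zero: "\<And>V. finite V \<Longrightarrow> L V 0"
    and L_add: "\<And>V x y. finite V \<Longrightarrow> x \<in> S V \<Longrightarrow> y \<in> S V \<Longrightarrow> L V (x + y)"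
    and L_smul: "\<And>V c x. finite V \<Longrightarrow> x \<in> S V \<Longrightarrow> L V (smul c x)"
    and L_relabel: "\<And>V \<sigma> x. finite V \<Longrightarrow> inj_on \<sigma> V \<Longrightarrow> x \<in> S V \<Longrightarrow> L (\<sigma> ` V) (relabel MGor V \<sigma> x)"
    and L_ident: "\<And>v. L {v} (basis ({#}, v))"
    and L_pcomp: "\<And>V1 V2 s x y. \<lbrakk>finite V1; finite V2; V1 \<inter> V2 = {}; s \<notin> V1; x \<in> S (insert s V1); y \<in> S V2\<rbrakk>
      \<Longrightarrow> L (V1 \<union> V2) (bilin (MGor_pcomp V2 s) x y)"
  shows "operad (sub_data MGor S)"
proof (rule operad_sub_data[OF operad_MGor])
  show "subspecies MGor S"
    unfolding subspecies_def
  proof (intro allI impI conjI ballI, goal_cases)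
    case (1 V)
    then show ?case using S B ST_basis_subset by fastforce
  next
    case (2 V)
    then show ?case using S L_zero by simp
  next
    case (3 V x y)
    then show ?case using S L_add by (simp add: supp_add_subset)
  next
    case (4 V c x)
    then show ?case using S L_smul by (simp add: supp_smul_subset)
  next
    case (5 V \<sigma> x)
    then have "supp (relabel MGor V \<sigma> x) \<subseteq> B (\<sigma> ` V)"
      unfolding MGor_sel using S B_relabel by (intro supp_relabel_subset) auto
    with 5 show ?case using S L_relabel by blast
  qed
next
  fix v show "ident MGor v \<in> S {v}" using S[of "{v}"] B_ident L_ident by simp
next
  fix V1 V2 :: "'v set" and s x y
  assume *: "finite V1" "finite V2" "V1 \<inter> V2 = {}" "s \<notin> V1" "x \<in> S (insert s V1)" "y \<in> S V2"
  have "supp (bilin (MGor_pcomp V2 s) x y) \<subseteq> B (V1 \<union> V2)"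
    using * S by (intro supp_bilin_subset[of x "B (insert s V1)" y "B V2"] B_pcomp) auto
  then show "pcomp MGor V1 V2 s x y \<in> S (V1 \<union> V2)"
    using * S L_pcomp by simp
qed

lemma ST_basis_ident: "({#}, v) \<in> ST_basis {v}"
  by (rule subsetD[OF PLie_basis_subset PLie_basis_ident])

lemma operad_ST: "operad (ST :: ('v, 'k::field, 'v omgraph \<times> 'v \<Rightarrow>\<^sub>0 'k) operad_data)"
  by (subst sub_MGor(1), rule operad_sub_MGor[of _ ST_basis "\<lambda>V x. True"])
    (auto simp: space_ST ST_basis_relabel ST_basis_ident intro!: ST_basis_pcomp[THEN subsetD])

text \<open>The copy of \<open>PLie\<close> inside \<open>MGor\<close>. It inherits the axioms and
  passes them to \<open>PLie\<close> as its image, so associativity of \<open>PLie_pcomp\<close> is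
  not proved by hand.\<close>

lemma operad_PLie_basis:
  "operad (sub_data MGor (\<lambda>V. {x :: 'v omgraph \<times> 'v \<Rightarrow>\<^sub>0 'k::field. supp x \<subseteq> PLie_basis V}))"
proof (rule operad_sub_MGor[of _ PLie_basis "\<lambda>V x. True"], goal_cases)
  case (2 V) show ?case by (rule PLie_basis_subset)
next
  case (3 V \<sigma> h r) then show ?case by (intro PLie_basis_relabel)
next
  case (4 v) show ?case by (rule PLie_basis_ident)
next
  case (5 V1 V2 s a b) then show ?case by (intro PLie_basis_pcomp)
qed simp_all

section \<open>The forgetful map from \<O> to connected multigraphs\<close>

lemma unorient_relabel:
  "unorient (relabel MGor V \<sigma> x) = lin (\<lambda>(g, r). basis (image_mset (map_uprod \<sigma>) g, \<sigma> r)) (unorient x)"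
  by (simp add: unorient_def lin_lin case_prod_unfold underlying_relabel_ends)

lemma all_roots_relabel:
  assumes "inj_on \<sigma> V"
  shows "lin (\<lambda>(g, r). basis (image_mset (map_uprod \<sigma>) g, \<sigma> r)) (all_roots V a) =
    all_roots (\<sigma> ` V) (relabel MG V \<sigma> a)"
  using assms by (simp add: all_roots_def lin_lin lin_sum sum.reindex)

lemma unorient_pcomp_OST:
  assumes "finite V1" "finite V2" "V1 \<inter> V2 = {}" "s \<notin> V1" "x \<in> space OST (insert s V1)" "y \<in> space OST V2"
  shows "unorient (bilin (MGor_pcomp V2 s) x y) = all_roots (V1 \<union> V2)
    (bilin (MG_pcomp V2 s) (unroot (insert s V1) x) (unroot V2 y) :: _ \<Rightarrow>\<^sub>0 'k::field)"
proof -
  have "supp x \<subseteq> ST_basis (insert s V1)" using assms by (simp add: space_OST)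
  then have "unorient (bilin (MGor_pcomp V2 s) x y) = bilin (star V2 s) (unorient x) (unroot V2 y)"
    using assms unroot_OST[OF assms(2,6)] by (intro unorient_bilin)
  also have "\<dots> = bilin (star V2 s) (all_roots (insert s V1) (unroot (insert s V1) x)) (unroot V2 y)"
    using assms by (subst unroot_OST[of "insert s V1" x]) auto
  also have "\<dots> = all_roots (V1 \<union> V2) (bilin (MG_pcomp V2 s) (unroot (insert s V1) x) (unroot V2 y))"
    using assms by (intro star_all_roots)
  finally show ?thesis .
qed

text \<open>\<O>, its intersection with \<open>PLie\<close> and its simple part differ only in the
  basis \<open>B\<close>; being a sum over all roots is preserved by the same computation in the
  three cases.\<close>

lemma operad_sub_OST:
  fixes S :: "'v set \<Rightarrow> ('v omgraph \<times> 'v \<Rightarrow>\<^sub>0 'k::field) set"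
  assumes S: "\<And>V x. finite V \<Longrightarrow> x \<in> S V \<longleftrightarrow> supp x \<subseteq> B V \<and> (\<exists>a. unorient x = all_roots V a)"
    and B: "\<And>V. finite V \<Longrightarrow> B V \<subseteq> ST_basis V"
    and B_relabel: "\<And>V \<sigma> h r. finite V \<Longrightarrow> inj_on \<sigma> V \<Longrightarrow> (h, r) \<in> B V \<Longrightarrow>
      (relabel_ends \<sigma> h, \<sigma> r) \<in> B (\<sigma> ` V)"
    and B_ident: "\<And>v. ({#}, v) \<in> B {v}"
    and B_pcomp: "\<And>V1 V2 s a b. \<lbrakk>finite V1; finite V2; V1 \<inter> V2 = {}; s \<notin> V1; a \<in> B (insert s V1); b \<in> B V2\<rbrakk>
      \<Longrightarrow> supp (MGor_pcomp V2 s a b :: _ \<Rightarrow>\<^sub>0 'k) \<subseteq> B (V1 \<union> V2)"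
  shows "operad (sub_data MGor S)"
proof -
  have sub: "x \<in> space OST V" if "finite V" "x \<in> S V" for V x
    using that S B by (force simp: space_OST)
  note eq = unroot_OST[OF _ sub]
  show ?thesis
  proof (rule operad_sub_MGor[of S B "\<lambda>V x. \<exists>a. unorient x = all_roots V a"], goal_cases)
    case (1 V x) then show ?case by (rule S)
  next
    case (2 V) then show ?case by (rule B)
  next
    case (3 V \<sigma> h r) then show ?case by (rule B_relabel)
  next
    case (4 v) show ?case by (rule B_ident)
  next
    case (5 V1 V2 s a b) then show ?case by (rule B_pcomp)
  next
    case (6 V) show ?case by (intro exI[of _ 0]) (simp add: unorient_simps all_roots_simps)
  next
    case (7 V x y)
    then show ?case
      by (intro exI[of _ "unroot V x + unroot V y"]) (simp add: unorient_simps all_roots_simps eq)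
  next
    case (8 V c x)
    then show ?case
      by (intro exI[of _ "smul c (unroot V x)"]) (simp add: unorient_simps all_roots_simps eq)
  next
    case (9 V \<sigma> x)
    show ?case
      unfolding unorient_relabel eq[OF 9(1,1,3)] all_roots_relabel[OF 9(2)] by blast
  next
    case (10 v)
    show ?case by (intro exI[of _ "basis {#}"]) (simp only: unorient_simps all_roots_simps underlying_simps, simp)
  next
    case (11 V1 V2 s x y)
    show ?case
      using unorient_pcomp_OST[OF 11(1-4) sub[OF finite.insertI[OF 11(1)] 11(5)] sub[OF 11(2,6)]] by blast
  qed
qed

lemma operad_OST: "operad (OST :: ('v, 'k::field, 'v omgraph \<times> 'v \<Rightarrow>\<^sub>0 'k) operad_data)"
  by (subst sub_MGor(2), rule operad_sub_OST[of _ ST_basis])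
    (simp_all add: space_OST ST_basis_relabel ST_basis_ident ST_basis_pcomp)

lemma supp_unroot: "supp (unroot V x) \<subseteq> underlying ` fst ` supp x"
proof -
  have "supp (unroot V x) \<subseteq>
      (\<Union>b\<in>supp x. supp ((case b of (h, r) \<Rightarrow> if r = (SOME r. r \<in> V) then basis (underlying h) else 0) :: _ \<Rightarrow>\<^sub>0 'b))"
    unfolding unroot_def by (rule supp_lin)
  also have "\<dots> \<subseteq> underlying ` fst ` supp x" by (force split: if_splits)
  finally show ?thesis .
qed

lemma structure_map_unroot: "structure_map (OST :: ('v, 'k::field, 'v omgraph \<times> 'v \<Rightarrow>\<^sub>0 'k) operad_data) MGc unroot"
  unfolding structure_map_def
proof (intro conjI allI impI ballI, goal_cases)
  case (1 V x)
  then have "supp x \<subseteq> ST_basis V" by (simp add: space_OST)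
  then have "underlying ` fst ` supp x \<subseteq> {g. connected_on V g}"
    using connected_ST_basis(1)[OF 1(1)] by fastforce
  then show ?case using supp_unroot[of V x] unfolding space_MGc by blast
next
  case (2 V x y)
  show ?case by (simp add: unroot_simps)
next
  case (3 V c x)
  show ?case by (simp add: unroot_simps)
next
  case (4 V \<sigma> x)
  show ?case
  \<comment> \<open>Without labels the value of \<open>unroot\<close> cannot be read off at a root,
    but the space is then zero.\<close>
  proof (cases "V = {}")
    case True
    then have "x = 0" using 4 by (simp add: space_OST)
    then show ?thesis by (simp add: unroot_simps)
  next
    case False
    have "unorient (relabel MGor V \<sigma> x) = all_roots (\<sigma> ` V) (relabel MG V \<sigma> (unroot V x))"
      unfolding unorient_relabel unroot_OST[OF 4(1,3)] all_roots_relabel[OF 4(2)] ..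
    with 4 False have "unroot (\<sigma> ` V) (relabel MGor V \<sigma> x) = relabel MG V \<sigma> (unroot V x)"
      by (intro unrootI) simp_all
    then show ?thesis by simp
  qed
next
  case (5 v)
  show ?case by (simp add: unroot_def)
next
  case (6 V1 V2 s x y)
  have "unroot (V1 \<union> V2) (bilin (MGor_pcomp V2 s) x y) =
      bilin (MG_pcomp V2 s) (unroot (insert s V1) x) (unroot V2 y)"
  proof (cases "V1 \<union> V2 = {}")
    case True
    then have "y = 0" using 6 by (simp add: space_OST)
    then show ?thesis by (simp add: unroot_simps)
  next
    case False
    with 6 show ?thesis by (intro unrootI unorient_pcomp_OST) auto
  qed
  then show ?case by simp
qed

lemma section_OST:
  assumes "finite V" "a \<in> space MGc V"
  defines "x \<equiv> lin (\<lambda>g. \<Sum>r\<in>V. basis (canonical_rooting V (g, r))) a"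
  shows "x \<in> space OST V" "unroot V x = a"
proof -
  have conn: "supp a \<subseteq> {g. connected_on V g}" using assms(2) by (simp add: space_MGc)
  note x = section_all_roots[OF assms(1) conn, folded x_def]
  show "x \<in> space OST V" using x assms(1) by (auto simp: space_OST)
  show "unroot V x = a"
  proof (cases "V = {}")
    case True
    then have "a = 0" using conn by (auto simp: connected_on_def)
    then show ?thesis by (simp add: x_def unroot_simps)
  next
    case False
    then show ?thesis using assms(1) x(3) by (intro unrootI)
  qed
qed

text \<open>On \<O>, \<open>unorient x\<close> is \<open>all_roots V (unroot V x)\<close>, so both
  maps vanish together, and an element killed by \<open>unorient\<close> lies in \<O> with
  \<open>a = 0\<close>. Hence the kernel is \<I>; that \<open>MGc\<close> is an operad also follows
  from here.\<close>

interpretation OST: operad_epi "OST :: ('v, 'k::field, 'v omgraph \<times> 'v \<Rightarrow>\<^sub>0 'k) operad_data" MGc unroot IST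
proof (rule operad_epi.intro)
  fix V :: "'v set" assume V: "finite V"
  show "unroot V (vzero (OST :: ('v, 'k, _) operad_data) V) = vzero MGc V"
    by (simp add: unroot_simps)
  show "unroot V ` space OST V = (space MGc V :: (_ \<Rightarrow>\<^sub>0 'k) set)"
    using structure_mapD(1)[OF structure_map_unroot V] section_OST[OF V] by (force simp: image_iff)
  have "unorient x = 0 \<longleftrightarrow> x \<in> space OST V \<and> unroot V x = 0"
    if "supp x \<subseteq> ST_basis V" for x :: "'v omgraph \<times> 'v \<Rightarrow>\<^sub>0 'k"
  proof
    assume 0: "unorient x = 0"
    have "unorient x = all_roots V 0" by (simp add: 0 all_roots_simps)
    then have x: "x \<in> space OST V" using that V by (auto simp: space_OST)
    moreover have "unroot V x = 0"
    proof (cases "V = {}")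
      case True
      then show ?thesis using that by (simp add: unroot_simps)
    next
      case False
      show ?thesis by (rule unrootI[OF V False]) (simp add: 0 all_roots_simps)
    qed
    ultimately show "x \<in> space OST V \<and> unroot V x = 0" by blast
  next
    assume "x \<in> space OST V \<and> unroot V x = 0"
    then show "unorient x = 0" using unroot_OST[OF V, of x] by (simp add: all_roots_simps)
  qed
  moreover have "supp x \<subseteq> ST_basis V" if "x \<in> space OST V" for x :: "'v omgraph \<times> 'v \<Rightarrow>\<^sub>0 'k"
    using that V by (simp add: space_OST)
  moreover have "vzero MGc V = (0 :: _ \<Rightarrow>\<^sub>0 'k)" by simp
  ultimately show "IST V = {x \<in> space OST V. unroot V x = (vzero MGc V :: _ \<Rightarrow>\<^sub>0 'k)}"
    unfolding IST_eq[OF V] by auto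
qed (rule operad_OST structure_map_unroot)+


section \<open>Simple graphs\<close>

definition simple_basis :: "'v set \<Rightarrow> ('v omgraph \<times> 'v) set" where
  "simple_basis V = {(h, r) \<in> ST_basis V. simple_mgraph (underlying h)}"

lemma simple_basis_subset: "simple_basis V \<subseteq> ST_basis V"
  by (auto simp: simple_basis_def)

text \<open>Connectedness is automatic on \<open>ST_basis\<close>, so the intersection with
  \<open>Gorc\<close> adds simplicity only.\<close>

lemma space_OSTG:
  assumes "finite V"
  shows "x \<in> space OSTG V \<longleftrightarrow> supp x \<subseteq> simple_basis V \<and> (\<exists>a. unorient x = all_roots V a)"
  by (auto simp: OSTG_def space_OST[OF assms] space_Gorc simple_basis_def subset_iff
      dest: connected_ST_basis[OF assms])

lemma simple_mgraph_relabel: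
  assumes "inj_on \<sigma> (ends g)" "simple_mgraph g"
  shows "simple_mgraph (image_mset (map_uprod \<sigma>) g)"
proof -
  have inj: "inj_on (map_uprod \<sigma>) (set_mset g)"
  proof (rule inj_onI)
    fix e e' assume *: "e \<in># g" "e' \<in># g" "map_uprod \<sigma> e = map_uprod \<sigma> e'"
    obtain a b where e: "e = Upair a b" by (cases e)
    obtain c d where e': "e' = Upair c d" by (cases e')
    have "a \<in> ends g" "b \<in> ends g" "c \<in> ends g" "d \<in> ends g"
      using *(1,2) e e' by (force simp: ends_def)+
    note eq = inj_on_eq_iff[OF assms(1)]
    from *(3) show "e = e'"
      using \<open>a \<in> ends g\<close> \<open>b \<in> ends g\<close> \<open>c \<in> ends g\<close> \<open>d \<in> ends g\<close> by (simp add: e e' eq)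
  qed
  have "proper_uprod (map_uprod \<sigma> e)" if "e \<in># g" for e
  proof -
    obtain a b where e: "e = Upair a b" by (cases e)
    then have "a \<noteq> b" "a \<in> ends g" "b \<in> ends g"
      using that assms(2) by (force simp: simple_mgraph_def ends_def)+
    then show ?thesis using assms(1) by (auto simp: e inj_on_def)
  qed
  moreover have "count (image_mset (map_uprod \<sigma>) g) (map_uprod \<sigma> e) = 1" if "e \<in># g" for e
  proof -
    have "map_uprod \<sigma> -` {map_uprod \<sigma> e} \<inter> set_mset g = {e}"
      using inj that by (auto simp: inj_on_def)
    then show ?thesis using that assms(2) by (simp add: count_image_mset simple_mgraph_def)
  qed
  ultimately show ?thesis unfolding simple_mgraph_def by auto
qed

lemma simple_basis_relabel:
  assumes "finite V" "inj_on \<sigma> V" "(h, r) \<in> simple_basis V"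
  shows "(relabel_ends \<sigma> h, \<sigma> r) \<in> simple_basis (\<sigma> ` V)"
proof -
  have h: "(h, r) \<in> ST_basis V" "simple_mgraph (underlying h)" using assms(3) by (auto simp: simple_basis_def)
  have "ends (underlying h) \<subseteq> V"
    using connected_ST_basis(1)[OF assms(1) h(1)] by (simp add: connected_on_def mgraph_on_iff)
  then have "simple_mgraph (underlying (relabel_ends \<sigma> h))"
    unfolding underlying_relabel_ends using assms(2) h(2)
    by (intro simple_mgraph_relabel) (auto intro: inj_on_subset)
  with ST_basis_relabel[OF assms(2) h(1)] show ?thesis by (simp add: simple_basis_def)
qed

lemma simple_basis_pcomp:
  assumes V: "finite V1" "finite V2" "V1 \<inter> V2 = {}" "s \<notin> V1"
    and ab: "a \<in> simple_basis (insert s V1)" "b \<in> simple_basis V2"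
  shows "supp (MGor_pcomp V2 s a b :: _ \<Rightarrow>\<^sub>0 'k::field) \<subseteq> simple_basis (V1 \<union> V2)"
proof
  fix x assume x: "x \<in> supp (MGor_pcomp V2 s a b :: _ \<Rightarrow>\<^sub>0 'k)"
  obtain h1 r1 where a: "a = (h1, r1)" "(h1, r1) \<in> ST_basis (insert s V1)" "simple_mgraph (underlying h1)"
    using ab(1) by (auto simp: simple_basis_def)
  obtain h2 r2 where b: "b = (h2, r2)" "(h2, r2) \<in> ST_basis V2" "simple_mgraph (underlying h2)"
    using ab(2) by (auto simp: simple_basis_def)
  have "x \<in> ST_basis (V1 \<union> V2)"
    using ST_basis_pcomp[OF V a(2) b(2)] x unfolding a(1) b(1) by blast
  moreover obtain h r where hr: "x = (h, r)" by (cases x)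
  moreover obtain h' where h': "rewiring (plug V2 s r2) h1 h'" "h = h' + h2"
    using x unfolding hr a(1) b(1) by (rule supp_MGor_pcomp)
  moreover have "simple_mgraph (underlying (h' + h2))"
    using connected_ST_basis[OF _ a(2)] connected_ST_basis[OF V(2) b(2)] V a(3) b(3) h'(1)
    by (intro simple_pcomp[of V1 V2 r2 s h1]) (auto simp: connected_on_def)
  ultimately show "x \<in> simple_basis (V1 \<union> V2)" by (simp add: simple_basis_def)
qed

lemma simple_basis_ident: "({#}, v) \<in> simple_basis {v}"
  using ST_basis_ident by (simp add: simple_basis_def simple_mgraph_def)

lemma operad_OSTG: "operad (OSTG :: ('v, 'k::field, 'v omgraph \<times> 'v \<Rightarrow>\<^sub>0 'k) operad_data)"
  by (subst sub_MGor(4), rule operad_sub_OST[of _ simple_basis, OF space_OSTG])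
    (simp_all add: simple_basis_subset simple_basis_relabel simple_basis_ident simple_basis_pcomp)


section \<open>Rooted trees as oriented trees\<close>

lemma orientation_tree:
  assumes "finite V" "rooting V r p"
  shows "orientation (parent_tree V r p) (parent_tree V r p) r = arcs V r p"
  using orientation_parent_tree[OF assms, of "{#}"] by simp

lemma PLie_basis_eq:
  assumes "finite V"
  shows "PLie_basis V = (\<lambda>(t, r). (orientation t t r, r)) ` {(t, r). tree_on V t \<and> r \<in> V}"
proof (intro set_eqI iffI)
  fix x assume "x \<in> PLie_basis V"
  then obtain r p where x: "x = (arcs V r p, r)" "rooting V r p" by (auto simp: PLie_basis_def)
  then have "x = (\<lambda>(t, r). (orientation t t r, r)) (parent_tree V r p, r)" "r \<in> V"
    using assms by (auto simp: orientation_tree rooting_def)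
  then show "x \<in> (\<lambda>(t, r). (orientation t t r, r)) ` {(t, r). tree_on V t \<and> r \<in> V}"
    using tree_on_parent_tree[OF assms x(2)] by blast
next
  fix x assume "x \<in> (\<lambda>(t, r). (orientation t t r, r)) ` {(t, r). tree_on V t \<and> r \<in> V}"
  then obtain t r where x: "x = (orientation t t r, r)" "tree_on V t" "r \<in> V" by auto
  obtain p where "rooting V r p" "t = parent_tree V r p" using tree_rooting[OF assms x(2,3)] by blast
  then show "x \<in> PLie_basis V" using x(1) assms by (auto simp: PLie_basis_def orientation_tree)
qed

lemma PLie_basis_tree:
  assumes "finite V" "(h, r) \<in> PLie_basis V"
  shows "tree_on V (underlying h)" "r \<in> V" "orientation (underlying h) (underlying h) r = h"
proof -
  obtain p where p: "h = arcs V r p" "rooting V r p" using assms(2) by (auto simp: PLie_basis_def)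
  show "tree_on V (underlying h)" "r \<in> V" "orientation (underlying h) (underlying h) r = h"
    using tree_on_parent_tree[OF assms(1) p(2)] orientation_tree[OF assms(1) p(2)] p
    by (auto simp: rooting_def)
qed

lemma unorient_PLie_emb:
  assumes "finite V" "x \<in> space PLie V"
  shows "unorient (PLie_emb V x) = x"
proof -
  have "unorient (PLie_emb V x) = lin (\<lambda>(t, r). basis (underlying (orientation t t r), r)) x"
    by (simp add: unorient_def PLie_emb_def lin_lin case_prod_unfold)
  also have "\<dots> = lin basis x"
  proof (rule lin_cong, clarify)
    fix t r assume "(t, r) \<in> supp x"
    then have "tree_on V t" "r \<in> V" using assms(2) by auto
    then obtain p where "rooting V r p" "t = parent_tree V r p" using tree_rooting[OF assms(1)] by blast
    then show "basis (underlying (orientation t t r), r) = basis (t, r)"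
      using assms(1) by (simp add: orientation_tree)
  qed
  finally show ?thesis by simp
qed

lemma PLie_emb_unorient:
  assumes "finite V" "supp x \<subseteq> PLie_basis V"
  shows "PLie_emb V (unorient x) = x"
proof -
  have "PLie_emb V (unorient x) = lin (\<lambda>(h, r). basis (orientation (underlying h) (underlying h) r, r)) x"
    by (simp add: unorient_def PLie_emb_def lin_lin case_prod_unfold)
  also have "\<dots> = lin basis x"
    using PLie_basis_tree(3)[OF assms(1)] assms(2) by (intro lin_cong) auto
  finally show ?thesis by simp
qed

lemma unorient_mem_PLie:
  assumes "finite V" "supp x \<subseteq> PLie_basis V"
  shows "unorient x \<in> space PLie V"
proof -
  have u: "unorient x = lin (\<lambda>b. basis ((\<lambda>(h, r). (underlying h, r)) b)) x"
    by (simp add: unorient_def case_prod_unfold)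
  have "supp (unorient x) \<subseteq> (\<lambda>(h, r). (underlying h, r)) ` supp x"
    unfolding u by (rule supp_lin_basis)
  also have "\<dots> \<subseteq> {(t, r). tree_on V t \<and> r \<in> V}"
    using PLie_basis_tree(1,2)[OF assms(1)] assms(2) by fastforce
  finally show ?thesis by simp
qed

lemma PLie_in_ST_eq:
  assumes "finite V"
  shows "PLie_in_ST V = {x :: _ \<Rightarrow>\<^sub>0 'k::field. supp x \<subseteq> PLie_basis V}"
proof (intro set_eqI iffI)
  fix x :: "_ \<Rightarrow>\<^sub>0 'k" assume "x \<in> PLie_in_ST V"
  then obtain y :: "_ \<Rightarrow>\<^sub>0 'k" where y: "x = PLie_emb V y" "y \<in> space PLie V" by (auto simp: PLie_in_ST_def)
  have x: "x = lin (\<lambda>b. basis ((\<lambda>(t, r). (orientation t t r, r)) b)) y"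
    by (simp add: y(1) PLie_emb_def case_prod_unfold)
  have "supp x \<subseteq> (\<lambda>(t, r). (orientation t t r, r)) ` supp y"
    unfolding x by (rule supp_lin_basis)
  also have "\<dots> \<subseteq> PLie_basis V"
    unfolding PLie_basis_eq[OF assms] using y(2) by (intro image_mono) simp
  finally show "x \<in> {x. supp x \<subseteq> PLie_basis V}" by simp
next
  fix x :: "_ \<Rightarrow>\<^sub>0 'k" assume "x \<in> {x. supp x \<subseteq> PLie_basis V}"
  then show "x \<in> PLie_in_ST V"
    using PLie_emb_unorient[OF assms, of x] unorient_mem_PLie[OF assms, of x]
    unfolding PLie_in_ST_def by (metis image_eqI mem_Collect_eq)
qed

lemma prod_basis_image_mset:
  "finite M \<Longrightarrow> (\<Prod>m\<in>M. basis {#e m#}) = (basis (image_mset e (mset_set M)) :: _ \<Rightarrow>\<^sub>0 'k::field)"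
  by (induction M rule: finite_induct) (simp_all add: basis_mult)

lemma rewire_image_mset_set:
  "finite M \<Longrightarrow> rewire A (image_mset f (mset_set M)) = (\<Prod>m\<in>M. rewire_edge A (f m))"
  by (induction M rule: finite_induct) simp_all

lemma is_parent_iff:
  assumes "finite V" "rooting V r p"
  shows "is_parent (parent_tree V r p) r u w \<longleftrightarrow> w \<in> V - {r} \<and> u = p w"
proof
  assume *: "is_parent (parent_tree V r p) r u w"
  then have "(u \<in> V - {r} \<and> w = p u) \<or> (w \<in> V - {r} \<and> u = p w)"
    using assms(1) by (simp add: is_parent_def adj_parent_tree)
  then show "w \<in> V - {r} \<and> u = p w"
    using * gdist_parent[OF assms] by (auto simp: is_parent_def dest: less_asym)
next
  assume "w \<in> V - {r} \<and> u = p w"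
  then show "is_parent (parent_tree V r p) r u w"
    using gdist_parent[OF assms, of w] assms(1) by (simp add: is_parent_def adj_parent_tree)
qed

text \<open>\<open>PLie_pcomp\<close> distinguishes the edges away from \<open>s\<close>, the edge
  to the parent of \<open>s\<close> and the edges to its children. The product over all arcs splits
  accordingly, and only the children contribute sums.\<close>

lemma rewire_arcs:
  assumes fin: "finite V1" "finite V2" and s: "s \<notin> V1" and p: "rooting (insert s V1) r1 p"
  defines "t \<equiv> parent_tree (insert s V1) r1 p"
  shows "rewire (\<lambda>a. fst ` plug V2 s r2 a) (arcs (insert s V1) r1 p) =
    (\<Sum>f\<in>{w. is_parent t r1 s w} \<rightarrow>\<^sub>E V2.
      basis (filter_mset (\<lambda>e. s \<notin> set_uprod e) t
        + image_mset (\<lambda>u. Upair u r2) (mset_set {u. is_parent t r1 u s})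
        + image_mset (\<lambda>w. Upair w (f w)) (mset_set {w. is_parent t r1 s w})) :: _ \<Rightarrow>\<^sub>0 'k::field)"
proof -
  define M where "M = insert s V1 - {r1}"
  \<comment> \<open>\<open>C\<close> is the set of children of \<open>s\<close>, \<open>M0\<close>
    indexes the edges avoiding \<open>s\<close>, and \<open>S\<close> is \<open>{s}\<close> or empty
    according to whether \<open>s\<close> has a parent.\<close>
  define C where "C = {w \<in> M. p w = s}"
  define M0 where "M0 = {w \<in> M. w \<noteq> s \<and> p w \<noteq> s}"
  define S where "S = {w \<in> M. w = s}"
  let ?A = "\<lambda>a. fst ` plug V2 s r2 a"
  let ?arc = "\<lambda>v. Upair (v, Source) (p v, Target)"
  have finM: "finite M" "finite C" "finite M0" "finite S"
    using fin by (auto simp: M_def C_def M0_def S_def)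
  have ne: "p w \<noteq> w" if "w \<in> M" for w
    using rooting_ne[OF p, of w] that by (auto simp: M_def)
  have M: "M = M0 \<union> S \<union> C" "M0 \<inter> S = {}" "(M0 \<union> S) \<inter> C = {}"
    using ne[of s] by (auto simp: M0_def S_def C_def)
  have Ceq: "{w. is_parent t r1 s w} = C"
    using is_parent_iff[OF _ p] fin by (auto simp: t_def C_def M_def)
  have Seq: "{u. is_parent t r1 u s} = p ` S"
    using is_parent_iff[OF _ p] fin by (auto simp: t_def S_def M_def)
  have filt: "filter_mset (\<lambda>e. s \<notin> set_uprod e) t = image_mset (\<lambda>v. Upair v (p v)) (mset_set M0)"
  proof -
    have "{v \<in> M. s \<notin> set_uprod (Upair v (p v))} = M0" by (auto simp: M0_def)
    then show ?thesis
      using finM by (simp add: t_def parent_tree_def filter_mset_image_mset filter_mset_mset_set flip: M_def)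
  qed
  \<comment> \<open>\<open>S\<close> has at most one element, so indexing by the parent or by
    \<open>s\<close> gives the same multiset.\<close>
  have parent: "image_mset (\<lambda>u. Upair u r2) (mset_set (p ` S)) = image_mset (\<lambda>w. Upair r2 (p w)) (mset_set S)"
  proof (cases "s \<in> M")
    case True
    then have "S = {s}" by (auto simp: S_def)
    then show ?thesis by simp
  next
    case False
    then have "S = {}" by (auto simp: S_def)
    then show ?thesis by simp
  qed
  have "rewire ?A (arcs (insert s V1) r1 p) = (\<Prod>m\<in>M. rewire_edge ?A (?arc m) :: _ \<Rightarrow>\<^sub>0 'k)"
    unfolding arcs_def M_def[symmetric] using finM(1) by (rule rewire_image_mset_set)
  also have "\<dots> = (\<Prod>m\<in>M0. rewire_edge ?A (?arc m)) * (\<Prod>m\<in>S. rewire_edge ?A (?arc m)) *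
      (\<Prod>m\<in>C. rewire_edge ?A (?arc m))"
    using finM M(2,3) unfolding M(1) by (simp add: prod.union_disjoint)
  also have "(\<Prod>m\<in>M0. rewire_edge ?A (?arc m)) = (\<Prod>m\<in>M0. basis {#Upair m (p m)#} :: _ \<Rightarrow>\<^sub>0 'k)"
    by (intro prod.cong refl) (simp add: M0_def rewire_edge_Upair plug_simps)
  also have "(\<Prod>m\<in>S. rewire_edge ?A (?arc m)) = (\<Prod>m\<in>S. basis {#Upair r2 (p m)#} :: _ \<Rightarrow>\<^sub>0 'k)"
  proof (intro prod.cong refl)
    fix m assume "m \<in> S"
    then have "m = s" "p s \<noteq> s" using ne by (auto simp: S_def)
    then show "rewire_edge ?A (?arc m) = (basis {#Upair r2 (p m)#} :: _ \<Rightarrow>\<^sub>0 'k)"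
      by (simp add: rewire_edge_Upair plug_simps)
  qed
  also have "(\<Prod>m\<in>C. rewire_edge ?A (?arc m)) = (\<Prod>m\<in>C. \<Sum>w\<in>V2. basis {#Upair m w#} :: _ \<Rightarrow>\<^sub>0 'k)"
  proof (intro prod.cong refl)
    fix m assume "m \<in> C"
    then have m: "p m = s" "m \<noteq> s" using ne[of m] by (auto simp: C_def)
    have "fst ` (\<lambda>w. (w, Target)) ` V2 = V2" by (simp add: image_image)
    with m show "rewire_edge ?A (?arc m) = (\<Sum>w\<in>V2. basis {#Upair m w#} :: _ \<Rightarrow>\<^sub>0 'k)"
      by (simp add: rewire_edge_Upair plug_simps)
  qed
  \<comment> \<open>Distributivity: choosing a vertex of \<open>V2\<close> for each child is
    choosing a function \<open>f\<close>.\<close>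
  also have "\<dots> = (\<Sum>f\<in>C \<rightarrow>\<^sub>E V2. \<Prod>m\<in>C. basis {#Upair m (f m)#})"
    using finM fin by (intro prod_sum_PiE) auto
  finally show ?thesis
    unfolding Ceq Seq filt parent using finM
    by (simp add: prod_basis_image_mset sum_distrib_left basis_mult)
qed

lemma PLie_pcomp_unorient:
  assumes fin: "finite V1" "finite V2" and s: "s \<notin> V1"
    and a: "(h1, r1) \<in> PLie_basis (insert s V1)"
  shows "unorient (MGor_pcomp V2 s (h1, r1) (h2, r2)) =
    (PLie_pcomp V2 s (underlying h1, r1) (underlying h2, r2) :: _ \<Rightarrow>\<^sub>0 'k::field)"
proof -
  obtain p where p: "h1 = arcs (insert s V1) r1 p" "rooting (insert s V1) r1 p"
    using a by (auto simp: PLie_basis_def)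
  show ?thesis
    unfolding unorient_pcomp[OF fin(2)] p(1) rewire_arcs[OF fin s p(2)]
    by (simp add: PLie_pcomp_def lin_sum sum_distrib_right basis_mult)
qed

text \<open>No sum over roots is needed here: on rooted trees the orientation is determined by the
  tree and its root, and \<open>PLie_pcomp\<close> also attaches the parent of \<open>s\<close> to
  the root of the second factor.\<close>

lemma structure_map_unorient:
  "structure_map (sub_data MGor (\<lambda>V. {x :: 'v omgraph \<times> 'v \<Rightarrow>\<^sub>0 'k::field. supp x \<subseteq> PLie_basis V})) PLie
    (\<lambda>V. unorient)"
  unfolding structure_map_def sub_data_sel
proof (intro conjI allI impI ballI, goal_cases)
  case (1 V x) then show ?case by (intro unorient_mem_PLie) auto
next
  case (2 V x y) show ?case by (simp add: unorient_simps)
next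
  case (3 V c x) show ?case by (simp add: unorient_simps)
next
  case (4 V \<sigma> x) show ?case by (simp only: unorient_relabel PLie_sel)
next
  case (5 v) show ?case by (simp add: unorient_simps)
next
  case (6 V1 V2 s x y)
  have "unorient (bilin (MGor_pcomp V2 s) x y) = bilin (\<lambda>a b. unorient (MGor_pcomp V2 s a b)) x y"
    by (simp add: unorient_def lin_bilin)
  also have "\<dots> = bilin (\<lambda>(h1, r1) (h2, r2). PLie_pcomp V2 s (underlying h1, r1) (underlying h2, r2)) x y"
  proof (intro bilin_cong, clarify)
    fix h1 r1 h2 r2 assume "(h1, r1) \<in> supp x"
    then have "(h1, r1) \<in> PLie_basis (insert s V1)" using 6(5) by auto
    then show "unorient (MGor_pcomp V2 s (h1, r1) (h2, r2)) =
        (PLie_pcomp V2 s (underlying h1, r1) (underlying h2, r2) :: _ \<Rightarrow>\<^sub>0 'k)"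
      using 6 by (intro PLie_pcomp_unorient) auto
  qed
  also have "\<dots> = bilin (PLie_pcomp V2 s) (unorient x) (unorient y)"
    by (simp add: unorient_def bilin_lin_lin case_prod_unfold)
  finally show ?case by simp
qed

text \<open>\<open>PLie_emb\<close> is treated as the inverse of \<open>unorient\<close>, which at
  the same time exhibits \<open>PLie\<close> as the image of an operad.\<close>

lemma operad_iso_PLie_emb:
  "operad_iso (PLie :: ('v, 'k::field, 'v mgraph \<times> 'v \<Rightarrow>\<^sub>0 'k) operad_data)
    (sub_data MGor (\<lambda>V. {x. supp x \<subseteq> PLie_basis V})) PLie_emb"
proof -
  let ?P = "sub_data MGor (\<lambda>V. {x :: 'v omgraph \<times> 'v \<Rightarrow>\<^sub>0 'k. supp x \<subseteq> PLie_basis V})"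
  have emb: "PLie_emb V y \<in> space ?P V \<and> unorient (PLie_emb V y) = y"
    if "finite V" "y \<in> space PLie V" for V and y :: "'v mgraph \<times> 'v \<Rightarrow>\<^sub>0 'k"
    using that PLie_in_ST_eq[OF that(1)] by (auto simp: unorient_PLie_emb PLie_in_ST_def)
  have "operad (PLie :: ('v, 'k, 'v mgraph \<times> 'v \<Rightarrow>\<^sub>0 'k) operad_data)"
  proof (rule operad_image[OF operad_PLie_basis structure_map_unorient])
    fix V :: "'v set" assume V: "finite V"
    show "unorient (vzero ?P V) = vzero PLie V" by (simp add: unorient_simps)
    show "unorient ` space ?P V = space PLie V"
      using emb[OF V] unorient_mem_PLie[OF V] by (force simp: image_iff simp del: PLie_sel(7))
  qed
  then show ?thesis
    by (rule operad_iso_inverse[OF operad_PLie_basis _ structure_map_unorient emb])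
      (simp_all add: PLie_emb_unorient del: PLie_sel(7))
qed

lemma structure_map_enlarge:
  assumes "structure_map P (sub_data Q S) f" "\<And>V. finite V \<Longrightarrow> S V \<subseteq> S' V"
  shows "structure_map P (sub_data Q S') f"
  unfolding structure_map_def sub_data_sel
  by (intro conjI allI impI ballI)
    (auto intro: subsetD[OF assms(2)] structure_mapD[OF assms(1), unfolded sub_data_sel])

lemma structure_map_restrict:
  assumes "structure_map P Q f" "\<And>V. finite V \<Longrightarrow> S V \<subseteq> space P V"
  shows "structure_map (sub_data P S) Q f"
  using assms unfolding structure_map_def sub_data_sel by (simp add: subset_iff)

lemma embedding_PLie_ST:
  "operad_embedding (PLie :: ('v, 'k::field, 'v mgraph \<times> 'v \<Rightarrow>\<^sub>0 'k) operad_data) ST PLie_emb"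
proof -
  note iso = operad_iso_PLie_emb[unfolded operad_iso_def operad_hom_iff, where 'v='v and 'k='k]
  have "structure_map (PLie :: ('v, 'k, _) operad_data) ST PLie_emb"
  proof (subst sub_MGor(1), rule structure_map_enlarge)
    show "structure_map (PLie :: ('v, 'k, _) operad_data)
        (sub_data MGor (\<lambda>V. {x. supp x \<subseteq> PLie_basis V})) PLie_emb"
      using iso by blast
    show "{x. supp x \<subseteq> PLie_basis V} \<subseteq> (space ST V :: (_ \<Rightarrow>\<^sub>0 'k) set)" if "finite V" for V :: "'v set"
      using PLie_basis_subset[of V] by (auto simp: space_ST[OF that])
  qed
  moreover have "inj_on (PLie_emb V) (space (PLie :: ('v, 'k, _) operad_data) V)" if "finite V" for V
    using iso that by (auto simp: bij_betw_def)
  ultimately show ?thesis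
    using iso operad_ST by (auto simp: operad_embedding_def operad_hom_iff)
qed

text \<open>\<open>unorient\<close> vanishes on \<I> and is injective on the copy of
  \<open>PLie\<close>, where \<open>PLie_emb\<close> undoes it.\<close>

lemma IST_PLie:
  assumes "finite V"
  shows "IST V \<inter> PLie_in_ST V = {0 :: 'v omgraph \<times> 'v \<Rightarrow>\<^sub>0 'k::field}"
proof
  show "IST V \<inter> PLie_in_ST V \<subseteq> {0 :: 'v omgraph \<times> 'v \<Rightarrow>\<^sub>0 'k}"
  proof clarify
    fix x :: "'v omgraph \<times> 'v \<Rightarrow>\<^sub>0 'k" assume "x \<in> IST V" "x \<in> PLie_in_ST V"
    then have "unorient x = 0" "PLie_emb V (unorient x) = x"
      using assms PLie_emb_unorient[OF assms, of x] by (auto simp: IST_eq PLie_in_ST_eq)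
    then show "x = 0" by (simp add: PLie_emb_def)
  qed
  show "{0} \<subseteq> IST V \<inter> PLie_in_ST V"
    using assms by (simp add: IST_eq PLie_in_ST_eq unorient_simps)
qed

section \<open>The intersection of \<open>PLie\<close> with \<O>\<close>

lemma space_PLie_O:
  assumes "finite V"
  shows "x \<in> space PLie_O V \<longleftrightarrow> supp x \<subseteq> PLie_basis V \<and> (\<exists>a. unorient x = all_roots V a)"
  using PLie_basis_subset[of V] by (auto simp: PLie_O_def PLie_in_ST_eq[OF assms] space_OST[OF assms])

lemma PLie_O_sub: "PLie_O = sub_data OST (space PLie_O)"
  and OSTG_sub: "OSTG = sub_data OST (space OSTG)"
  and T_sub: "T = sub_data MGc (space T)"
  and Gc_sub: "Gc = sub_data MGc (space Gc)"
  by (simp_all add: PLie_O_def OST_def OSTG_def T_def MGc_def Gc_def)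

lemma space_PLie_O_subset: "space PLie_O V \<subseteq> space OST V"
  and space_OSTG_subset: "space OSTG V \<subseteq> space OST V"
  by (auto simp: PLie_O_def OSTG_def)

lemma operad_PLie_O: "operad (PLie_O :: ('v, 'k::field, 'v omgraph \<times> 'v \<Rightarrow>\<^sub>0 'k) operad_data)"
  by (subst sub_MGor(3), rule operad_sub_OST[of _ PLie_basis, OF space_PLie_O])
    (simp_all add: PLie_basis_subset PLie_basis_relabel PLie_basis_ident PLie_basis_pcomp)

lemma psi_tree_eq: "psi_tree V x = PLie_emb V (all_roots V x)"
  by (simp add: psi_tree_def all_roots_def)

lemma psi_tree_props:
  assumes "finite V" "x \<in> space T V"
  shows "psi_tree V x \<in> space PLie_O V" "unroot V (psi_tree V x) = (x :: _ \<Rightarrow>\<^sub>0 'k::field)"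
proof -
  have "supp (all_roots V x) \<subseteq> (\<Union>g\<in>supp x. supp (\<Sum>r\<in>V. basis (g, r) :: _ \<Rightarrow>\<^sub>0 'k))"
    unfolding all_roots_def by (rule supp_lin)
  also have "\<dots> \<subseteq> (\<Union>g\<in>supp x. \<Union>r\<in>V. supp (basis (g, r) :: _ \<Rightarrow>\<^sub>0 'k))"
    by (intro UN_mono order.refl supp_sum)
  also have "\<dots> \<subseteq> {(t, r). tree_on V t \<and> r \<in> V}"
    using assms(2) by (auto simp: space_T)
  finally have P: "all_roots V x \<in> space PLie V" by simp
  then have "supp (psi_tree V x) \<subseteq> PLie_basis V"
    using PLie_in_ST_eq[OF assms(1), where 'k='k] unfolding psi_tree_eq PLie_in_ST_def by blast
  moreover have u: "unorient (psi_tree V x) = all_roots V x"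
    unfolding psi_tree_eq using assms(1) P by (rule unorient_PLie_emb)
  ultimately show "psi_tree V x \<in> space PLie_O V" unfolding space_PLie_O[OF assms(1)] by blast
  show "unroot V (psi_tree V x) = x"
  proof (cases "V = {}")
    case True
    then have "x = 0" using assms(2) by (auto simp: space_T tree_on_def connected_on_def)
    then show ?thesis by (simp add: psi_tree_eq all_roots_simps PLie_emb_def unroot_simps)
  next
    case False
    with assms(1) u show ?thesis by (intro unrootI)
  qed
qed

lemma psi_tree_unroot:
  assumes "finite V" "x \<in> space PLie_O V"
  shows "psi_tree V (unroot V x) = x"
  using assms unroot_OST[OF assms(1) subsetD[OF space_PLie_O_subset assms(2)]]
    PLie_emb_unorient[OF assms(1), of x]
  by (simp add: psi_tree_eq space_PLie_O)

lemma unroot_PLie_O: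
  assumes "finite V" "x \<in> space PLie_O V"
  shows "unroot V x \<in> space T V"
proof -
  have "underlying ` fst ` supp x \<subseteq> {t. tree_on V t}"
    using assms PLie_basis_tree(1)[OF assms(1)] by (fastforce simp: space_PLie_O)
  then show ?thesis using supp_unroot[of V x] by (auto simp: space_T)
qed

text \<open>\<open>psi_tree\<close> inverts the restriction of \<open>unroot\<close> to this
  intersection, and therefore inherits its compatibility with the operations.\<close>

lemma operad_iso_psi_tree:
  "operad_iso (T :: ('v, 'k::field, 'v mgraph \<Rightarrow>\<^sub>0 'k) operad_data) PLie_O psi_tree"
proof -
  have "structure_map (sub_data OST (space PLie_O)) (sub_data MGc (space T))
      (unroot :: 'v set \<Rightarrow> _ \<Rightarrow> _ \<Rightarrow>\<^sub>0 'k)"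
    using space_PLie_O_subset by (intro structure_map_sub_data[OF structure_map_unroot] unroot_PLie_O) auto
  then have map: "structure_map PLie_O T (unroot :: 'v set \<Rightarrow> _ \<Rightarrow> _ \<Rightarrow>\<^sub>0 'k)"
    by (simp only: PLie_O_sub[symmetric] T_sub[symmetric])
  have "operad (T :: ('v, 'k, 'v mgraph \<Rightarrow>\<^sub>0 'k) operad_data)"
  proof (rule operad_image[OF operad_PLie_O map])
    fix V :: "'v set" assume V: "finite V"
    show "unroot V (vzero PLie_O V) = (vzero T V :: _ \<Rightarrow>\<^sub>0 'k)" by (simp add: unroot_simps)
    show "unroot V ` space PLie_O V = (space T V :: (_ \<Rightarrow>\<^sub>0 'k) set)"
      using unroot_PLie_O[OF V] psi_tree_props[OF V] by (force simp: image_iff)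
  qed
  then show ?thesis
    by (rule operad_iso_inverse[OF operad_PLie_O _ map])
      (simp_all add: psi_tree_props psi_tree_unroot)
qed

text \<open>\<open>unroot\<close> is constant on classes modulo \<I>, and \<open>psi_tree\<close>
  recovers an element of the intersection from its value.\<close>

lemma embedding_PLie_O_quotient:
  "operad_embedding (PLie_O :: ('v, 'k::field, 'v omgraph \<times> 'v \<Rightarrow>\<^sub>0 'k) operad_data)
    (quotient OST IST) (coset OST IST)"
proof -
  have "structure_map (sub_data OST (space PLie_O)) (quotient OST IST)
      (coset OST IST :: 'v set \<Rightarrow> (_ \<Rightarrow>\<^sub>0 'k) \<Rightarrow> _)"
    using space_PLie_O_subset by (intro structure_map_restrict OST.structure_map_coset) auto
  then have "structure_map PLie_O (quotient OST IST) (coset OST IST :: 'v set \<Rightarrow> (_ \<Rightarrow>\<^sub>0 'k) \<Rightarrow> _)"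
    by (simp only: PLie_O_sub[symmetric])
  moreover have "inj_on (coset OST IST V) (space PLie_O V :: (_ \<Rightarrow>\<^sub>0 'k) set)" if V: "finite V" for V :: "'v set"
  proof (rule inj_onI)
    fix x y :: "'v omgraph \<times> 'v \<Rightarrow>\<^sub>0 'k"
    assume xy: "x \<in> space PLie_O V" "y \<in> space PLie_O V" and eq: "coset OST IST V x = coset OST IST V y"
    have "x \<in> space OST V" "y \<in> space OST V" using xy space_PLie_O_subset by auto
    with eq V have "unroot V x = unroot V y" by (auto simp: OST.coset_eq)
    then have "psi_tree V (unroot V x) = psi_tree V (unroot V y)" by (rule arg_cong)
    then show "x = y" by (simp only: psi_tree_unroot[OF V xy(1)] psi_tree_unroot[OF V xy(2)])
  qed
  ultimately show ?thesis
    using operad_PLie_O OST.operad_quotient by (auto simp: operad_embedding_def operad_hom_iff)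
qed


section \<open>The isomorphism\<close>

lemma section_OSTG:
  assumes "finite V" "a \<in> space Gc V"
  shows "lin (\<lambda>g. \<Sum>r\<in>V. basis (canonical_rooting V (g, r))) a \<in> space OSTG V" (is "?x \<in> _")
proof -
  have a: "a \<in> space MGc V" using assms(2) by (auto simp: space_MGc space_Gc)
  have "supp ?x \<subseteq> (\<Union>g\<in>supp a. supp (\<Sum>r\<in>V. basis (canonical_rooting V (g, r)) :: _ \<Rightarrow>\<^sub>0 'b))"
    by (rule supp_lin)
  also have "\<dots> \<subseteq> (\<Union>g\<in>supp a. \<Union>r\<in>V. supp (basis (canonical_rooting V (g, r)) :: _ \<Rightarrow>\<^sub>0 'b))"
    by (intro UN_mono order.refl supp_sum)
  also have "\<dots> \<subseteq> {(h, r). simple_mgraph (underlying h)}"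
  proof clarsimp
    fix g r h r' assume "g \<in> supp a" "r \<in> V" "(h, r') = canonical_rooting V (g, r)"
    moreover then have "connected_on V g" "simple_mgraph g" using assms(2) by (auto simp: space_Gc)
    ultimately show "simple_mgraph (underlying h)"
      using underlying_orientation[OF assms(1) \<open>r \<in> V\<close> canonical_rooting_mem(3)[OF assms(1)]]
      by (simp add: canonical_rooting_def)
  qed
  finally have "supp ?x \<subseteq> simple_basis V"
    using section_OST(1)[OF assms(1) a] assms(1) by (auto simp: simple_basis_def space_OST)
  with section_OST(1)[OF assms(1) a] assms(1) show ?thesis
    by (auto simp: space_OSTG space_OST)
qed

lemma unroot_OSTG:
  assumes "finite V" "x \<in> space OSTG V"
  shows "unroot V x \<in> space Gc V"
proof -
  have "underlying ` fst ` supp x \<subseteq> {g. connected_on V g \<and> simple_mgraph g}"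
    using assms connected_ST_basis(1)[OF assms(1)] by (fastforce simp: space_OSTG simple_basis_def)
  then show ?thesis using supp_unroot[of V x] by (auto simp: space_Gc)
qed

text \<open>The same map restricts to simple graphs: canonical rootings leave the underlying
  multigraph unchanged, hence surjectivity, and the kernel of a restriction is the intersection with
  the kernel.\<close>

interpretation OSTG: operad_epi "OSTG :: ('v, 'k::field, 'v omgraph \<times> 'v \<Rightarrow>\<^sub>0 'k) operad_data" Gc unroot ISTG
proof (rule operad_epi.intro)
  show "operad (OSTG :: ('v, 'k, 'v omgraph \<times> 'v \<Rightarrow>\<^sub>0 'k) operad_data)" by (rule operad_OSTG)
  have "structure_map (sub_data OST (space OSTG)) (sub_data MGc (space Gc))
      (unroot :: 'v set \<Rightarrow> _ \<Rightarrow> _ \<Rightarrow>\<^sub>0 'k)"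
    using space_OSTG_subset by (intro structure_map_sub_data[OF structure_map_unroot] unroot_OSTG) auto
  then show "structure_map OSTG Gc (unroot :: 'v set \<Rightarrow> _ \<Rightarrow> _ \<Rightarrow>\<^sub>0 'k)"
    by (simp only: OSTG_sub[symmetric] Gc_sub[symmetric])
  fix V :: "'v set" assume V: "finite V"
  show "unroot V (vzero OSTG V) = (vzero Gc V :: _ \<Rightarrow>\<^sub>0 'k)" by (simp add: unroot_simps)
  show "unroot V ` space OSTG V = (space Gc V :: (_ \<Rightarrow>\<^sub>0 'k) set)"
  proof (intro equalityI subsetI)
    fix a :: "_ \<Rightarrow>\<^sub>0 'k" assume a: "a \<in> space Gc V"
    then have "a \<in> space MGc V" by (auto simp: space_MGc space_Gc)
    from section_OST(2)[OF V this] show "a \<in> unroot V ` space OSTG V"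
      by (intro image_eqI[OF _ section_OSTG[OF V a]]) (rule sym)
  qed (use unroot_OSTG[OF V] in auto)
  show "ISTG V = {x \<in> space OSTG V. unroot V x = (vzero Gc V :: _ \<Rightarrow>\<^sub>0 'k)}"
    using OST.kernel[OF V, where 'k='k] by (auto simp: ISTG_def OSTG_def)
qed

theorem proposition2p6:
  shows "operad_embedding (PLie :: ('v, 'k::field_char_0, 'v mgraph \<times> 'v \<Rightarrow>\<^sub>0 'k) operad_data) ST PLie_emb
    \<and> operad_iso (T :: ('v, 'k, 'v mgraph \<Rightarrow>\<^sub>0 'k) operad_data) PLie_O psi_tree
    \<and> operad_ideal (OST :: ('v, 'k, 'v omgraph \<times> 'v \<Rightarrow>\<^sub>0 'k) operad_data) IST
    \<and> (\<forall>V. finite V \<longrightarrow> (IST V :: ('v omgraph \<times> 'v \<Rightarrow>\<^sub>0 'k) set) \<inter> PLie_in_ST V = {0})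
    \<and> operad_embedding (PLie_O :: ('v, 'k, 'v omgraph \<times> 'v \<Rightarrow>\<^sub>0 'k) operad_data)
        (quotient OST IST) (coset OST IST)
    \<and> operad_ideal (OSTG :: ('v, 'k, 'v omgraph \<times> 'v \<Rightarrow>\<^sub>0 'k) operad_data) ISTG
    \<and> (\<exists>\<psi> :: 'v set \<Rightarrow> ('v mgraph \<Rightarrow>\<^sub>0 'k) \<Rightarrow> ('v omgraph \<times> 'v \<Rightarrow>\<^sub>0 'k) set.
        operad_iso MGc (quotient OST IST) \<psi>
        \<and> (\<forall>V x. finite V \<longrightarrow> x \<in> space T V \<longrightarrow> \<psi> V x = coset OST IST V (psi_tree V x))
        \<and> (\<forall>V g t. finite V \<longrightarrow> connected_on V g \<longrightarrow> (\<forall>r\<in>V. spanning_tree V g (t r)) \<longrightarrow>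
              \<psi> V (basis g) = coset OST IST V (\<Sum>r\<in>V. basis (orientation g (t r) r, r)))
        \<and> (\<exists>\<phi>. operad_iso Gc (quotient OSTG ISTG) \<phi>
              \<and> (\<forall>V x. finite V \<longrightarrow> x \<in> space Gc V \<longrightarrow>
                    coset_incl OST IST V (\<phi> V x) = \<psi> V x)))"
proof (intro conjI)
  \<comment> \<open>Both maps send an element to its fibre under \<open>unroot\<close>, so they are
    compatible by construction.\<close>
  let ?\<psi> = "\<lambda>V (a :: 'v mgraph \<Rightarrow>\<^sub>0 'k). {x \<in> space OST V. unroot V x = a}"
  let ?\<phi> = "\<lambda>V (a :: 'v mgraph \<Rightarrow>\<^sub>0 'k). {x \<in> space OSTG V. unroot V x = a}"
  have psi: "?\<psi> V (unroot V x) = coset OST IST V x" if "finite V" "x \<in> space OST V"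
    for V and x :: "'v omgraph \<times> 'v \<Rightarrow>\<^sub>0 'k"
    using OST.coset_eq[OF that] by simp
  have tree: "?\<psi> V x = coset OST IST V (psi_tree V x)" if "finite V" "x \<in> space T V"
    for V and x :: "'v mgraph \<Rightarrow>\<^sub>0 'k"
    using psi[OF that(1) subsetD[OF space_PLie_O_subset psi_tree_props(1)[OF that]]]
      psi_tree_props(2)[OF that] by simp
  \<comment> \<open>The trees \<open>t r\<close> disappear when labels are forgotten, so every
    choice lands in the fibre over \<open>basis g\<close>.\<close>
  have graph: "?\<psi> V (basis g) = coset OST IST V (\<Sum>r\<in>V. basis (orientation g (t r) r, r))"
    if V: "finite V" and g: "connected_on V g" and t: "\<forall>r\<in>V. spanning_tree V g (t r)" for V g t
  proof -
    let ?x = "\<Sum>r\<in>V. basis (orientation g (t r) r, r) :: _ \<Rightarrow>\<^sub>0 'k"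
    have x: "?x \<in> space OST V"
      unfolding OST_def sub_data_sel by (rule free.span_base) (use g t in blast)
    have "unorient ?x = all_roots V (basis g)"
      using t underlying_orientation[OF V] by (simp add: unorient_simps all_roots_simps)
    then have "unroot V ?x = basis g"
      using V g by (intro unrootI) (auto simp: connected_on_def)
    with psi[OF V x] show ?thesis by simp
  qed
  \<comment> \<open>The smaller fibre is nonempty and all its elements have the same class modulo
    \<I>, so the union in \<open>coset_incl\<close> is that one class.\<close>
  have incl: "coset_incl OST IST V (?\<phi> V a) = ?\<psi> V a" if V: "finite V" and a: "a \<in> space Gc V" for V a
  proof -
    obtain x where x: "x \<in> space OSTG V" "unroot V x = a"
      using OSTG.onto[OF V] a by (metis imageE)
    have "coset OST IST V y = ?\<psi> V a" if "y \<in> ?\<phi> V a" for y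
      using psi[OF V subsetD[OF space_OSTG_subset, of y]] that by simp
    then show ?thesis
      unfolding coset_incl_def using x by (intro UN1_const[of x]) auto
  qed
  show "\<exists>\<psi> :: 'v set \<Rightarrow> ('v mgraph \<Rightarrow>\<^sub>0 'k) \<Rightarrow> ('v omgraph \<times> 'v \<Rightarrow>\<^sub>0 'k) set.
        operad_iso MGc (quotient OST IST) \<psi>
        \<and> (\<forall>V x. finite V \<longrightarrow> x \<in> space T V \<longrightarrow> \<psi> V x = coset OST IST V (psi_tree V x))
        \<and> (\<forall>V g t. finite V \<longrightarrow> connected_on V g \<longrightarrow> (\<forall>r\<in>V. spanning_tree V g (t r)) \<longrightarrow>
              \<psi> V (basis g) = coset OST IST V (\<Sum>r\<in>V. basis (orientation g (t r) r, r)))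
        \<and> (\<exists>\<phi>. operad_iso Gc (quotient OSTG ISTG) \<phi>
              \<and> (\<forall>V x. finite V \<longrightarrow> x \<in> space Gc V \<longrightarrow>
                    coset_incl OST IST V (\<phi> V x) = \<psi> V x))"
  proof (rule exI[of _ ?\<psi>], intro conjI allI impI)
    show "operad_iso MGc (quotient OST IST) ?\<psi>" by (rule OST.operad_iso_fibre)
    show "\<exists>\<phi>. operad_iso Gc (quotient OSTG ISTG) \<phi>
        \<and> (\<forall>V x. finite V \<longrightarrow> x \<in> space Gc V \<longrightarrow> coset_incl OST IST V (\<phi> V x) = ?\<psi> V x)"
    proof (intro exI[of _ ?\<phi>] conjI allI impI)
      show "operad_iso Gc (quotient OSTG ISTG) ?\<phi>" by (rule OSTG.operad_iso_fibre)
    qed (rule incl)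
  qed (rule tree graph; assumption)+
qed (use IST_PLie in \<open>auto intro: embedding_PLie_ST operad_iso_psi_tree OST.operad_ideal
    embedding_PLie_O_quotient OSTG.operad_ideal\<close>)

end
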